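(* Let $m\geq n\geq1$, let $\mathbf{A}$ be a real $m\times n$ matrix with singular values $\sigma_1(\mathbf{A})\ge\cdots\ge\sigma_n(\mathbf{A})\ge0$, let $k\geq1$ be an integer, and choose an oversampling parameter $p\geq4$. Let $\mathbf{K}\in\mathbb{R}^{n\times n}$ be a symmetric positive semi-definite matrix with largest eigenvalue $\lambda_1$ and $k$th largest eigenvalue $\lambda_k>0$. If $\mathbf{\Omega}\in\mathbb{R}^{n\times(k+p)}$ is a Gaussian random matrix, where each column is i.i.d. from a multivariate Gaussian distribution with mean zero and covariance matrix $\mathbf{K}$, and $\mathbf{Q}\mathbf{R}=\mathbf{A}\mathbf{\Omega}$ is the economized QR decomposition of $\mathbf{A}\mathbf{\Omega}$, then for all $u,t\geq1$, $$\|\mathbf{A}-\mathbf{Q}\mathbf{Q}^*\mathbf{A}\|_{\mathrm{F}}\leq\left(1+ut\sqrt{(k+p)\frac{3k}{p+1}\frac{\beta_k}{\gamma_k}}\right)\sqrt{\sum_{j=k+1}^n\sigma_j^2(\mathbf{A})},$$ with failure probability at most $t^{-p}+[ue^{-(u^2-1)/2}]^{k+p}$, where $$\gamma_k=\frac{k}{\lambda_1\operatorname{Tr}((\mathbf{V}_1^*\mathbf{K}\mathbf{V}_1)^{-1})},\qquad\beta_k=\frac{\operatorname{Tr}(\mathbf{\Sigma}_2^2\mathbf{V}_2^*\mathbf{K}\mathbf{V}_2)}{\lambda_1\|\mathbf{\Sigma}_2\|_{\mathrm{F}}^2}.$$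
   Context: Let $\mathbf{A}=\mathbf{U}\mathbf{\Sigma}\mathbf{V}^*$ be a singular value decomposition, with $\mathbf{V}$ an $n\times n$ orthogonal matrix. $\mathbf{V}_1$ is the $n\times k$ matrix of the first $k$ columns of $\mathbf{V}$ and $\mathbf{V}_2$ the $n\times(n-k)$ matrix of the remaining columns. $\mathbf{\Sigma}_2$ is the $(n-k)\times(n-k)$ diagonal matrix with entries $\sigma_{k+1}(\mathbf{A}),\ldots,\sigma_n(\mathbf{A})$. $\|\cdot\|_{\mathrm{F}}$ is the Frobenius norm. It is implicit that $\gamma_k$ and $\beta_k$ are well defined, i.e. $\mathbf{V}_1^*\mathbf{K}\mathbf{V}_1$ is invertible and $\mathbf{\Sigma}_2\neq0$. *)

theory Defs
  imports
    "HOL-Probability.Probability"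
    "Jordan_Normal_Form.Gauss_Jordan_Elimination"
    "Jordan_Normal_Form.Char_Poly"
begin

definition trace_mat :: "real mat \<Rightarrow> real" where
  "trace_mat B = (\<Sum>i<dim_row B. B $$ (i, i))"

definition frobenius_norm :: "real mat \<Rightarrow> real" where
  "frobenius_norm B = sqrt (\<Sum>i<dim_row B. \<Sum>j<dim_col B. (B $$ (i, j))\<^sup>2)"

definition orthonormal_cols :: "real mat \<Rightarrow> bool" where
  "orthonormal_cols B \<longleftrightarrow> transpose_mat B * B = 1\<^sub>m (dim_col B)"

definition sym_psd_mat :: "nat \<Rightarrow> real mat \<Rightarrow> bool" where
  "sym_psd_mat n K \<longleftrightarrow>
     K \<in> carrier_mat n n \<and> transpose_mat K = K \<and>
     (\<forall>x\<in>carrier_vec n. 0 \<le> scalar_prod x (K *\<^sub>v x))"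

text \<open>The sequences \<open>lam\<close> (eigenvalues) and \<open>\<sigma>\<close> (singular values) below are indexed from
  \<open>1\<close> to \<open>n\<close>, in contrast to matrix entries, which are indexed from \<open>0\<close>.
  Eigenvalues are listed with algebraic multiplicity.\<close>

definition eigenvalues_decreasing :: "nat \<Rightarrow> real mat \<Rightarrow> (nat \<Rightarrow> real) \<Rightarrow> bool" where
  "eigenvalues_decreasing n K lam \<longleftrightarrow>
     char_poly K = (\<Prod>i=1..n. [:- lam i, 1:]) \<and>
     (\<forall>i j. 1 \<le> i \<longrightarrow> i \<le> j \<longrightarrow> j \<le> n \<longrightarrow> lam j \<le> lam i)"

definition is_svd :: "nat \<Rightarrow> nat \<Rightarrow> real mat \<Rightarrow> real mat \<Rightarrow> (nat \<Rightarrow> real) \<Rightarrow> real mat \<Rightarrow> bool" where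
  "is_svd m n A U \<sigma> V \<longleftrightarrow>
     U \<in> carrier_mat m n \<and> orthonormal_cols U \<and>
     V \<in> carrier_mat n n \<and> orthonormal_cols V \<and>
     (\<forall>i j. 1 \<le> i \<longrightarrow> i \<le> j \<longrightarrow> j \<le> n \<longrightarrow> \<sigma> j \<le> \<sigma> i) \<and>
     (\<forall>i. 1 \<le> i \<longrightarrow> i \<le> n \<longrightarrow> 0 \<le> \<sigma> i) \<and>
     A = U * mat_diag n (\<lambda>i. \<sigma> (i + 1)) * transpose_mat V"

definition V1_mat :: "nat \<Rightarrow> nat \<Rightarrow> real mat \<Rightarrow> real mat" where
  "V1_mat n k V = Matrix.mat n k (\<lambda>(i, j). V $$ (i, j))"

definition V2_mat :: "nat \<Rightarrow> nat \<Rightarrow> real mat \<Rightarrow> real mat" where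
  "V2_mat n k V = Matrix.mat n (n - k) (\<lambda>(i, j). V $$ (i, k + j))"

definition Sigma2_mat :: "nat \<Rightarrow> nat \<Rightarrow> (nat \<Rightarrow> real) \<Rightarrow> real mat" where
  "Sigma2_mat n k \<sigma> = mat_diag (n - k) (\<lambda>i. \<sigma> (k + i + 1))"

definition gamma_k :: "nat \<Rightarrow> nat \<Rightarrow> real mat \<Rightarrow> real mat \<Rightarrow> real \<Rightarrow> real" where
  "gamma_k n k V K lam1 =
     real k / (lam1 * trace_mat (the (mat_inverse (transpose_mat (V1_mat n k V) * K * V1_mat n k V))))"

definition beta_k :: "nat \<Rightarrow> nat \<Rightarrow> (nat \<Rightarrow> real) \<Rightarrow> real mat \<Rightarrow> real mat \<Rightarrow> real \<Rightarrow> real" where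
  "beta_k n k \<sigma> V K lam1 =
     trace_mat (Sigma2_mat n k \<sigma> * Sigma2_mat n k \<sigma> * transpose_mat (V2_mat n k V) * K * V2_mat n k V) /
     (lam1 * (frobenius_norm (Sigma2_mat n k \<sigma>))\<^sup>2)"

text \<open>The factor \<open>R\<close> is upper trapezoidal if \<open>B\<close> has more columns than rows. \<open>B\<close> may be rank
  deficient, in which case neither \<open>Q\<close> nor its range is determined by \<open>B\<close>.\<close>

definition economized_qr :: "real mat \<Rightarrow> real mat \<Rightarrow> real mat \<Rightarrow> bool" where
  "economized_qr B Q R \<longleftrightarrow>
     Q \<in> carrier_mat (dim_row B) (min (dim_row B) (dim_col B)) \<and> orthonormal_cols Q \<and>
     R \<in> carrier_mat (min (dim_row B) (dim_col B)) (dim_col B) \<and> upper_triangular R \<and>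
     Q * R = B"

text \<open>A point mass counts as a Gaussian distribution of variance \<open>0\<close>, which is needed for
  singular covariance matrices.\<close>

definition gaussian_rv :: "'w measure \<Rightarrow> ('w \<Rightarrow> real) \<Rightarrow> bool" where
  "gaussian_rv M X \<longleftrightarrow>
     X \<in> borel_measurable M \<and>
     ((\<exists>\<mu>. AE \<omega> in M. X \<omega> = \<mu>) \<or>
      (\<exists>\<mu> s. 0 < s \<and> distributed M lborel X (\<lambda>x. ennreal (normal_density \<mu> s x))))"

definition multivariate_gaussian ::
    "'w measure \<Rightarrow> nat \<Rightarrow> ('w \<Rightarrow> real vec) \<Rightarrow> real vec \<Rightarrow> real mat \<Rightarrow> bool" where
  "multivariate_gaussian M n X \<mu> C \<longleftrightarrow>
     (\<forall>\<omega>\<in>space M. X \<omega> \<in> carrier_vec n) \<and>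
     (\<forall>a\<in>carrier_vec n. gaussian_rv M (\<lambda>\<omega>. scalar_prod a (X \<omega>))) \<and>
     (\<forall>i<n. integral\<^sup>L M (\<lambda>\<omega>. vec_index (X \<omega>) i) = vec_index \<mu> i) \<and>
     (\<forall>i<n. \<forall>j<n.
        integral\<^sup>L M (\<lambda>\<omega>. (vec_index (X \<omega>) i - vec_index \<mu> i) * (vec_index (X \<omega>) j - vec_index \<mu> j))
          = C $$ (i, j))"

definition gaussian_random_matrix ::
    "'w measure \<Rightarrow> nat \<Rightarrow> nat \<Rightarrow> ('w \<Rightarrow> real mat) \<Rightarrow> real mat \<Rightarrow> bool" where
  "gaussian_random_matrix M n l \<Omega> K \<longleftrightarrow>
     (\<forall>\<omega>\<in>space M. \<Omega> \<omega> \<in> carrier_mat n l) \<and>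
     (\<forall>j<l. multivariate_gaussian M n (\<lambda>\<omega>. col (\<Omega> \<omega>) j) (0\<^sub>v n) K) \<and>
     prob_space.indep_vars M (\<lambda>_. \<Pi>\<^sub>M i\<in>{..<n}. borel)
       (\<lambda>j \<omega>. \<lambda>i\<in>{..<n}. \<Omega> \<omega> $$ (i, j)) {..<l}"

end

theory Submission
  imports Defs
begin

text \<open>Write \<open>\<Omega>\<^sub>1 = V\<^sub>1\<^sup>* \<Omega>\<close> and \<open>\<Omega>\<^sub>2 = V\<^sub>2\<^sup>* \<Omega>\<close>. For every right inverse \<open>G\<close> of \<open>\<Omega>\<^sub>1\<close>, the range of \<open>Q\<close> contains
  that of \<open>A \<Omega> G V\<^sub>1\<^sup>*\<close>, so the error is at most the norm of \<open>A - A \<Omega> G V\<^sub>1\<^sup>*\<close>, which is at most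
  \<open>\<parallel>\<Sigma>\<^sub>2\<parallel> + \<parallel>\<Sigma>\<^sub>2 \<Omega>\<^sub>2\<parallel> \<parallel>G\<parallel>\<close> (Frobenius norms). The two factors are controlled separately, so no
  independence of \<open>\<Omega>\<^sub>1\<close> and \<open>\<Omega>\<^sub>2\<close> is needed.

  For \<open>\<parallel>\<Sigma>\<^sub>2 \<Omega>\<^sub>2\<parallel>\<close> this is a Chernoff bound over the independent columns. For \<open>\<parallel>G\<parallel>\<close>, take as
  column \<open>i\<close> of \<open>G\<close> the minimal vector dual to row \<open>i\<close> of \<open>\<Omega>\<^sub>1\<close>: its squared norm is \<open>S\<^sup>-\<^sup>1\<^sub>i\<^sub>i / D\<close>,
  where \<open>S = V\<^sub>1\<^sup>* K V\<^sub>1\<close> and \<open>D\<close> is the squared distance of a standard Gaussian vector, independent of the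
  other \<open>k - 1\<close> rows, to the span of these rows. Hence \<open>D\<close> dominates a chi-square variable with \<open>p + 1\<close>
  degrees of freedom, and Markov's inequality applies to its moment of order \<open>- p / 2\<close>.\<close>

section \<open>Uniqueness of joint characteristic functions\<close>

lemma (in prob_space) distr_weighted:
  fixes h X :: "'a \<Rightarrow> real"
  assumes [measurable]: "h \<in> borel_measurable M" "X \<in> borel_measurable M"
    and nonneg: "\<And>x. 0 \<le> h x" and int: "integrable M h" and pos: "0 < expectation h"
  defines "D \<equiv> distr (density M (\<lambda>x. ennreal (h x / expectation h))) borel X"
  shows "real_distribution D"
    and "char D s = (\<integral>x. complex_of_real (h x) * iexp (s * X x) \<partial>M) / expectation h"
    and "S \<in> sets borel \<Longrightarrow> measure D S = (\<integral>x. h x * indicator S (X x) \<partial>M) / expectation h"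
proof -
  define P where "P = density M (\<lambda>x. ennreal (h x / expectation h))"
  have D: "D = distr P borel X" by (simp add: D_def P_def)
  have [measurable]: "X \<in> borel_measurable P" by (simp add: P_def)
  have "emeasure P (space P) = 1"
    unfolding P_def using pos nonneg int by (simp add: emeasure_density nn_integral_eq_integral)
  then interpret P: prob_space P by (rule prob_spaceI)
  show "real_distribution D"
    unfolding D by (rule P.real_distribution_distr) simp
  have "char D s = (\<integral>x. (h x / expectation h) *\<^sub>R iexp (s * X x) \<partial>M)"
    unfolding D char_def P_def
    using nonneg pos by (subst integral_distr) (simp_all add: integral_density)
  also have "\<dots> = (\<integral>x. complex_of_real (h x) * iexp (s * X x) / complex_of_real (expectation h) \<partial>M)"
    by (intro Bochner_Integration.integral_cong) (auto simp: scaleR_conv_of_real)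
  finally show "char D s = (\<integral>x. complex_of_real (h x) * iexp (s * X x) \<partial>M) / expectation h" by simp
  assume [measurable]: "S \<in> sets borel"
  have "measure D S = (\<integral>y. indicator S y \<partial>D)" by (simp add: D)
  also have "\<dots> = (\<integral>x. h x / expectation h * indicator S (X x) \<partial>M)"
    unfolding D P_def using nonneg pos by (subst integral_distr) (simp_all add: integral_density)
  finally show "measure D S = (\<integral>x. h x * indicator S (X x) \<partial>M) / expectation h" by simp
qed

lemma (in pair_prob_space) nonneg_weighted_char_unique:
  fixes h X :: "'a \<Rightarrow> real" and h' Y :: "'b \<Rightarrow> real"
  assumes [measurable]: "h \<in> borel_measurable M1" "X \<in> borel_measurable M1"
      "h' \<in> borel_measurable M2" "Y \<in> borel_measurable M2"
    and h: "\<And>x. 0 \<le> h x" "integrable M1 h" and h': "\<And>x. 0 \<le> h' x" "integrable M2 h'"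
    and eq: "\<And>s. (\<integral>x. complex_of_real (h x) * iexp (s * X x) \<partial>M1)
                  = (\<integral>x. complex_of_real (h' x) * iexp (s * Y x) \<partial>M2)"
    and S: "S \<in> sets borel"
  shows "(\<integral>x. h x * indicator S (X x) \<partial>M1) = (\<integral>x. h' x * indicator S (Y x) \<partial>M2)"
proof -
  have "complex_of_real (M1.expectation h) = complex_of_real (M2.expectation h')"
    using eq[of 0] by (simp add: integral_complex_of_real)
  then have total: "M1.expectation h = M2.expectation h'" by (simp only: of_real_eq_iff)
  show ?thesis
  proof (cases "M1.expectation h = 0")
    case True
    then have "AE x in M1. h x = 0" "AE x in M2. h' x = 0"
      using integral_nonneg_eq_0_iff_AE[OF h(2)] integral_nonneg_eq_0_iff_AE[OF h'(2)] h h' total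
      by auto
    then have "AE x in M1. h x * indicator S (X x) = 0" "AE x in M2. h' x * indicator S (Y x) = 0"
      by auto
    then show ?thesis by (simp add: integral_eq_zero_AE)
  next
    case False
    moreover have "0 \<le> M1.expectation h" using h by simp
    ultimately have pos: "0 < M1.expectation h" "0 < M2.expectation h'" using total by simp_all
    note M1 = M1.distr_weighted[OF assms(1,2) h pos(1)]
      and M2 = M2.distr_weighted[OF assms(3,4) h' pos(2)]
    have "distr (density M1 (\<lambda>x. ennreal (h x / M1.expectation h))) borel X
        = distr (density M2 (\<lambda>x. ennreal (h' x / M2.expectation h'))) borel Y"
      by (rule Levy_uniqueness[OF M1(1) M2(1)])
        (rule ext, rule trans[OF M1(2) trans[OF _ M2(2)[symmetric]]], simp only: eq total)
    then show ?thesis using M1(3)[OF S] M2(3)[OF S] pos total by simp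
  qed
qed

text \<open>Adding a constant makes a bounded real weight nonnegative; this is why the laws of \<open>X\<close> and \<open>Y\<close>
  have to agree.\<close>

lemma (in pair_prob_space) real_weighted_char_unique:
  fixes h X :: "'a \<Rightarrow> real" and h' Y :: "'b \<Rightarrow> real"
  assumes [measurable]: "h \<in> borel_measurable M1" "X \<in> borel_measurable M1"
      "h' \<in> borel_measurable M2" "Y \<in> borel_measurable M2"
    and h: "\<And>x. \<bar>h x\<bar> \<le> c" and h': "\<And>y. \<bar>h' y\<bar> \<le> c"
    and char: "\<And>s. (\<integral>x. iexp (s * X x) \<partial>M1) = (\<integral>y. iexp (s * Y y) \<partial>M2)"
    and eq: "\<And>s. (\<integral>x. complex_of_real (h x) * iexp (s * X x) \<partial>M1)
                = (\<integral>y. complex_of_real (h' y) * iexp (s * Y y) \<partial>M2)"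
    and [measurable]: "S \<in> sets borel"
  shows "(\<integral>x. h x * indicator S (X x) \<partial>M1) = (\<integral>y. h' y * indicator S (Y y) \<partial>M2)"
proof -
  have c: "0 \<le> c" using h abs_ge_zero by (rule order_trans[rotated])
  have [simp]: "integrable M1 h" "integrable M2 h'"
    "integrable M1 (\<lambda>x. h x * indicator S (X x))" "integrable M2 (\<lambda>y. h' y * indicator S (Y y))"
    "integrable M1 (\<lambda>x. h x * iexp (s * X x))" "integrable M2 (\<lambda>y. h' y * iexp (s * Y y))" for s
    by (auto intro!: M1.integrable_const_bound[where B=c] M2.integrable_const_bound[where B=c]
        simp: h h' norm_mult c split: split_indicator)
  have [simp]: "integrable M1 (\<lambda>x. indicator S (X x) :: real)" "integrable M1 (\<lambda>x. iexp (s * X x))"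
    "integrable M2 (\<lambda>y. indicator S (Y y) :: real)" "integrable M2 (\<lambda>y. iexp (s * Y y))" for s
    by (auto intro!: M1.integrable_const_bound[where B=1] M2.integrable_const_bound[where B=1]
        split: split_indicator)
  have "0 \<le> h x + c" "0 \<le> h' y + c" for x y using h[of x] h'[of y] by auto
  then have "(\<integral>x. (h x + c) * indicator S (X x) \<partial>M1) = (\<integral>y. (h' y + c) * indicator S (Y y) \<partial>M2)"
    by (intro nonneg_weighted_char_unique) (simp_all add: distrib_right eq char del: of_real_mult)
  moreover have "(\<integral>x. c * indicator S (X x) \<partial>M1) = (\<integral>y. c * indicator S (Y y) \<partial>M2)"
    using c by (intro nonneg_weighted_char_unique) (simp_all add: char del: of_real_mult)
  ultimately show ?thesis by (auto simp: distrib_right)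
qed

lemma (in pair_prob_space) complex_weighted_char_unique:
  fixes g :: "'a \<Rightarrow> complex" and g' :: "'b \<Rightarrow> complex" and X :: "'a \<Rightarrow> real" and Y :: "'b \<Rightarrow> real"
  assumes [measurable]: "g \<in> borel_measurable M1" "X \<in> borel_measurable M1"
      "g' \<in> borel_measurable M2" "Y \<in> borel_measurable M2"
    and g: "\<And>x. cmod (g x) \<le> c" and g': "\<And>y. cmod (g' y) \<le> c"
    and char: "\<And>s. (\<integral>x. iexp (s * X x) \<partial>M1) = (\<integral>y. iexp (s * Y y) \<partial>M2)"
    and eq: "\<And>s. (\<integral>x. g x * iexp (s * X x) \<partial>M1) = (\<integral>y. g' y * iexp (s * Y y) \<partial>M2)"
    and [measurable]: "S \<in> sets borel"
  shows "(\<integral>x. g x * indicator S (X x) \<partial>M1) = (\<integral>y. g' y * indicator S (Y y) \<partial>M2)"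
proof -
  have c: "0 \<le> c" using g norm_ge_zero by (rule order_trans[rotated])
  have [measurable]: "cnj \<in> borel_measurable borel"
    by (intro borel_measurable_continuous_onI continuous_intros)
  have cnj_eq: "(\<integral>x. cnj (g x) * iexp (s * X x) \<partial>M1) = (\<integral>y. cnj (g' y) * iexp (s * Y y) \<partial>M2)" for s
  proof -
    have "(\<integral>x. cnj (g x * iexp (- s * X x)) \<partial>M1) = (\<integral>y. cnj (g' y * iexp (- s * Y y)) \<partial>M2)"
      by (simp only: Bochner_Integration.integral_cnj eq)
    then show ?thesis by (simp add: exp_cnj)
  qed
  have [simp]: "integrable M1 (\<lambda>x. g x * iexp (s * X x))"
    "integrable M2 (\<lambda>y. g' y * iexp (s * Y y))"
    "integrable M1 (\<lambda>x. cnj (g x) * iexp (s * X x))"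
    "integrable M2 (\<lambda>y. cnj (g' y) * iexp (s * Y y))"
    "integrable M1 (\<lambda>x. g x * indicator S (X x))"
    "integrable M2 (\<lambda>y. g' y * indicator S (Y y))" for s
    using c
    by (auto intro!: M1.integrable_const_bound[where B=c] M2.integrable_const_bound[where B=c]
        simp: g g' norm_mult split: split_indicator)
  have Re_Im: "complex_of_real (Re z) * w = (z * w + cnj z * w) / 2"
    "complex_of_real (Im z) * w = (z * w - cnj z * w) / (2 * \<i>)" for z w
    by (simp_all add: complex_eq_iff)
  have "(\<integral>x. Re (g x) * indicator S (X x) \<partial>M1) = (\<integral>y. Re (g' y) * indicator S (Y y) \<partial>M2)"
    by (rule real_weighted_char_unique)
      (auto simp: Re_Im eq cnj_eq char simp del: of_real_mult
        intro: order_trans[OF abs_Re_le_cmod] g g')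
  moreover have "(\<integral>x. Im (g x) * indicator S (X x) \<partial>M1) = (\<integral>y. Im (g' y) * indicator S (Y y) \<partial>M2)"
    by (rule real_weighted_char_unique)
      (auto simp: Re_Im eq cnj_eq char simp del: of_real_mult
        intro: order_trans[OF abs_Im_le_cmod] g g')
  moreover have "Re (z * indicator S r) = Re z * indicator S r"
    "Im (z * indicator S r) = Im z * indicator S r" for z r
    by (simp_all split: split_indicator)
  ultimately show ?thesis
    by (simp add: complex_eq_iff flip: integral_Re integral_Im)
qed

lemma (in pair_prob_space) joint_char_unique_mixed:
  fixes X :: "'i \<Rightarrow> 'a \<Rightarrow> real" and Y :: "'i \<Rightarrow> 'b \<Rightarrow> real"
  assumes "finite A" and "finite B" and "A \<inter> B = {}"
    and "\<And>i. i \<in> A \<union> B \<Longrightarrow> X i \<in> borel_measurable M1"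
    and "\<And>i. i \<in> A \<union> B \<Longrightarrow> Y i \<in> borel_measurable M2"
    and "\<And>t. (\<integral>x. iexp (\<Sum>i\<in>A \<union> B. t i * X i x) \<partial>M1) = (\<integral>y. iexp (\<Sum>i\<in>A \<union> B. t i * Y i y) \<partial>M2)"
    and "\<And>i. i \<in> A \<Longrightarrow> S i \<in> sets borel"
  shows "(\<integral>x. (\<Prod>i\<in>A. indicator (S i) (X i x)) * iexp (\<Sum>i\<in>B. t i * X i x) \<partial>M1)
       = (\<integral>y. (\<Prod>i\<in>A. indicator (S i) (Y i y)) * iexp (\<Sum>i\<in>B. t i * Y i y) \<partial>M2)"
  using assms
proof (induction A arbitrary: B t)
  case empty
  then show ?case by simp
next
  case (insert b A B t)
  have B: "finite B" "b \<notin> B" and AB: "insert b A \<union> B = A \<union> insert b B" using insert.prems by auto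
  note [measurable] = insert.prems(3,4,6)
  define weight :: "('i \<Rightarrow> real) \<Rightarrow> complex"
    where "weight z = (\<Prod>i\<in>A. indicator (S i) (z i)) * iexp (\<Sum>i\<in>B. t i * z i)" for z
  have sum_upd: "(\<Sum>i\<in>insert b B. (t(b := s)) i * z i) = s * z b + (\<Sum>i\<in>B. t i * z i)"
    for s and z :: "'i \<Rightarrow> real"
    using B by (simp add: sum.insert cong: sum.cong_simp) (auto intro!: sum.cong)
  have sum_only: "(\<Sum>i\<in>insert b A \<union> B. (if i = b then s else 0) * z i) = s * z b"
    for s and z :: "'i \<Rightarrow> real"
    using insert.hyps B by (simp add: if_distrib[of "\<lambda>x. x * _"] sum.delta cong: if_cong)
  have "(\<integral>x. weight (\<lambda>i. X i x) * indicator (S b) (X b x) \<partial>M1)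
      = (\<integral>y. weight (\<lambda>i. Y i y) * indicator (S b) (Y b y) \<partial>M2)"
  proof (rule complex_weighted_char_unique[where c=1])
    show "(\<lambda>x. weight (\<lambda>i. X i x)) \<in> borel_measurable M1"
      "(\<lambda>y. weight (\<lambda>i. Y i y)) \<in> borel_measurable M2"
      unfolding weight_def by measurable
    show "cmod (weight (\<lambda>i. X i x)) \<le> 1" "cmod (weight (\<lambda>i. Y i y)) \<le> 1" for x y
      by (auto simp: weight_def norm_mult prod_norm[symmetric]
          intro!: prod_le_1 split: split_indicator)
    show "(\<integral>x. iexp (s * X b x) \<partial>M1) = (\<integral>y. iexp (s * Y b y) \<partial>M2)" for s
      using insert.prems(5)[of "\<lambda>i. if i = b then s else 0"] unfolding sum_only .
    show "(\<integral>x. weight (\<lambda>i. X i x) * iexp (s * X b x) \<partial>M1)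
        = (\<integral>y. weight (\<lambda>i. Y i y) * iexp (s * Y b y) \<partial>M2)" for s
    proof -
      have "(\<integral>x. (\<Prod>i\<in>A. indicator (S i) (X i x)) * iexp (\<Sum>i\<in>insert b B. (t(b := s)) i * X i x) \<partial>M1)
          = (\<integral>y. (\<Prod>i\<in>A. indicator (S i) (Y i y)) * iexp (\<Sum>i\<in>insert b B. (t(b := s)) i * Y i y) \<partial>M2)"
        using insert.prems insert.hyps by (intro insert.IH) (auto simp: AB[symmetric])
      then show ?thesis
        unfolding sum_upd by (simp add: weight_def exp_add distrib_left mult_ac)
    qed
  qed (use insert.prems in auto)
  then show ?case using insert.hyps by (simp add: weight_def mult_ac)
qed

lemma indicator_PiE_restrict:
  assumes "finite I"
  shows "indicator (Pi\<^sub>E I S) (restrict f I) = (\<Prod>i\<in>I. indicator (S i) (f i) :: 'a :: semidom)"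
  using assms by (cases "\<forall>i\<in>I. f i \<in> S i") (auto simp: indicator_def restrict_PiE_iff)

proposition (in pair_prob_space) joint_char_unique:
  fixes X :: "'i \<Rightarrow> 'a \<Rightarrow> real" and Y :: "'i \<Rightarrow> 'b \<Rightarrow> real"
  assumes I: "finite I"
    and X: "\<And>i. i \<in> I \<Longrightarrow> X i \<in> borel_measurable M1"
    and Y: "\<And>i. i \<in> I \<Longrightarrow> Y i \<in> borel_measurable M2"
    and "\<And>t. (\<integral>x. iexp (\<Sum>i\<in>I. t i * X i x) \<partial>M1) = (\<integral>y. iexp (\<Sum>i\<in>I. t i * Y i y) \<partial>M2)"
  shows "distr M1 (\<Pi>\<^sub>M i\<in>I. borel) (\<lambda>x. \<lambda>i\<in>I. X i x) = distr M2 (\<Pi>\<^sub>M i\<in>I. borel) (\<lambda>y. \<lambda>i\<in>I. Y i y)"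
    (is "?DX = ?DY")
proof (rule measure_eqI_PiM_finite[OF I])
  have [measurable]: "(\<lambda>x. \<lambda>i\<in>I. X i x) \<in> M1 \<rightarrow>\<^sub>M (\<Pi>\<^sub>M i\<in>I. borel)"
    "(\<lambda>y. \<lambda>i\<in>I. Y i y) \<in> M2 \<rightarrow>\<^sub>M (\<Pi>\<^sub>M i\<in>I. borel)"
    using X Y by (auto intro: measurable_restrict)
  interpret DX: prob_space ?DX by (rule M1.prob_space_distr) simp
  interpret DY: prob_space ?DY by (rule M2.prob_space_distr) simp
  show "range (\<lambda>_::nat. \<Pi>\<^sub>E i\<in>I. UNIV) \<subseteq> prod_algebra I (\<lambda>i. borel::real measure)"
    using I by (auto intro!: prod_algebraI_finite)
  show "(\<Union>n::nat. \<Pi>\<^sub>E i\<in>I. UNIV) = space (Pi\<^sub>M I (\<lambda>i. borel::real measure))"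
    by (simp add: space_PiM)
  show "emeasure ?DX (\<Pi>\<^sub>E i\<in>I. UNIV) \<noteq> \<infinity>" for n :: nat
    by (simp add: DX.emeasure_eq_measure)
  fix S :: "'i \<Rightarrow> real set" assume S: "\<And>i. i \<in> I \<Longrightarrow> S i \<in> sets borel"
  then have [measurable]: "Pi\<^sub>E I S \<in> sets (\<Pi>\<^sub>M i\<in>I. borel)" using I by (intro sets_PiM_I_finite) auto
  have "complex_of_real (\<integral>x. (\<Prod>i\<in>I. indicator (S i) (X i x)) \<partial>M1)
      = complex_of_real (\<integral>y. (\<Prod>i\<in>I. indicator (S i) (Y i y)) \<partial>M2)"
    using joint_char_unique_mixed[of I "{}" X Y S] assms S
    by (simp add: of_real_indicator flip: integral_complex_of_real)
  then have boxes: "(\<integral>x. (\<Prod>i\<in>I. indicator (S i) (X i x) :: real) \<partial>M1)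
      = (\<integral>y. (\<Prod>i\<in>I. indicator (S i) (Y i y)) \<partial>M2)"
    by (simp only: of_real_eq_iff)
  have "measure ?DX (Pi\<^sub>E I S) = (\<integral>z. indicator (Pi\<^sub>E I S) z \<partial>?DX)" by simp
  also have "\<dots> = (\<integral>z. indicator (Pi\<^sub>E I S) z \<partial>?DY)"
    by (subst (1 2) integral_distr) (simp_all add: indicator_PiE_restrict I boxes)
  also have "\<dots> = measure ?DY (Pi\<^sub>E I S)" by simp
  finally show "emeasure ?DX (Pi\<^sub>E I S) = emeasure ?DY (Pi\<^sub>E I S)"
    by (simp add: DX.emeasure_eq_measure DY.emeasure_eq_measure)
qed simp_all

lemma (in pair_prob_space) integral_iexp_add:
  assumes [measurable]: "f \<in> borel_measurable M1" "g \<in> borel_measurable M2"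
  shows "(\<integral>w. iexp (f (fst w) + g (snd w)) \<partial>(M1 \<Otimes>\<^sub>M M2))
      = (\<integral>x. iexp (f x) \<partial>M1) * (\<integral>y. iexp (g y) \<partial>M2)"
proof -
  have "integrable (M1 \<Otimes>\<^sub>M M2) (\<lambda>w. iexp (f (fst w)) * iexp (g (snd w)))"
    by (rule P.integrable_const_bound[where B=1]) (auto simp: norm_mult)
  then have "(\<integral>w. iexp (f (fst w)) * iexp (g (snd w)) \<partial>(M1 \<Otimes>\<^sub>M M2))
      = (\<integral>x. iexp (f x) \<partial>M1) * (\<integral>y. iexp (g y) \<partial>M2)"
    by (subst integral_fst'[symmetric]) simp_all
  then show ?thesis by (simp add: exp_add distrib_left)
qed

lemma distr_Plus_split:
  fixes X :: "'i \<Rightarrow> 'a \<Rightarrow> real" and Y :: "'j \<Rightarrow> 'a \<Rightarrow> real"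
  assumes X: "\<And>i. i \<in> I \<Longrightarrow> X i \<in> borel_measurable M"
    and Y: "\<And>j. j \<in> J \<Longrightarrow> Y j \<in> borel_measurable M"
  shows "distr (distr M (\<Pi>\<^sub>M c\<in>I <+> J. borel) (\<lambda>\<omega>. \<lambda>c\<in>I <+> J. case_sum X Y c \<omega>))
      ((\<Pi>\<^sub>M i\<in>I. borel) \<Otimes>\<^sub>M (\<Pi>\<^sub>M j\<in>J. borel)) (\<lambda>z. (\<lambda>i\<in>I. z (Inl i), \<lambda>j\<in>J. z (Inr j)))
    = distr M ((\<Pi>\<^sub>M i\<in>I. borel) \<Otimes>\<^sub>M (\<Pi>\<^sub>M j\<in>J. borel)) (\<lambda>\<omega>. (\<lambda>i\<in>I. X i \<omega>, \<lambda>j\<in>J. Y j \<omega>))"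
    (is "distr (distr M ?BS ?Z) ?BP ?split = distr M ?BP ?XY")
proof -
  have "?Z \<in> M \<rightarrow>\<^sub>M ?BS"
    using X Y by (intro measurable_restrict) auto
  moreover have "?split \<in> ?BS \<rightarrow>\<^sub>M ?BP"
    by (intro measurable_Pair measurable_restrict measurable_component_singleton) auto
  moreover have "?split \<circ> ?Z = ?XY"
    by (auto simp: fun_eq_iff)
  ultimately show ?thesis by (simp add: distr_distr)
qed

text \<open>Kac's theorem. (The constant \<open>indep_var\<close> would require \<open>X\<close> and \<open>Y\<close> to have the same type.)\<close>

proposition (in prob_space) distr_Pair_eq_pair_measure_if_char_factor:
  fixes X :: "'i \<Rightarrow> 'a \<Rightarrow> real" and Y :: "'j \<Rightarrow> 'a \<Rightarrow> real"
  assumes I: "finite I" and J: "finite J"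
    and X [measurable]: "\<And>i. i \<in> I \<Longrightarrow> X i \<in> borel_measurable M"
    and Y [measurable]: "\<And>j. j \<in> J \<Longrightarrow> Y j \<in> borel_measurable M"
    and factor: "\<And>s t. expectation (\<lambda>\<omega>. iexp ((\<Sum>i\<in>I. s i * X i \<omega>) + (\<Sum>j\<in>J. t j * Y j \<omega>)))
      = expectation (\<lambda>\<omega>. iexp (\<Sum>i\<in>I. s i * X i \<omega>)) * expectation (\<lambda>\<omega>. iexp (\<Sum>j\<in>J. t j * Y j \<omega>))"
  shows "distr M ((\<Pi>\<^sub>M i\<in>I. borel) \<Otimes>\<^sub>M (\<Pi>\<^sub>M j\<in>J. borel)) (\<lambda>\<omega>. (\<lambda>i\<in>I. X i \<omega>, \<lambda>j\<in>J. Y j \<omega>))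
    = distr M (\<Pi>\<^sub>M i\<in>I. borel) (\<lambda>\<omega>. \<lambda>i\<in>I. X i \<omega>) \<Otimes>\<^sub>M distr M (\<Pi>\<^sub>M j\<in>J. borel) (\<lambda>\<omega>. \<lambda>j\<in>J. Y j \<omega>)"
    (is "distr M (?BI \<Otimes>\<^sub>M ?BJ) _ = distr M _ ?X \<Otimes>\<^sub>M distr M _ ?Y")
proof -
  interpret MM: pair_prob_space M M ..
  interpret MMM: pair_prob_space M "M \<Otimes>\<^sub>M M" ..
  define X' where "X' i w = X i (fst w)" for i and w :: "'a \<times> 'a"
  define Y' where "Y' j w = Y j (snd w)" for j and w :: "'a \<times> 'a"
  have X' [measurable]: "X' i \<in> borel_measurable (M \<Otimes>\<^sub>M M)" if "i \<in> I" for i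
    using that unfolding X'_def[abs_def] by measurable
  have Y' [measurable]: "Y' j \<in> borel_measurable (M \<Otimes>\<^sub>M M)" if "j \<in> J" for j
    using that unfolding Y'_def[abs_def] by measurable
  have "distr M (\<Pi>\<^sub>M c\<in>I <+> J. borel) (\<lambda>\<omega>. \<lambda>c\<in>I <+> J. case_sum X Y c \<omega>)
      = distr (M \<Otimes>\<^sub>M M) (\<Pi>\<^sub>M c\<in>I <+> J. borel) (\<lambda>w. \<lambda>c\<in>I <+> J. case_sum X' Y' c w)"
  proof (rule MMM.joint_char_unique)
    fix t :: "'i + 'j \<Rightarrow> real"
    have sum_Plus: "(\<Sum>c\<in>I <+> J. t c * case_sum f g c w)
        = (\<Sum>i\<in>I. t (Inl i) * f i w) + (\<Sum>j\<in>J. t (Inr j) * g j w)"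
      for f g and w :: 'c
      using I J by (simp add: sum.Plus)
    show "expectation (\<lambda>\<omega>. iexp (\<Sum>c\<in>I <+> J. t c * case_sum X Y c \<omega>))
        = (\<integral>w. iexp (\<Sum>c\<in>I <+> J. t c * case_sum X' Y' c w) \<partial>(M \<Otimes>\<^sub>M M))"
      unfolding sum_Plus factor X'_def Y'_def by (rule MM.integral_iexp_add[symmetric]) measurable
  qed (use I J in auto)
  then have "distr M (?BI \<Otimes>\<^sub>M ?BJ) (\<lambda>\<omega>. (?X \<omega>, ?Y \<omega>))
      = distr (M \<Otimes>\<^sub>M M) (?BI \<Otimes>\<^sub>M ?BJ) (\<lambda>w. (\<lambda>i\<in>I. X' i w, \<lambda>j\<in>J. Y' j w))"
    using distr_Plus_split[of I X M J Y] distr_Plus_split[of I X' "M \<Otimes>\<^sub>M M" J Y'] X Y X' Y' by simp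
  also have "\<dots> = distr (M \<Otimes>\<^sub>M M) (?BI \<Otimes>\<^sub>M ?BJ) (\<lambda>(\<omega>, \<omega>'). (?X \<omega>, ?Y \<omega>'))"
    by (simp add: X'_def Y'_def case_prod_beta')
  also have "\<dots> = distr M ?BI ?X \<Otimes>\<^sub>M distr M ?BJ ?Y"
    by (rule pair_measure_distr[symmetric])
      (auto intro!: prob_space_imp_sigma_finite prob_space_distr measurable_restrict)
  finally show ?thesis .
qed

section \<open>Gaussian and chi-square integrals\<close>

interpretation std_normal: real_distribution std_normal_distribution
  by (rule real_dist_normal_dist)

lemma prob_space_PiM_std_normal: "prob_space (\<Pi>\<^sub>M i\<in>I. std_normal_distribution)"
  by (intro prob_space_PiM std_normal.prob_space_axioms)

lemma integral_iexp_PiM_std_normal: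
  assumes "finite I"
  shows "(\<integral>x. iexp (\<Sum>i\<in>I. s i * x i) \<partial>(\<Pi>\<^sub>M i\<in>I. std_normal_distribution))
    = complex_of_real (exp (- (\<Sum>i\<in>I. (s i)\<^sup>2) / 2))"
proof -
  interpret product_prob_space "\<lambda>_. std_normal_distribution" I ..
  have "(\<integral>x. iexp (\<Sum>i\<in>I. s i * x i) \<partial>(\<Pi>\<^sub>M i\<in>I. std_normal_distribution))
      = (\<integral>x. (\<Prod>i\<in>I. iexp (s i * x i)) \<partial>(\<Pi>\<^sub>M i\<in>I. std_normal_distribution))"
    using assms by (simp add: exp_sum sum_distrib_left)
  also have "\<dots> = (\<Prod>i\<in>I. char std_normal_distribution (s i))"
    unfolding char_def
    by (rule product_integral_prod[OF assms])
      (auto intro!: std_normal.integrable_const_bound[where B=1])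
  also have "\<dots> = complex_of_real (exp (- (\<Sum>i\<in>I. (s i)\<^sup>2) / 2))"
    using assms
    by (simp add: char_std_normal_distribution exp_sum sum_divide_distrib flip: sum_negf)
  finally show ?thesis .
qed

lemma (in prob_space) distr_eq_PiM_std_normal_if_char:
  fixes X :: "'i \<Rightarrow> 'a \<Rightarrow> real"
  assumes I: "finite I" and X: "\<And>i. i \<in> I \<Longrightarrow> X i \<in> borel_measurable M"
    and char: "\<And>s. expectation (\<lambda>\<omega>. iexp (\<Sum>i\<in>I. s i * X i \<omega>))
      = complex_of_real (exp (- (\<Sum>i\<in>I. (s i)\<^sup>2) / 2))"
  shows "distr M (\<Pi>\<^sub>M i\<in>I. borel) (\<lambda>\<omega>. \<lambda>i\<in>I. X i \<omega>) = (\<Pi>\<^sub>M i\<in>I. std_normal_distribution)"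
proof -
  let ?P = "\<Pi>\<^sub>M i\<in>I. std_normal_distribution"
  interpret S: prob_space ?P by (rule prob_space_PiM_std_normal)
  interpret pair_prob_space M ?P ..
  have "distr M (\<Pi>\<^sub>M i\<in>I. borel) (\<lambda>\<omega>. \<lambda>i\<in>I. X i \<omega>) = distr ?P (\<Pi>\<^sub>M i\<in>I. borel) (\<lambda>x. \<lambda>i\<in>I. x i)"
    using I X by (intro joint_char_unique)
      (auto simp: char integral_iexp_PiM_std_normal simp del: of_real_sum)
  also have "\<dots> = distr ?P (\<Pi>\<^sub>M i\<in>I. borel) (\<lambda>x. x)"
    by (intro distr_cong) (auto simp: space_PiM)
  also have "\<dots> = ?P"
    by (intro distr_id2 sets_PiM_cong) simp_all
  finally show ?thesis .
qed

lemma nn_integral_exp_square_std_normal: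
  fixes c :: real
  assumes "c < 1 / 2"
  shows "(\<integral>\<^sup>+x. ennreal (exp (c * x\<^sup>2)) \<partial>std_normal_distribution)
      = ennreal ((1 - 2 * c) powr (- 1 / 2))"
proof -
  define \<sigma> where "\<sigma> = 1 / sqrt (1 - 2 * c)"
  have \<sigma>: "0 < \<sigma>" "\<sigma>\<^sup>2 = 1 / (1 - 2 * c)" using assms by (simp_all add: \<sigma>_def power_divide)
  have "std_normal_density x * exp (c * x\<^sup>2) = \<sigma> * normal_density 0 \<sigma> x" for x
  proof -
    have "- (x\<^sup>2 / 2) + c * x\<^sup>2 = - (x\<^sup>2 / (2 * \<sigma>\<^sup>2))"
      unfolding \<sigma>(2) using assms by (simp add: field_simps)
    then have "exp (- (x\<^sup>2 / 2)) * exp (c * x\<^sup>2) = exp (- (x\<^sup>2 / (2 * \<sigma>\<^sup>2)))"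
      by (simp only: flip: exp_add)
    then show ?thesis using \<sigma>(1)
      by (simp add: std_normal_density_def normal_density_def real_sqrt_mult)
  qed
  then have "(\<integral>\<^sup>+x. ennreal (exp (c * x\<^sup>2)) \<partial>std_normal_distribution)
      = (\<integral>\<^sup>+x. ennreal (\<sigma> * normal_density 0 \<sigma> x) \<partial>lborel)"
    by (subst nn_integral_density) (auto simp: ennreal_mult[symmetric])
  also have "\<dots> = ennreal \<sigma>"
    using \<sigma>(1) by (subst nn_integral_eq_integral) auto
  also have "\<sigma> = (1 - 2 * c) powr (- 1 / 2)"
    using assms by (simp add: \<sigma>_def powr_minus_divide powr_half_sqrt)
  finally show ?thesis .
qed

lemma nn_integral_exp_sum_squares_PiM_std_normal:
  fixes c :: real
  assumes I: "finite I" and c: "c < 1 / 2"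
  shows "(\<integral>\<^sup>+x. ennreal (exp (c * (\<Sum>i\<in>I. (x i)\<^sup>2))) \<partial>(\<Pi>\<^sub>M i\<in>I. std_normal_distribution))
    = ennreal ((1 - 2 * c) powr (- (card I / 2)))"
proof -
  interpret product_prob_space "\<lambda>_. std_normal_distribution" I ..
  have "(\<integral>\<^sup>+x. ennreal (exp (c * (\<Sum>i\<in>I. (x i)\<^sup>2))) \<partial>(\<Pi>\<^sub>M i\<in>I. std_normal_distribution))
      = (\<integral>\<^sup>+x. (\<Prod>i\<in>I. ennreal (exp (c * (x i)\<^sup>2))) \<partial>(\<Pi>\<^sub>M i\<in>I. std_normal_distribution))"
    using I by (simp add: sum_distrib_left exp_sum prod_ennreal)
  also have "\<dots> = (\<Prod>i\<in>I. \<integral>\<^sup>+x. ennreal (exp (c * x\<^sup>2)) \<partial>std_normal_distribution)"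
    by (rule product_nn_integral_prod[OF I]) auto
  also have "\<dots> = ennreal (((1 - 2 * c) powr (- 1 / 2)) ^ card I)"
    by (simp add: nn_integral_exp_square_std_normal[OF c] ennreal_power)
  also have "((1 - 2 * c) powr (- 1 / 2)) ^ card I = (1 - 2 * c) powr (- (card I / 2))"
    using c by (simp add: powr_realpow[symmetric] powr_powr)
  finally show ?thesis .
qed

definition gamma_kernel :: "real \<Rightarrow> real \<Rightarrow> real \<Rightarrow> real" where
  "gamma_kernel q x s = indicator {0..} s * s powr (q - 1) * exp (- (x * s))"

lemma gamma_kernel_nonneg: "0 \<le> gamma_kernel q x s"
  by (simp add: gamma_kernel_def)

lemma borel_measurable_gamma_kernel [measurable (raw)]:
  assumes [measurable]: "f \<in> borel_measurable M" "g \<in> borel_measurable M"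
  shows "(\<lambda>x. gamma_kernel q (f x) (g x)) \<in> borel_measurable M"
  unfolding gamma_kernel_def by measurable

lemma nn_integral_gamma_kernel:
  assumes q: "0 < q" and x: "0 < x"
  shows "(\<integral>\<^sup>+s. ennreal (gamma_kernel q x s) \<partial>lborel) = ennreal (Gamma q * x powr (- q))"
proof -
  have "ennreal (Gamma q) = (\<integral>\<^sup>+t. ennreal (indicator {0..} t * t powr (q - 1) / exp t) \<partial>lborel)"
    by (rule Gamma_conv_nn_integral_real[OF q])
  also have "\<dots> = (\<integral>\<^sup>+t. ennreal (gamma_kernel q 1 t) \<partial>lborel)"
    by (simp add: gamma_kernel_def exp_minus field_simps)
  also have "\<dots> = ennreal x * (\<integral>\<^sup>+s. ennreal (gamma_kernel q 1 (0 + x * s)) \<partial>lborel)"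
    using x by (subst nn_integral_real_affine[where c=x and t=0]) simp_all
  also have "\<dots> = ennreal x * (\<integral>\<^sup>+s. ennreal (x powr (q - 1)) * ennreal (gamma_kernel q x s) \<partial>lborel)"
    using x by (intro arg_cong[where f="(*) (ennreal x)"] nn_integral_cong)
      (auto simp: gamma_kernel_def powr_mult indicator_def zero_le_mult_iff simp flip: ennreal_mult)
  also have "\<dots> = ennreal (x powr q) * (\<integral>\<^sup>+s. ennreal (gamma_kernel q x s) \<partial>lborel)"
    using x by (subst nn_integral_cmult) (auto simp: powr_diff simp flip: mult.assoc ennreal_mult)
  finally have "ennreal (x powr (- q)) * ennreal (Gamma q)
      = ennreal (x powr (- q) * x powr q) * (\<integral>\<^sup>+s. ennreal (gamma_kernel q x s) \<partial>lborel)"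
    by (simp add: ennreal_mult mult.assoc)
  then show ?thesis
    using x q by (simp add: Gamma_real_nonneg mult.commute flip: ennreal_mult powr_add)
qed

text \<open>Writing \<open>(1 + c * s) powr (- (q + b))\<close> as a Gamma integral and exchanging the integrals avoids a
  substitution.\<close>

lemma nn_integral_beta_prime:
  fixes q b c :: real
  assumes q: "0 < q" and b: "0 < b" and c: "0 < c"
  shows "(\<integral>\<^sup>+s. ennreal (indicator {0..} s * s powr (q - 1) * (1 + c * s) powr (- (q + b))) \<partial>lborel)
    = ennreal (c powr (- q) * Beta q b)" (is "(\<integral>\<^sup>+s. ?f s \<partial>lborel) = _")
proof -
  let ?K = "\<lambda>s v. ennreal (gamma_kernel q (c * v) s * gamma_kernel (q + b) 1 v)"
  have Gamma_pos: "0 < Gamma q" "0 < Gamma b" "0 < Gamma (q + b)"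
    using q b by (auto intro: Gamma_real_pos)
  have inner_v: "(\<integral>\<^sup>+v. ?K s v \<partial>lborel) = ennreal (Gamma (q + b)) * ?f s" for s
  proof (cases "0 \<le> s")
    case True
    have "?K s v = ennreal (s powr (q - 1)) * ennreal (gamma_kernel (q + b) (1 + c * s) v)" for v
      using True by (simp add: gamma_kernel_def algebra_simps flip: ennreal_mult exp_add)
    then have "(\<integral>\<^sup>+v. ?K s v \<partial>lborel)
        = ennreal (s powr (q - 1)) * ennreal (Gamma (q + b) * (1 + c * s) powr (- (q + b)))"
      using True q b c by (simp add: nn_integral_cmult nn_integral_gamma_kernel add_pos_nonneg)
    then show ?thesis using True Gamma_pos by (simp add: mult_ac flip: ennreal_mult)
  qed (simp add: gamma_kernel_def)
  have inner_s: "(\<integral>\<^sup>+s. ?K s v \<partial>lborel)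
      = ennreal (Gamma q * c powr (- q)) * ennreal (gamma_kernel b 1 v)" if "v \<noteq> 0" for v
  proof (cases "0 < v")
    case True
    have "(\<integral>\<^sup>+s. ?K s v \<partial>lborel)
        = ennreal (Gamma q * (c * v) powr (- q)) * ennreal (gamma_kernel (q + b) 1 v)"
      using True q c
      by (simp add: ennreal_mult gamma_kernel_nonneg nn_integral_multc nn_integral_gamma_kernel)
    moreover have "v powr (- q) * v powr (q + b - 1) = v powr (b - 1)"
      by (simp flip: powr_add)
    ultimately show ?thesis
      using True c Gamma_pos by (simp add: gamma_kernel_def powr_mult mult_ac flip: ennreal_mult)
  qed (use that in \<open>simp add: gamma_kernel_def\<close>)
  have "ennreal (Gamma (q + b)) * (\<integral>\<^sup>+s. ?f s \<partial>lborel) = (\<integral>\<^sup>+s. \<integral>\<^sup>+v. ?K s v \<partial>lborel \<partial>lborel)"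
    by (simp add: inner_v nn_integral_cmult)
  also have "\<dots> = (\<integral>\<^sup>+v. \<integral>\<^sup>+s. ?K s v \<partial>lborel \<partial>lborel)"
    by (rule lborel_pair.Fubini'[symmetric]) simp
  also have "\<dots> = (\<integral>\<^sup>+v. ennreal (Gamma q * c powr (- q)) * ennreal (gamma_kernel b 1 v) \<partial>lborel)"
    using AE_lborel_singleton[of 0] by (intro nn_integral_cong_AE) (auto simp: inner_s)
  also have "\<dots> = ennreal (Gamma (q + b)) * ennreal (c powr (- q) * Beta q b)"
    using b Gamma_pos
    by (simp add: nn_integral_cmult nn_integral_gamma_kernel Beta_def flip: ennreal_mult)
  finally show ?thesis
    using Gamma_pos by (simp add: ennreal_mult_cancel_left)
qed

text \<open>The value \<open>\<infinity>\<close> at \<open>0\<close> makes Markov's inequality also cover linearly dependent rows.\<close>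

definition inv_powr :: "real \<Rightarrow> real \<Rightarrow> ennreal" where
  "inv_powr q x = (if x \<le> 0 then \<infinity> else ennreal (x powr (- q)))"

lemma inv_powr_antimono: "0 \<le> q \<Longrightarrow> x \<le> y \<Longrightarrow> inv_powr q y \<le> inv_powr q x"
  by (auto simp: inv_powr_def intro!: ennreal_leI powr_mono2')

lemma borel_measurable_inv_powr [measurable]: "inv_powr q \<in> borel_measurable borel"
  unfolding inv_powr_def[abs_def] by measurable

lemma inv_powr_eq_nn_integral_gamma_kernel:
  assumes "0 < q" and "0 < x"
  shows "ennreal (Gamma q) * inv_powr q x = (\<integral>\<^sup>+s. ennreal (gamma_kernel q x s) \<partial>lborel)"
  using assms
  by (simp add: inv_powr_def nn_integral_gamma_kernel Gamma_real_nonneg flip: ennreal_mult)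

lemma nn_integral_gamma_kernel_sum_squares:
  assumes I: "finite I"
  shows "(\<integral>\<^sup>+x. ennreal (gamma_kernel q (\<Sum>i\<in>I. (x i)\<^sup>2) s) \<partial>(\<Pi>\<^sub>M i\<in>I. std_normal_distribution))
    = ennreal (indicator {0..} s * s powr (q - 1) * (1 + 2 * s) powr (- (card I / 2)))"
proof (cases "0 \<le> s")
  case True
  then have "(\<integral>\<^sup>+x. ennreal (gamma_kernel q (\<Sum>i\<in>I. (x i)\<^sup>2) s) \<partial>(\<Pi>\<^sub>M i\<in>I. std_normal_distribution))
      = (\<integral>\<^sup>+x. ennreal (s powr (q - 1)) * ennreal (exp (- s * (\<Sum>i\<in>I. (x i)\<^sup>2)))
          \<partial>(\<Pi>\<^sub>M i\<in>I. std_normal_distribution))"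
    by (simp add: gamma_kernel_def mult.commute flip: ennreal_mult)
  also have "\<dots> = ennreal (s powr (q - 1)) * ennreal ((1 - 2 * - s) powr (- (card I / 2)))"
    using True
    by (subst nn_integral_cmult)
      (simp, subst nn_integral_exp_sum_squares_PiM_std_normal, simp_all add: I)
  finally show ?thesis using True by (simp flip: ennreal_mult)
qed (simp add: gamma_kernel_def)

lemma AE_sum_squares_PiM_std_normal_pos:
  assumes "finite I" and "I \<noteq> {}"
  shows "AE x in (\<Pi>\<^sub>M i\<in>I. std_normal_distribution). 0 < (\<Sum>i\<in>I. (x i)\<^sup>2 :: real)"
proof -
  obtain i where i: "i \<in> I" using assms by blast
  have "AE x in std_normal_distribution. x \<noteq> 0"
    using AE_lborel_singleton[of "0::real"] by (subst AE_density) auto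
  then have "AE x in (\<Pi>\<^sub>M i\<in>I. std_normal_distribution). x i \<noteq> 0"
    using i by (intro AE_PiM_component std_normal.prob_space_axioms) auto
  then show ?thesis by eventually_elim (use assms i in \<open>auto intro!: sum_pos2\<close>)
qed

lemma nn_integral_inv_powr_chi_square:
  fixes q :: real
  assumes I: "finite I" and q: "0 < q" "2 * q < card I"
  shows "(\<integral>\<^sup>+x. inv_powr q (\<Sum>i\<in>I. (x i)\<^sup>2) \<partial>(\<Pi>\<^sub>M i\<in>I. std_normal_distribution))
    = ennreal (2 powr (- q) * Gamma (card I / 2 - q) / Gamma (card I / 2))"
proof -
  let ?P = "\<Pi>\<^sub>M i\<in>I. std_normal_distribution"
  interpret P: prob_space ?P by (rule prob_space_PiM_std_normal)
  interpret pair_sigma_finite ?P lborel ..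
  let ?X = "\<lambda>x. \<Sum>i\<in>I. (x i)\<^sup>2 :: real"
  let ?b = "card I / 2 - q"
  have b: "0 < ?b" using q by simp
  have Gamma_pos: "0 < Gamma q" "0 < Gamma ?b" "0 < Gamma (card I / 2)"
    using q b by (auto intro: Gamma_real_pos)
  have "ennreal (Gamma q) * (\<integral>\<^sup>+x. inv_powr q (?X x) \<partial>?P)
      = (\<integral>\<^sup>+x. ennreal (Gamma q) * inv_powr q (?X x) \<partial>?P)"
    by (rule nn_integral_cmult[symmetric]) measurable
  also have "\<dots> = (\<integral>\<^sup>+x. \<integral>\<^sup>+s. ennreal (gamma_kernel q (?X x) s) \<partial>lborel \<partial>?P)"
  proof (rule nn_integral_cong_AE)
    have "I \<noteq> {}" using q by auto
    from AE_sum_squares_PiM_std_normal_pos[OF I this]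
    show "AE x in ?P. ennreal (Gamma q) * inv_powr q (?X x)
        = (\<integral>\<^sup>+s. ennreal (gamma_kernel q (?X x) s) \<partial>lborel)"
      by eventually_elim (use q in \<open>simp add: inv_powr_eq_nn_integral_gamma_kernel\<close>)
  qed
  also have "\<dots> = (\<integral>\<^sup>+s. \<integral>\<^sup>+x. ennreal (gamma_kernel q (?X x) s) \<partial>?P \<partial>lborel)"
    by (rule Fubini'[symmetric]) measurable
  also have "\<dots> = ennreal (2 powr (- q) * Beta q ?b)"
    using nn_integral_beta_prime[of q ?b 2] q b
    by (simp add: nn_integral_gamma_kernel_sum_squares I)
  also have "\<dots> = ennreal (Gamma q) * ennreal (2 powr (- q) * Gamma ?b / Gamma (card I / 2))"
    using Gamma_pos by (simp add: Beta_def flip: ennreal_mult)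
  finally show ?thesis
    using Gamma_pos by (simp add: ennreal_mult_cancel_left)
qed

text \<open>The moment of order \<open>- p / 2\<close> of a chi-square variable with \<open>p + 1\<close> degrees of freedom.\<close>

definition inv_chi_square_moment :: "nat \<Rightarrow> real" where
  "inv_chi_square_moment p = 2 powr (- (p / 2)) * Gamma (1 / 2) / Gamma ((p + 1) / 2)"

lemma inv_chi_square_moment_add_2:
  "inv_chi_square_moment (p + 2) = inv_chi_square_moment p / (p + 1)"
proof -
  have "(real p + 1) / 2 \<notin> \<int>\<^sub>\<le>\<^sub>0" by (auto elim!: nonpos_Ints_cases)
  then have "Gamma ((real (p + 2) + 1) / 2) = (real p + 1) / 2 * Gamma ((real p + 1) / 2)"
    using Gamma_plus1[of "(real p + 1) / 2"] by (simp add: add_divide_distrib)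
  moreover have "- (real (p + 2) / 2) = - (real p / 2) - 1" by (simp add: field_simps)
  then have "2 powr (- (real (p + 2) / 2)) = 2 powr (- (real p / 2)) / 2"
    by (simp only: powr_diff powr_one)
  ultimately show ?thesis unfolding inv_chi_square_moment_def by (simp only:) simp
qed

lemma powr_ratio_le_3:
  fixes x :: real
  assumes "5 \<le> x"
  shows "((x + 2) / x) powr ((x + 1) / 2) \<le> 3"
proof -
  have "(x + 1) / 2 * ln ((x + 2) / x) \<le> (x + 1) / 2 * (2 * (inverse x + inverse (x + 2)) / 2)"
    using assms ln_inverse_approx_le[of x 2] by (intro mult_left_mono) (simp_all add: ln_div)
  also have "\<dots> = 1 + 1 / (x * (x + 2))"
    using assms by (simp add: divide_simps) (simp add: algebra_simps)
  also have "\<dots> \<le> 1 + 1 / (5 * 7)"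
    using assms by (intro add_left_mono divide_left_mono mult_mono) auto
  finally have "((x + 2) / x) powr ((x + 1) / 2) \<le> exp (1 + 1 / 35)"
    using assms by (simp add: powr_def)
  also have "\<dots> = exp 1 * exp (1 / 35 :: real)" by (rule exp_add)
  also have "\<dots> \<le> 272 / 100 * (1 + 1 / 35 + (1 / 35)\<^sup>2)"
    using e_less_272 by (intro mult_mono exp_bound) auto
  also have "\<dots> \<le> 3" by (simp add: power2_eq_square)
  finally show ?thesis .
qed

lemma powr_inverse_step_le:
  fixes x :: real
  assumes x: "5 \<le> x"
  shows "(3 / x) powr ((x - 1) / 2) / x \<le> (3 / (x + 2)) powr ((x + 1) / 2)"
proof -
  have exponent: "(x + 1) / 2 = (x - 1) / 2 + 1" by (simp add: field_simps)
  have "(3 / x) powr ((x - 1) / 2) / x = (3 / x) powr ((x + 1) / 2) / 3"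
    unfolding exponent powr_add using x by simp
  also have "\<dots> \<le> (3 / x) powr ((x + 1) / 2) / ((x + 2) / x) powr ((x + 1) / 2)"
    using powr_ratio_le_3[OF x] x by (intro divide_left_mono) auto
  also have "\<dots> = (3 / (x + 2)) powr ((x + 1) / 2)"
    using x by (simp add: powr_divide)
  finally show ?thesis .
qed

lemma inv_chi_square_moment_le:
  assumes "4 \<le> p"
  shows "inv_chi_square_moment p \<le> (3 / (real p + 1)) powr (p / 2)"
  using assms
proof (induction p rule: less_induct)
  case (less p)
  consider "p = 4" | "p = 5" | "6 \<le> p" using less.prems by linarith
  then show ?case
  proof cases
    case 1
    have "inv_chi_square_moment 0 = 1"
      by (simp add: inv_chi_square_moment_def Gamma_one_half_real)
    then have "inv_chi_square_moment 4 = 1 / 3"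
      using inv_chi_square_moment_add_2[of 0] inv_chi_square_moment_add_2[of 2]
      by (simp add: eval_nat_numeral)
    then show ?thesis using 1 by (simp add: power2_eq_square)
  next
    case 2
    have "inv_chi_square_moment 1 = sqrt pi / sqrt 2"
      by (simp add: inv_chi_square_moment_def Gamma_one_half_real powr_minus_divide powr_half_sqrt)
    then have "inv_chi_square_moment 5 = sqrt pi / (8 * sqrt 2)"
      using inv_chi_square_moment_add_2[of 1] inv_chi_square_moment_add_2[of 3]
      by (simp add: eval_nat_numeral)
    also have "\<dots> \<le> sqrt 4 / (8 * sqrt 2)"
      using pi_less_4 by (intro divide_right_mono real_sqrt_le_mono) auto
    also have "\<dots> = (1 / 2) powr (2 + 1 / 2)"
      unfolding powr_add by (simp add: powr_half_sqrt real_sqrt_divide power2_eq_square)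
    finally show ?thesis using 2 by simp
  next
    case 3
    define r where "r = p - 2"
    have r: "p = r + 2" "4 \<le> r" using 3 by (auto simp: r_def)
    define x where "x = real r + 1"
    have x: "5 \<le> x" using r by (simp add: x_def)
    have "inv_chi_square_moment p = inv_chi_square_moment r / x"
      using inv_chi_square_moment_add_2[of r] by (simp add: r x_def)
    also have "\<dots> \<le> (3 / x) powr (real r / 2) / x"
      using less.IH[of r] r x by (intro divide_right_mono) (auto simp: x_def add_ac)
    also have "\<dots> \<le> (3 / (x + 2)) powr ((x + 1) / 2)"
      using powr_inverse_step_le[OF x] by (simp add: x_def)
    finally show ?thesis by (simp add: r x_def add_ac)
  qed
qed

lemma nn_integral_inv_powr_chi_square_le:
  assumes p: "4 \<le> p"
  shows "(\<integral>\<^sup>+x. inv_powr (p / 2) (\<Sum>i<p+1. (x i)\<^sup>2) \<partial>(\<Pi>\<^sub>M i\<in>{..<p+1}. std_normal_distribution))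
    \<le> ennreal ((3 / (real p + 1)) powr (p / 2))"
proof -
  let ?I = "{..<p + 1}"
  have "(\<integral>\<^sup>+x. inv_powr (p / 2) (\<Sum>i\<in>?I. (x i)\<^sup>2) \<partial>(\<Pi>\<^sub>M i\<in>?I. std_normal_distribution))
      = ennreal (2 powr (- (p / 2)) * Gamma (card ?I / 2 - p / 2) / Gamma (card ?I / 2))"
    using p by (intro nn_integral_inv_powr_chi_square) auto
  also have "2 powr (- (p / 2)) * Gamma (card ?I / 2 - p / 2) / Gamma (card ?I / 2)
      = inv_chi_square_moment p"
    by (simp add: inv_chi_square_moment_def add_divide_distrib add.commute)
  finally show ?thesis
    using inv_chi_square_moment_le[OF p] by (simp only: ennreal_leI)
qed

section \<open>Distance to a span\<close>

text \<open>Vectors of length \<open>l\<close> are functions on \<open>nat\<close> whose values at arguments \<open>\<ge> l\<close> are irrelevant.\<close>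

definition dotp :: "nat \<Rightarrow> (nat \<Rightarrow> real) \<Rightarrow> (nat \<Rightarrow> real) \<Rightarrow> real" where
  "dotp l x y = (\<Sum>j<l. x j * y j)"

lemma dotp_commute: "dotp l x y = dotp l y x"
  by (simp add: dotp_def mult.commute)

lemma dotp_self_nonneg: "0 \<le> dotp l x x"
  by (simp add: dotp_def sum_nonneg)

lemma dotp_self_eq_0_iff: "dotp l x x = 0 \<longleftrightarrow> (\<forall>j<l. x j = 0)"
  by (auto simp: dotp_def sum_nonneg_eq_0_iff)

lemma dotp_scale_left: "dotp l (\<lambda>j. c * x j) z = c * dotp l x z"
  by (simp add: dotp_def sum_distrib_left mult_ac)

lemma dotp_scale_right: "dotp l z (\<lambda>j. c * x j) = c * dotp l z x"
  by (simp add: dotp_def sum_distrib_left mult_ac)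

lemma dotp_diff_left: "dotp l (\<lambda>j. x j - y j) z = dotp l x z - dotp l y z"
  by (simp add: dotp_def left_diff_distrib sum_subtractf)

lemma dotp_sum_left: "dotp l (\<lambda>j. \<Sum>a\<in>A. x a j) z = (\<Sum>a\<in>A. dotp l (x a) z)"
  unfolding dotp_def sum_distrib_right by (rule sum.swap)

definition orthonormal :: "nat \<Rightarrow> nat \<Rightarrow> (nat \<Rightarrow> nat \<Rightarrow> real) \<Rightarrow> bool" where
  "orthonormal l d q \<longleftrightarrow> (\<forall>i<d. \<forall>j<d. dotp l (q i) (q j) = of_bool (i = j))"

lemma orthonormalD: "orthonormal l d q \<Longrightarrow> i < d \<Longrightarrow> j < d \<Longrightarrow> dotp l (q i) (q j) = of_bool (i = j)"
  by (simp add: orthonormal_def)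

lemma exists_nonzero_orthogonal:
  fixes r :: "'i \<Rightarrow> nat \<Rightarrow> real"
  assumes A: "finite A" "card A < l"
  shows "\<exists>v. dotp l v v \<noteq> 0 \<and> (\<forall>a\<in>A. dotp l (r a) v = 0)"
proof -
  obtain h where h: "bij_betw h {..<card A} A"
    using ex_bij_betw_nat_finite[OF A(1)] by (auto simp: atLeast0LessThan)
  define W where "W = Matrix.mat l l (\<lambda>(i, j). if i < card A then r (h i) j else 0)"
  have W: "W \<in> carrier_mat l l" by (simp add: W_def)
  have "det W = (\<Sum>j<l. W $$ (card A, j) * cofactor W (card A) j)"
    using A(2) by (rule laplace_expansion_row[OF W])
  also have "\<dots> = 0" using A(2) by (simp add: W_def)
  finally obtain v where v: "v \<in> carrier_vec l" "v \<noteq> 0\<^sub>v l" "W *\<^sub>v v = 0\<^sub>v l"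
    using det_0_iff_vec_prod_zero[OF W] by auto
  have "dotp l (r a) (vec_index v) = 0" if "a \<in> A" for a
  proof -
    have "a \<in> h ` {..<card A}" using that bij_betw_imp_surj_on[OF h] by simp
    then obtain i where i: "i < card A" "a = h i" by auto
    have "dotp l (r a) (vec_index v) = vec_index (W *\<^sub>v v) i"
      using i A(2) v(1) W
      by (auto simp: scalar_prod_def dotp_def W_def atLeast0LessThan intro!: sum.cong)
    then show ?thesis using v(3) i A(2) by simp
  qed
  moreover have "dotp l (vec_index v) (vec_index v) \<noteq> 0"
    using v(1,2) by (auto simp: dotp_self_eq_0_iff)
  ultimately show ?thesis by blast
qed

lemma exists_unit_orthogonal:
  fixes r :: "'i \<Rightarrow> nat \<Rightarrow> real"
  assumes "finite A" and "card A < l"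
  shows "\<exists>v. dotp l v v = 1 \<and> (\<forall>a\<in>A. dotp l (r a) v = 0)"
proof -
  obtain v where v: "dotp l v v \<noteq> 0" "\<And>a. a \<in> A \<Longrightarrow> dotp l (r a) v = 0"
    using exists_nonzero_orthogonal[OF assms] by blast
  define c where "c = 1 / sqrt (dotp l v v)"
  have "c\<^sup>2 * dotp l v v = 1"
    using v(1) dotp_self_nonneg[of l v] by (simp add: c_def power_divide)
  then show ?thesis
    using v(2) by (intro exI[of _ "\<lambda>j. c * v j"])
      (simp add: dotp_scale_left dotp_scale_right power2_eq_square mult.assoc)
qed

lemma exists_orthonormal_complement:
  fixes r :: "'i \<Rightarrow> nat \<Rightarrow> real"
  assumes A: "finite A" and "card A + d \<le> l"
  shows "\<exists>q. orthonormal l d q \<and> (\<forall>i<d. \<forall>a\<in>A. dotp l (r a) (q i) = 0)"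
  using assms(2)
proof (induction d)
  case 0
  show ?case by (simp add: orthonormal_def)
next
  case (Suc d)
  then obtain q where q: "orthonormal l d q" "\<And>i a. i < d \<Longrightarrow> a \<in> A \<Longrightarrow> dotp l (r a) (q i) = 0"
    by auto
  let ?B = "Inl ` A \<union> Inr ` {..<d} :: ('i + nat) set"
  have "card ?B \<le> card A + d"
    by (rule order_trans[OF card_Un_le]) (auto intro!: add_mono simp: card_image)
  then have "finite ?B" "card ?B < l" using A Suc.prems by auto
  from exists_unit_orthogonal[OF this, of "case_sum r q"]
  obtain v where v: "dotp l v v = 1" "\<And>a. a \<in> A \<Longrightarrow> dotp l (r a) v = 0"
    "\<And>i. i < d \<Longrightarrow> dotp l (q i) v = 0"
    by (auto simp: ball_Un)
  have "dotp l v (q i) = 0" if "i < d" for i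
    using v(3)[OF that] by (simp add: dotp_commute)
  then have "orthonormal l (Suc d) (q(d := v))"
    using q(1) v(1,3) by (auto simp: orthonormal_def less_Suc_eq)
  then show ?case
    using q(2) v(2) by (intro exI[of _ "q(d := v)"] conjI) (assumption, auto simp: less_Suc_eq)
qed

definition residual :: "'i set \<Rightarrow> ('i \<Rightarrow> nat \<Rightarrow> real) \<Rightarrow> ('i \<Rightarrow> real) \<Rightarrow> (nat \<Rightarrow> real) \<Rightarrow> nat \<Rightarrow> real" where
  "residual A r c x = (\<lambda>j. x j - (\<Sum>a\<in>A. c a * r a j))"

lemma dotp_residual_left: "dotp l (residual A r c x) z = dotp l x z - (\<Sum>a\<in>A. c a * dotp l (r a) z)"
  by (simp add: residual_def dotp_diff_left dotp_sum_left dotp_scale_left)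

lemma dotp_residual_right: "dotp l z (residual A r c x) = dotp l z x - (\<Sum>a\<in>A. c a * dotp l z (r a))"
  by (simp add: dotp_commute[of l z] dotp_residual_left)

lemma dotp_orthogonal_residual:
  assumes "\<And>a. a \<in> A \<Longrightarrow> dotp l y (r a) = 0"
  shows "dotp l y (residual A r c x) = dotp l y x"
  using assms by (simp add: dotp_residual_right)

lemma residual_insert:
  assumes "finite A" and "b \<notin> A"
  shows "residual (insert b A) r ((\<lambda>a. c a - k * d a)(b := k)) x
    = (\<lambda>j. residual A r c x j - k * residual A r d (r b) j)"
proof
  fix j
  have "(\<Sum>a\<in>A. ((\<lambda>a. c a - k * d a)(b := k)) a * r a j)
      = (\<Sum>a\<in>A. c a * r a j) - k * (\<Sum>a\<in>A. d a * r a j)"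
    using assms(2)
    by (auto simp: sum_distrib_left left_diff_distrib mult.assoc simp flip: sum_subtractf
        intro!: sum.cong)
  then show "residual (insert b A) r ((\<lambda>a. c a - k * d a)(b := k)) x j
      = residual A r c x j - k * residual A r d (r b) j"
    using assms by (simp add: residual_def right_diff_distrib)
qed

text \<open>The induction step is one step of the Gram-Schmidt process.\<close>

lemma exists_orthogonal_residual:
  fixes r :: "'i \<Rightarrow> nat \<Rightarrow> real"
  assumes "finite A"
  shows "\<exists>c. \<forall>a\<in>A. dotp l (residual A r c x) (r a) = 0"
  using assms
proof (induction A arbitrary: x rule: finite_induct)
  case empty
  show ?case by simp
next
  case (insert b A)
  obtain c where c: "\<And>a. a \<in> A \<Longrightarrow> dotp l (residual A r c x) (r a) = 0"
    using insert.IH[of x] by blast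
  obtain d where d: "\<And>a. a \<in> A \<Longrightarrow> dotp l (residual A r d (r b)) (r a) = 0"
    using insert.IH[of "r b"] by blast
  define x' where "x' = residual A r c x"
  define b' where "b' = residual A r d (r b)"
  define k where "k = dotp l x' b' / dotp l b' b'"
  define y where "y = residual (insert b A) r ((\<lambda>a. c a - k * d a)(b := k)) x"
  have y_eq: "y = (\<lambda>j. x' j - k * b' j)"
    unfolding y_def x'_def b'_def by (rule residual_insert[OF insert.hyps])
  have orth: "dotp l y (r a) = 0" if "a \<in> A" for a
    using c[OF that] d[OF that] by (simp add: y_eq dotp_diff_left dotp_scale_left x'_def b'_def)
  have "dotp l y (r b) = dotp l y b'"
    unfolding b'_def by (rule dotp_orthogonal_residual[symmetric]) (rule orth)
  also have "\<dots> = dotp l x' b' - k * dotp l b' b'"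
    by (simp add: y_eq dotp_diff_left dotp_scale_left)
  also have "\<dots> = 0"
  proof (cases "dotp l b' b' = 0")
    case True
    then have "\<forall>j<l. b' j = 0" by (simp only: dotp_self_eq_0_iff)
    then have "dotp l x' b' = 0" by (simp add: dotp_def)
    then show ?thesis using True by simp
  qed (simp add: k_def)
  finally have "\<forall>a\<in>insert b A. dotp l y (r a) = 0" using orth by simp
  then show ?case unfolding y_def by blast
qed

lemma Bessel_inequality:
  assumes q: "orthonormal l d q"
  shows "(\<Sum>i<d. (dotp l (q i) x)\<^sup>2) \<le> dotp l x x"
proof -
  define y where "y = residual {..<d} q (\<lambda>i. dotp l (q i) x) x"
  have "dotp l y (q i) = 0" if "i < d" for i
  proof -
    have "(\<Sum>j<d. dotp l (q j) x * dotp l (q j) (q i)) = dotp l (q i) x"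
      using that by (simp add: orthonormalD[OF q])
    then show ?thesis by (simp add: y_def dotp_residual_left dotp_commute[of l x])
  qed
  then have "dotp l y y = dotp l y x"
    by (subst (2) y_def) (auto intro: dotp_orthogonal_residual)
  also have "\<dots> = dotp l x x - (\<Sum>i<d. (dotp l (q i) x)\<^sup>2)"
    by (simp add: y_def dotp_residual_left power2_eq_square)
  finally show ?thesis using dotp_self_nonneg[of l y] by simp
qed

text \<open>The infimum ranges over rational coefficients only, so that the squared distance to the span is
  visibly a measurable function of all entries.\<close>

definition span_dist2 :: "nat \<Rightarrow> 'i set \<Rightarrow> (nat \<Rightarrow> real) \<Rightarrow> ('i \<Rightarrow> nat \<Rightarrow> real) \<Rightarrow> real" where
  "span_dist2 l A x r = (INF c\<in>(\<Pi>\<^sub>E a\<in>A. \<rat>). dotp l (residual A r c x) (residual A r c x))"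

lemma span_dist2_bdd_below: "bdd_below ((\<lambda>c. dotp l (residual A r c x) (residual A r c x)) ` C)"
  by (rule bdd_belowI[of _ 0]) (auto simp: dotp_self_nonneg)

lemma span_dist2_greatest:
  assumes "\<And>c. m \<le> dotp l (residual A r c x) (residual A r c x)"
  shows "m \<le> span_dist2 l A x r"
  unfolding span_dist2_def
  by (rule cINF_greatest) (auto simp: PiE_eq_empty_iff assms intro: Rats_0)

lemma span_dist2_le:
  fixes r :: "'i \<Rightarrow> nat \<Rightarrow> real"
  assumes A: "finite A"
  shows "span_dist2 l A x r \<le> dotp l (residual A r c x) (residual A r c x)"
proof -
  let ?D = "\<lambda>c. dotp l (residual A r c x) (residual A r c x)"
  have "\<exists>f. (\<forall>n. f n \<in> \<rat>) \<and> f \<longlonglongrightarrow> c a" for a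
    using Rats_closure_real closure_sequential[of "c a" "\<rat>"] by simp
  then obtain f where f: "\<And>a n. f a n \<in> \<rat>" "\<And>a. f a \<longlonglongrightarrow> c a" by metis
  have "(\<lambda>n. ?D (\<lambda>a. f a n)) \<longlonglongrightarrow> ?D c"
    unfolding dotp_def residual_def by (intro tendsto_intros f)
  moreover have "span_dist2 l A x r \<le> ?D (\<lambda>a. f a n)" for n
  proof -
    have "span_dist2 l A x r \<le> ?D (\<lambda>a\<in>A. f a n)"
      unfolding span_dist2_def by (rule cINF_lower[OF span_dist2_bdd_below]) (auto simp: f(1))
    then show ?thesis by (simp add: residual_def cong: sum.cong)
  qed
  ultimately show ?thesis by (intro LIMSEQ_le_const) auto
qed

lemma span_dist2_cong:
  assumes "\<And>j. j < l \<Longrightarrow> x j = x' j" and "\<And>a j. a \<in> A \<Longrightarrow> j < l \<Longrightarrow> r a j = r' a j"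
  shows "span_dist2 l A x r = span_dist2 l A x' r'"
proof -
  have "dotp l (residual A r c x) (residual A r c x)
      = dotp l (residual A r' c x') (residual A r' c x')" for c
    unfolding dotp_def residual_def using assms by (intro sum.cong refl) simp
  then show ?thesis by (simp add: span_dist2_def)
qed

lemma borel_measurable_span_dist2 [measurable (raw)]:
  fixes r :: "'i \<Rightarrow> nat \<Rightarrow> 'w \<Rightarrow> real"
  assumes A: "finite A"
    and [measurable]: "\<And>j. j < l \<Longrightarrow> x j \<in> borel_measurable M"
      "\<And>a j. a \<in> A \<Longrightarrow> j < l \<Longrightarrow> r a j \<in> borel_measurable M"
  shows "(\<lambda>\<omega>. span_dist2 l A (\<lambda>j. x j \<omega>) (\<lambda>a j. r a j \<omega>)) \<in> borel_measurable M"
  unfolding span_dist2_def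
proof (rule borel_measurable_cINF)
  show "countable (\<Pi>\<^sub>E a\<in>A. (\<rat> :: real set))"
    using A by (intro countable_PiE) (auto simp: countable_rat)
  show "(\<lambda>\<omega>. dotp l (residual A (\<lambda>a j. r a j \<omega>) c (\<lambda>j. x j \<omega>))
      (residual A (\<lambda>a j. r a j \<omega>) c (\<lambda>j. x j \<omega>)))
      \<in> borel_measurable M" for c
    unfolding dotp_def residual_def by measurable
qed (rule span_dist2_bdd_below)

lemma sum_squares_dotp_le_span_dist2:
  assumes q: "orthonormal l d q" and r: "\<And>i a. i < d \<Longrightarrow> a \<in> A \<Longrightarrow> dotp l (r a) (q i) = 0"
  shows "(\<Sum>i<d. (dotp l (q i) x)\<^sup>2) \<le> span_dist2 l A x r"
proof (rule span_dist2_greatest)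
  fix c
  have "dotp l (q i) (residual A r c x) = dotp l (q i) x" if "i < d" for i
    using r[OF that] by (intro dotp_orthogonal_residual) (simp add: dotp_commute[of l "q i"])
  then show "(\<Sum>i<d. (dotp l (q i) x)\<^sup>2) \<le> dotp l (residual A r c x) (residual A r c x)"
    using Bessel_inequality[OF q, of "residual A r c x"] by simp
qed

lemma span_dist2_scale_le:
  assumes A: "finite A" and y: "\<And>j. j < l \<Longrightarrow> y j = c * x j + (\<Sum>a\<in>A. d a * r a j)"
  shows "c\<^sup>2 * span_dist2 l A x r \<le> span_dist2 l A y r"
proof (rule span_dist2_greatest)
  fix e
  show "c\<^sup>2 * span_dist2 l A x r \<le> dotp l (residual A r e y) (residual A r e y)"
  proof (cases "c = 0")
    case True
    then show ?thesis by (simp add: dotp_self_nonneg)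
  next
    case False
    define x' where "x' = residual A r (\<lambda>a. (e a - d a) / c) x"
    have "residual A r e y j = c * x' j" if "j < l" for j
    proof -
      have "c * (\<Sum>a\<in>A. (e a - d a) / c * r a j) = (\<Sum>a\<in>A. (e a - d a) * r a j)"
        using False by (simp add: sum_distrib_left)
      then show ?thesis
        using y[OF that]
        by (simp add: x'_def residual_def right_diff_distrib left_diff_distrib sum_subtractf)
    qed
    then have "dotp l (residual A r e y) (residual A r e y) = dotp l (\<lambda>j. c * x' j) (\<lambda>j. c * x' j)"
      by (simp add: dotp_def)
    also have "\<dots> = c\<^sup>2 * dotp l x' x'"
      by (simp add: dotp_scale_left dotp_scale_right power2_eq_square mult.assoc)
    finally show ?thesis
      using span_dist2_le[OF A, of l x r] by (simp add: x'_def mult_left_mono)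
  qed
qed

lemma exists_dual_vector:
  fixes r :: "'i \<Rightarrow> nat \<Rightarrow> real"
  assumes A: "finite A" and dist: "0 < span_dist2 l A x r"
  shows "\<exists>g. dotp l g x = 1 \<and> (\<forall>a\<in>A. dotp l g (r a) = 0) \<and> dotp l g g \<le> 1 / span_dist2 l A x r"
proof -
  obtain c where orth: "\<And>a. a \<in> A \<Longrightarrow> dotp l (residual A r c x) (r a) = 0"
    using exists_orthogonal_residual[OF A, of l r x] by blast
  define h where "h = residual A r c x"
  have hr: "dotp l h (r a) = 0" if "a \<in> A" for a using orth[OF that] by (simp add: h_def)
  have "dotp l h h = dotp l h x" by (subst (2) h_def) (rule dotp_orthogonal_residual[OF hr])
  then have hx: "dotp l h x = dotp l h h" ..
  have "span_dist2 l A x r \<le> dotp l h h" unfolding h_def by (rule span_dist2_le[OF A])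
  with dist have pos: "0 < dotp l h h" and "1 / dotp l h h \<le> 1 / span_dist2 l A x r"
    by (simp_all add: frac_le)
  define g where "g j = 1 / dotp l h h * h j" for j
  have g: "dotp l g z = 1 / dotp l h h * dotp l h z" for z
    unfolding g_def[abs_def] by (rule dotp_scale_left)
  have "dotp l g g = 1 / dotp l h h"
    unfolding g using pos by (simp add: dotp_commute[of l h g] g)
  then show ?thesis
    using \<open>1 / dotp l h h \<le> _\<close> pos hr hx by (intro exI[of _ g]) (simp add: g)
qed

lemma exists_dual_family:
  fixes r :: "'i \<Rightarrow> nat \<Rightarrow> real"
  assumes "finite I" and "\<And>i. i \<in> I \<Longrightarrow> 0 < span_dist2 l (I - {i}) (r i) r"
  shows "\<exists>g. (\<forall>i\<in>I. \<forall>a\<in>I. dotp l (g i) (r a) = of_bool (i = a)) \<and>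
    (\<forall>i\<in>I. dotp l (g i) (g i) \<le> 1 / span_dist2 l (I - {i}) (r i) r)"
proof -
  have "\<forall>i\<in>I. \<exists>g. dotp l g (r i) = 1 \<and> (\<forall>a\<in>I - {i}. dotp l g (r a) = 0) \<and>
      dotp l g g \<le> 1 / span_dist2 l (I - {i}) (r i) r"
    using assms by (intro ballI exists_dual_vector) auto
  then obtain g where "\<forall>i\<in>I. dotp l (g i) (r i) = 1 \<and> (\<forall>a\<in>I - {i}. dotp l (g i) (r a) = 0) \<and>
      dotp l (g i) (g i) \<le> 1 / span_dist2 l (I - {i}) (r i) r"
    by metis
  then show ?thesis by (intro exI[of _ g]) auto
qed

section \<open>Distance of a Gaussian vector to a span\<close>

lemma distr_orthonormal_std_normal:
  assumes q: "orthonormal l d q"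
  shows "distr (\<Pi>\<^sub>M j\<in>{..<l}. std_normal_distribution) (\<Pi>\<^sub>M i\<in>{..<d}. borel)
      (\<lambda>x. \<lambda>i\<in>{..<d}. dotp l (q i) x)
    = (\<Pi>\<^sub>M i\<in>{..<d}. std_normal_distribution)"
proof -
  interpret prob_space "\<Pi>\<^sub>M j\<in>{..<l}. std_normal_distribution" by (rule prob_space_PiM_std_normal)
  show ?thesis
  proof (rule distr_eq_PiM_std_normal_if_char)
    show "(\<lambda>x. dotp l (q i) x) \<in> borel_measurable (\<Pi>\<^sub>M j\<in>{..<l}. std_normal_distribution)" for i
      unfolding dotp_def by measurable
    fix s :: "nat \<Rightarrow> real"
    define y where "y j = (\<Sum>i<d. s i * q i j)" for j
    have y: "dotp l y z = (\<Sum>i<d. s i * dotp l (q i) z)" for z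
      by (simp add: y_def[abs_def] dotp_sum_left dotp_scale_left)
    have "dotp l (q i) y = s i" if "i < d" for i
      unfolding dotp_commute[of l "q i"] y using that by (simp add: orthonormalD[OF q])
    then have "(\<Sum>j<l. (y j)\<^sup>2) = (\<Sum>i<d. (s i)\<^sup>2)"
      using y[of y] by (simp add: dotp_def power2_eq_square)
    moreover have "(\<Sum>i<d. s i * dotp l (q i) x) = (\<Sum>j<l. y j * x j)" for x
      unfolding y[symmetric] by (simp only: dotp_def)
    ultimately show "expectation (\<lambda>x. iexp (\<Sum>i<d. s i * dotp l (q i) x))
        = complex_of_real (exp (- (\<Sum>i<d. (s i)\<^sup>2) / 2))"
      by (simp only: integral_iexp_PiM_std_normal finite_lessThan)
  qed simp
qed

lemma nn_integral_inv_powr_span_dist2_std_normal_le: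
  fixes r :: "'i \<Rightarrow> nat \<Rightarrow> real"
  assumes A: "finite A" "card A + (p + 1) \<le> l" and p: "4 \<le> p"
  shows "(\<integral>\<^sup>+x. inv_powr (p / 2) (span_dist2 l A x r) \<partial>(\<Pi>\<^sub>M j\<in>{..<l}. std_normal_distribution))
    \<le> ennreal ((3 / (real p + 1)) powr (p / 2))" (is "(\<integral>\<^sup>+x. _ \<partial>?P) \<le> _")
proof -
  let ?d = "p + 1"
  let ?B = "(\<Pi>\<^sub>M i\<in>{..<?d}. borel) :: (nat \<Rightarrow> real) measure"
  obtain q where q: "orthonormal l ?d q" "\<And>i a. i < ?d \<Longrightarrow> a \<in> A \<Longrightarrow> dotp l (r a) (q i) = 0"
    using exists_orthonormal_complement[OF A, of r] by blast
  let ?proj = "\<lambda>x. \<lambda>i\<in>{..<?d}. dotp l (q i) x"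
  have [measurable]: "?proj \<in> ?P \<rightarrow>\<^sub>M ?B"
    unfolding dotp_def by measurable
  have "(\<integral>\<^sup>+x. inv_powr (p / 2) (span_dist2 l A x r) \<partial>?P)
      \<le> (\<integral>\<^sup>+x. inv_powr (p / 2) (\<Sum>i<?d. (?proj x i)\<^sup>2) \<partial>?P)"
    using sum_squares_dotp_le_span_dist2[OF q] by (intro nn_integral_mono inv_powr_antimono) auto
  also have "\<dots> = (\<integral>\<^sup>+z. inv_powr (p / 2) (\<Sum>i<?d. (z i)\<^sup>2) \<partial>distr ?P ?B ?proj)"
    by (rule nn_integral_distr[symmetric]) measurable
  also have "\<dots> \<le> ennreal ((3 / (real p + 1)) powr (p / 2))"
    unfolding distr_orthonormal_std_normal[OF q(1)]
    by (rule nn_integral_inv_powr_chi_square_le[OF p])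
  finally show ?thesis .
qed

lemma (in prob_space) nn_integral_inv_powr_span_dist2_le:
  fixes X :: "'a \<Rightarrow> nat \<Rightarrow> real" and Y :: "'a \<Rightarrow> 'i \<times> nat \<Rightarrow> real"
  assumes A: "finite A" "card A + (p + 1) \<le> l" and p: "4 \<le> p"
    and [measurable]: "X \<in> M \<rightarrow>\<^sub>M (\<Pi>\<^sub>M j\<in>{..<l}. borel)" "Y \<in> M \<rightarrow>\<^sub>M (\<Pi>\<^sub>M b\<in>A \<times> {..<l}. borel)"
    and law: "distr M (\<Pi>\<^sub>M j\<in>{..<l}. borel) X = (\<Pi>\<^sub>M j\<in>{..<l}. std_normal_distribution)"
    and indep: "distr M ((\<Pi>\<^sub>M j\<in>{..<l}. borel) \<Otimes>\<^sub>M (\<Pi>\<^sub>M b\<in>A \<times> {..<l}. borel)) (\<lambda>\<omega>. (X \<omega>, Y \<omega>))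
      = distr M (\<Pi>\<^sub>M j\<in>{..<l}. borel) X \<Otimes>\<^sub>M distr M (\<Pi>\<^sub>M b\<in>A \<times> {..<l}. borel) Y"
  shows "(\<integral>\<^sup>+\<omega>. inv_powr (p / 2) (span_dist2 l A (X \<omega>) (\<lambda>a j. Y \<omega> (a, j))) \<partial>M)
    \<le> ennreal ((3 / (real p + 1)) powr (p / 2))" (is "_ \<le> ?m")
proof -
  let ?BX = "(\<Pi>\<^sub>M j\<in>{..<l}. borel) :: (nat \<Rightarrow> real) measure"
  let ?BY = "(\<Pi>\<^sub>M b\<in>A \<times> {..<l}. borel) :: ('i \<times> nat \<Rightarrow> real) measure"
  let ?DX = "distr M ?BX X" and ?DY = "distr M ?BY Y"
  interpret DX: prob_space ?DX by (rule prob_space_distr) simp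
  interpret DY: prob_space ?DY by (rule prob_space_distr) simp
  interpret pair_sigma_finite ?DX ?DY ..
  define F where "F z = inv_powr (p / 2) (span_dist2 l A (fst z) (\<lambda>a j. snd z (a, j)))"
    for z :: "(nat \<Rightarrow> real) \<times> ('i \<times> nat \<Rightarrow> real)"
  have [measurable]: "F \<in> borel_measurable (?BX \<Otimes>\<^sub>M ?BY)"
  proof -
    have "(\<lambda>z. snd z (a, j)) \<in> borel_measurable (?BX \<Otimes>\<^sub>M ?BY)" if "a \<in> A" "j < l" for a j
      using that
      by (intro measurable_compose[OF measurable_snd] measurable_component_singleton) auto
    then show ?thesis unfolding F_def using A(1) by measurable
  qed
  have "(\<integral>\<^sup>+\<omega>. inv_powr (p / 2) (span_dist2 l A (X \<omega>) (\<lambda>a j. Y \<omega> (a, j))) \<partial>M)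
      = (\<integral>\<^sup>+z. F z \<partial>distr M (?BX \<Otimes>\<^sub>M ?BY) (\<lambda>\<omega>. (X \<omega>, Y \<omega>)))"
    by (subst nn_integral_distr) (measurable, simp add: F_def)
  also have "\<dots> = (\<integral>\<^sup>+y. \<integral>\<^sup>+x. F (x, y) \<partial>?DX \<partial>?DY)"
    unfolding indep by (rule nn_integral_snd[symmetric]) measurable
  also have "\<dots> \<le> (\<integral>\<^sup>+y. ?m \<partial>?DY)"
    unfolding law F_def fst_conv snd_conv
    by (intro nn_integral_mono nn_integral_inv_powr_span_dist2_std_normal_le A p)
  also have "\<dots> = ?m" using DY.emeasure_space_1 by simp
  finally show ?thesis .
qed

section \<open>Tail bounds\<close>

text \<open>Jensen's inequality for \<open>x powr q\<close>.\<close>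

lemma weighted_inverse_sum_le_if_inv_powr_mean_less:
  fixes B x :: "'i \<Rightarrow> real" and q \<tau> :: real
  assumes I: "finite I" "I \<noteq> {}" and B: "\<And>i. i \<in> I \<Longrightarrow> 0 < B i" and q: "1 \<le> q" and \<tau>: "0 < \<tau>"
    and mean: "(\<Sum>i\<in>I. ennreal (B i / sum B I) * inv_powr q (x i)) < ennreal (\<tau> powr q)"
  shows "(\<forall>i\<in>I. 0 < x i) \<and> (\<Sum>i\<in>I. B i / x i) \<le> \<tau> * sum B I"
proof
  have total: "0 < sum B I" using I B by (intro sum_pos) auto
  show pos: "\<forall>i\<in>I. 0 < x i"
  proof (rule ballI, rule ccontr)
    fix i assume i: "i \<in> I" and "\<not> 0 < x i"
    then have "ennreal (B i / sum B I) * inv_powr q (x i) = \<infinity>"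
      using B[OF i] total by (simp add: inv_powr_def ennreal_mult_top)
    moreover have "ennreal (B i / sum B I) * inv_powr q (x i)
        \<le> (\<Sum>i\<in>I. ennreal (B i / sum B I) * inv_powr q (x i))"
      using i I by (intro member_le_sum) auto
    ultimately show False using mean by (simp add: top_unique)
  qed
  have "(\<Sum>i\<in>I. ennreal (B i / sum B I) * inv_powr q (x i))
      = (\<Sum>i\<in>I. ennreal (B i / sum B I * (1 / x i) powr q))"
    using pos B total
    by (intro sum.cong)
      (auto simp: inv_powr_def powr_divide powr_minus_divide less_imp_le simp flip: ennreal_mult)
  also have "\<dots> = ennreal (\<Sum>i\<in>I. B i / sum B I * (1 / x i) powr q)"
    using B total by (intro sum_ennreal) (auto simp: less_imp_le)
  finally have "(\<Sum>i\<in>I. B i / sum B I * (1 / x i) powr q) < \<tau> powr q"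
    using mean \<tau> by (simp add: ennreal_less_iff less_imp_le B total sum_nonneg)
  moreover have "(\<Sum>i\<in>I. (B i / sum B I) *\<^sub>R (1 / x i)) powr q
      \<le> (\<Sum>i\<in>I. B i / sum B I * (1 / x i) powr q)"
    using B total pos
    by (intro convex_on_sum[OF I powr_convex[OF q]])
      (auto simp: less_imp_le simp flip: sum_divide_distrib)
  ultimately have "(\<Sum>i\<in>I. (B i / sum B I) *\<^sub>R (1 / x i)) powr q < \<tau> powr q" by simp
  then have "(\<Sum>i\<in>I. (B i / sum B I) *\<^sub>R (1 / x i)) \<le> \<tau>"
    using powr_mono2[of q \<tau> "\<Sum>i\<in>I. (B i / sum B I) *\<^sub>R (1 / x i)"] q \<tau> by linarith
  moreover have "(\<Sum>i\<in>I. (B i / sum B I) *\<^sub>R (1 / x i)) = (\<Sum>i\<in>I. B i / x i) / sum B I"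
    by (simp add: sum_divide_distrib mult.commute)
  ultimately show "(\<Sum>i\<in>I. B i / x i) \<le> \<tau> * sum B I" using total by (simp add: divide_le_eq)
qed

lemma (in prob_space) weighted_inverse_sum_tail:
  fixes B :: "'i \<Rightarrow> real" and X :: "'i \<Rightarrow> 'a \<Rightarrow> real" and q \<tau> m :: real
  assumes I: "finite I" "I \<noteq> {}" and B: "\<And>i. i \<in> I \<Longrightarrow> 0 < B i" and q: "1 \<le> q" and \<tau>: "0 < \<tau>"
    and [measurable]: "\<And>i. i \<in> I \<Longrightarrow> X i \<in> borel_measurable M" and m: "0 \<le> m"
    and moment: "\<And>i. i \<in> I \<Longrightarrow> (\<integral>\<^sup>+\<omega>. inv_powr q (X i \<omega>) \<partial>M) \<le> ennreal m"
  shows "prob {\<omega> \<in> space M. \<not> ((\<forall>i\<in>I. 0 < X i \<omega>) \<and> (\<Sum>i\<in>I. B i / X i \<omega>) \<le> \<tau> * sum B I)}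
    \<le> m * \<tau> powr (- q)"
proof -
  define \<Psi> where "\<Psi> \<omega> = (\<Sum>i\<in>I. ennreal (B i / sum B I) * inv_powr q (X i \<omega>))" for \<omega>
  have [measurable]: "\<Psi> \<in> borel_measurable M" unfolding \<Psi>_def by measurable
  have total: "0 < sum B I" using I B by (intro sum_pos) auto
  have "(\<integral>\<^sup>+\<omega>. \<Psi> \<omega> \<partial>M) = (\<Sum>i\<in>I. ennreal (B i / sum B I) * (\<integral>\<^sup>+\<omega>. inv_powr q (X i \<omega>) \<partial>M))"
    unfolding \<Psi>_def by (simp add: nn_integral_sum nn_integral_cmult)
  also have "\<dots> \<le> (\<Sum>i\<in>I. ennreal (B i / sum B I) * ennreal m)"
    by (intro sum_mono mult_left_mono moment) auto
  also have "\<dots> = ennreal (\<Sum>i\<in>I. B i / sum B I) * ennreal m"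
    unfolding sum_distrib_right[symmetric]
    using B total by (subst sum_ennreal) (auto simp: less_imp_le)
  also have "(\<Sum>i\<in>I. B i / sum B I) = 1" using total by (simp flip: sum_divide_distrib)
  finally have mean: "(\<integral>\<^sup>+\<omega>. \<Psi> \<omega> \<partial>M) \<le> ennreal m" by simp
  let ?good = "\<lambda>\<omega>. (\<forall>i\<in>I. 0 < X i \<omega>) \<and> (\<Sum>i\<in>I. B i / X i \<omega>) \<le> \<tau> * sum B I"
  have "1 \<le> ennreal (\<tau> powr (- q)) * \<Psi> \<omega>" if "\<not> ?good \<omega>" for \<omega>
  proof -
    have "\<not> \<Psi> \<omega> < ennreal (\<tau> powr q)"
      using that weighted_inverse_sum_le_if_inv_powr_mean_less[of I B q \<tau> "\<lambda>i. X i \<omega>"] I B q \<tau>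
      unfolding \<Psi>_def by blast
    then have "ennreal (\<tau> powr (- q)) * ennreal (\<tau> powr q) \<le> ennreal (\<tau> powr (- q)) * \<Psi> \<omega>"
      by (intro mult_left_mono) auto
    then show ?thesis using \<tau> by (simp flip: ennreal_mult powr_add)
  qed
  then have "emeasure M {\<omega> \<in> space M. \<not> ?good \<omega>}
      \<le> emeasure M {\<omega> \<in> space M. 1 \<le> ennreal (\<tau> powr (- q)) * \<Psi> \<omega>}"
    by (intro emeasure_mono) auto
  also have "\<dots> \<le> ennreal (\<tau> powr (- q)) * (\<integral>\<^sup>+\<omega>. \<Psi> \<omega> * indicator (space M) \<omega> \<partial>M)"
    by (rule nn_integral_Markov_inequality) measurable
  also have "\<dots> \<le> ennreal (\<tau> powr (- q)) * ennreal m"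
    using mean by (intro mult_left_mono) (simp_all cong: nn_integral_cong_simp)
  finally show ?thesis
    using m by (simp add: emeasure_eq_measure mult.commute flip: ennreal_mult)
qed

lemma powr_half_cancel:
  fixes t :: real
  assumes "0 < t" and "0 < x"
  shows "x powr (real p / 2) * (t\<^sup>2 * x) powr (- (real p / 2)) = 1 / t ^ p"
proof -
  have "(t\<^sup>2 * x) powr (- (real p / 2)) = (t powr 2) powr (- (real p / 2)) * x powr (- (real p / 2))"
    using assms by (simp add: powr_mult)
  also have "(t powr 2) powr (- (real p / 2)) = 1 / t ^ p"
    unfolding powr_powr using assms by (simp add: powr_minus_divide powr_realpow)
  finally show ?thesis using assms by (simp flip: powr_add)
qed

lemma (in prob_space) nn_integral_exp_sum_indep_le:
  fixes Y :: "'i \<Rightarrow> 'a \<Rightarrow> real"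
  assumes I: "finite I" and indep: "indep_vars (\<lambda>_. borel) Y I" and m: "0 \<le> m"
    and mgf: "\<And>i. i \<in> I \<Longrightarrow> (\<integral>\<^sup>+\<omega>. ennreal (exp (c * Y i \<omega>)) \<partial>M) \<le> ennreal m"
  shows "(\<integral>\<^sup>+\<omega>. ennreal (exp (c * (\<Sum>i\<in>I. Y i \<omega>))) \<partial>M) \<le> ennreal (m ^ card I)"
proof -
  have "(\<integral>\<^sup>+\<omega>. ennreal (exp (c * (\<Sum>i\<in>I. Y i \<omega>))) \<partial>M) = (\<integral>\<^sup>+\<omega>. (\<Prod>i\<in>I. ennreal (exp (c * Y i \<omega>))) \<partial>M)"
    using I by (simp add: sum_distrib_left exp_sum prod_ennreal)
  also have "\<dots> = (\<Prod>i\<in>I. \<integral>\<^sup>+\<omega>. ennreal (exp (c * Y i \<omega>)) \<partial>M)"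
    using I by (intro indep_vars_nn_integral indep_vars_compose2[OF indep]) auto
  also have "\<dots> \<le> (\<Prod>i\<in>I. ennreal m)"
    by (intro prod_mono_ennreal mgf)
  also have "\<dots> = ennreal (m ^ card I)"
    using m by (simp add: ennreal_power)
  finally show ?thesis .
qed

text \<open>The hypothesis holds with equality for \<open>T\<close> times a chi-square variable with one degree of
  freedom.\<close>

lemma (in prob_space) chi_square_type_tail:
  fixes Y :: "'i \<Rightarrow> 'a \<Rightarrow> real" and T u :: real
  assumes I: "finite I" and indep: "indep_vars (\<lambda>_. borel) Y I" and T: "0 < T" and u: "1 \<le> u"
    and mgf: "\<And>i c. i \<in> I \<Longrightarrow> 0 \<le> c \<Longrightarrow> 2 * c * T < 1 \<Longrightarrow>
      (\<integral>\<^sup>+\<omega>. ennreal (exp (c * Y i \<omega>)) \<partial>M) \<le> ennreal ((1 - 2 * c * T) powr (- 1 / 2))"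
  shows "prob {\<omega> \<in> space M. u\<^sup>2 * (card I * T) < (\<Sum>i\<in>I. Y i \<omega>)}
      \<le> (u * exp (- (u\<^sup>2 - 1) / 2)) ^ card I"
proof (cases "u = 1")
  case True
  then show ?thesis by simp
next
  case False
  with u have u: "1 < u" by simp
  have [measurable]: "Y i \<in> borel_measurable M" if "i \<in> I" for i
    using indep that by (auto simp: indep_vars_def)
  define c where "c = (1 - 1 / u\<^sup>2) / (2 * T)"
  have c: "0 < c" using T u by (simp add: c_def)
  have c_eq: "1 - 2 * c * T = u powr (- 2)" "c * (u\<^sup>2 * (card I * T)) = card I * ((u\<^sup>2 - 1) / 2)"
    using T u by (auto simp: c_def powr_minus field_simps)
  then have "2 * c * T < 1" using u powr_gt_zero[of u "- 2"] by linarith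
  have "(1 - 2 * c * T) powr (- 1 / 2) = u"
    using u by (simp add: c_eq(1) powr_powr)
  then have moment: "(\<integral>\<^sup>+\<omega>. ennreal (exp (c * (\<Sum>i\<in>I. Y i \<omega>))) \<partial>M) \<le> ennreal (u ^ card I)"
    using mgf[of _ c] c \<open>2 * c * T < 1\<close> u by (intro nn_integral_exp_sum_indep_le I indep) auto
  have "emeasure M {\<omega> \<in> space M. u\<^sup>2 * (card I * T) < (\<Sum>i\<in>I. Y i \<omega>)}
      \<le> emeasure M {\<omega> \<in> space M. u\<^sup>2 * (card I * T) \<le> (\<Sum>i\<in>I. Y i \<omega>)}"
    by (intro emeasure_mono) auto
  also have "\<dots> \<le> ennreal (exp (- c * (u\<^sup>2 * (card I * T))))
      * (\<integral>\<^sup>+\<omega>. ennreal (exp (c * (\<Sum>i\<in>I. Y i \<omega>))) * indicator (space M) \<omega> \<partial>M)"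
    using c by (intro Chernoff_ineq_nn_integral_ge) auto
  also have "\<dots> \<le> ennreal (exp (- c * (u\<^sup>2 * (card I * T)))) * ennreal (u ^ card I)"
    using moment by (intro mult_left_mono) (simp_all cong: nn_integral_cong_simp)
  also have "exp (- c * (u\<^sup>2 * (card I * T))) = exp (- (u\<^sup>2 - 1) / 2) ^ card I"
    unfolding mult_minus_left c_eq(2) by (simp flip: exp_of_nat_mult) (simp add: field_simps)
  finally show ?thesis
    using u by (simp add: emeasure_eq_measure power_mult_distrib mult.commute flip: ennreal_mult)
qed

section \<open>Gaussian variables\<close>

text \<open>The case \<open>v = 0\<close> is a point mass.\<close>

definition centered_gaussian :: "'w measure \<Rightarrow> ('w \<Rightarrow> real) \<Rightarrow> real \<Rightarrow> bool" where
  "centered_gaussian M X v \<longleftrightarrow> X \<in> borel_measurable M \<and> 0 \<le> v \<and>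
     distr M borel X = distr std_normal_distribution borel (\<lambda>x. sqrt v * x)"

lemma gaussian_rv_cong:
  assumes eq: "\<And>\<omega>. \<omega> \<in> space M \<Longrightarrow> X \<omega> = Y \<omega>"
  shows "gaussian_rv M X \<longleftrightarrow> gaussian_rv M Y"
proof -
  have "distr M lborel X = distr M lborel Y" by (rule distr_cong) (auto simp: eq)
  moreover have "X \<in> borel_measurable M \<longleftrightarrow> Y \<in> borel_measurable M"
    by (rule measurable_cong) (rule eq)
  moreover have "(AE \<omega> in M. X \<omega> = \<mu>) \<longleftrightarrow> (AE \<omega> in M. Y \<omega> = \<mu>)" for \<mu>
    by (rule AE_cong) (simp add: eq)
  ultimately show ?thesis by (simp add: gaussian_rv_def distributed_def)
qed

context prob_space
begin

lemma gaussian_rv_square_integrable: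
  assumes X: "gaussian_rv M X"
  shows "integrable M (\<lambda>\<omega>. (X \<omega>)\<^sup>2)"
proof -
  have [measurable]: "X \<in> borel_measurable M" using X by (simp add: gaussian_rv_def)
  from X consider \<mu> where "AE \<omega> in M. X \<omega> = \<mu>"
    | \<mu> s where "0 < s" "distributed M lborel X (\<lambda>x. ennreal (normal_density \<mu> s x))"
    by (auto simp: gaussian_rv_def)
  then show ?thesis
  proof cases
    case 1
    then show ?thesis by (intro integrable_const_bound[where B="\<mu>\<^sup>2"]) auto
  next
    case 2
    have "integrable M (\<lambda>\<omega>. (X \<omega> - \<mu>)\<^sup>2)"
      using 2 integrable_normal_moment[of s \<mu> 2] distributed_integrable[OF 2(2), of "\<lambda>x. (x - \<mu>)\<^sup>2"]
      by simp
    moreover from this have "integrable M (\<lambda>\<omega>. X \<omega> - \<mu>)"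
      by (rule square_integrable_imp_integrable[rotated]) simp
    ultimately have "integrable M (\<lambda>\<omega>. (X \<omega> - \<mu>)\<^sup>2 + 2 * \<mu> * (X \<omega> - \<mu>) + \<mu>\<^sup>2)" by simp
    then show ?thesis by (simp add: power2_eq_square algebra_simps)
  qed
qed

lemma gaussian_rv_integrable: "gaussian_rv M X \<Longrightarrow> integrable M X"
  using gaussian_rv_square_integrable square_integrable_imp_integrable
  by (auto simp: gaussian_rv_def)

lemma gaussian_rv_centered:
  assumes X: "gaussian_rv M X" and mean: "expectation X = 0" and var: "expectation (\<lambda>\<omega>. (X \<omega>)\<^sup>2) = v"
  shows "centered_gaussian M X v"
proof -
  have [measurable]: "X \<in> borel_measurable M" using X by (simp add: gaussian_rv_def)
  have "distr M borel X = distr std_normal_distribution borel (\<lambda>x. sqrt v * x)"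
  proof -
    from X consider \<mu> where "AE \<omega> in M. X \<omega> = \<mu>"
      | \<mu> s where "0 < s" "distributed M lborel X (\<lambda>x. ennreal (normal_density \<mu> s x))"
      by (auto simp: gaussian_rv_def)
    then show ?thesis
    proof cases
      case 1
      then have "expectation X = expectation (\<lambda>_. \<mu>)" by (intro integral_cong_AE) auto
      with mean 1 have zero: "AE \<omega> in M. X \<omega> = 0" by (simp add: prob_space)
      then have "expectation (\<lambda>\<omega>. (X \<omega>)\<^sup>2) = expectation (\<lambda>_. 0)" by (intro integral_cong_AE) auto
      moreover have "distr M borel X = distr M borel (\<lambda>_. 0)"
        using zero by (intro distr_cong_AE) auto
      ultimately show ?thesis using var by (simp add: std_normal.distr_const)
    next
      case 2
      have "\<mu> = 0" using normal_distributed_expectation[OF 2] mean by simp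
      moreover have "variance X = s\<^sup>2" by (rule normal_distributed_variance[OF 2])
      ultimately have s: "\<mu> = 0" "sqrt v = s" using var mean 2(1) by auto
      have "distributed M lborel (\<lambda>\<omega>. (X \<omega> - \<mu>) / s) std_normal_density"
        using normal_standard_normal_convert[OF 2(1), of X \<mu>] 2(2) by simp
      then have "std_normal_distribution = distr M lborel (\<lambda>\<omega>. X \<omega> / s)"
        by (simp add: s distributed_def)
      also have "distr \<dots> borel (\<lambda>x. sqrt v * x) = distr M borel X"
        using 2(1) by (subst distr_distr) (simp_all add: s comp_def)
      finally show ?thesis ..
    qed
  qed
  then show ?thesis using var by (auto simp: centered_gaussian_def)
qed

lemma centered_gaussian_measurable: "centered_gaussian M X v \<Longrightarrow> X \<in> borel_measurable M"
  by (simp add: centered_gaussian_def)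

lemma centered_gaussian_variance_nonneg: "centered_gaussian M X v \<Longrightarrow> 0 \<le> v"
  by (simp add: centered_gaussian_def)

lemma centered_gaussian_distr:
  "centered_gaussian M X v \<Longrightarrow> distr M borel X = distr std_normal_distribution borel (\<lambda>x. sqrt v * x)"
  by (simp add: centered_gaussian_def)

lemma centered_gaussian_char:
  assumes X: "centered_gaussian M X v"
  shows "expectation (\<lambda>\<omega>. iexp (X \<omega>)) = complex_of_real (exp (- v / 2))"
proof -
  note [measurable] = centered_gaussian_measurable[OF X]
  have "expectation (\<lambda>\<omega>. iexp (X \<omega>)) = (\<integral>x. iexp x \<partial>distr M borel X)"
    by (subst integral_distr) auto
  also have "\<dots> = char std_normal_distribution (sqrt v)"
    unfolding centered_gaussian_distr[OF X] char_def by (subst integral_distr) auto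
  finally show ?thesis
    using centered_gaussian_variance_nonneg[OF X] by (simp add: char_std_normal_distribution)
qed

lemma nn_integral_exp_square_centered_gaussian:
  assumes X: "centered_gaussian M X v" and c: "2 * c * v < 1"
  shows "(\<integral>\<^sup>+\<omega>. ennreal (exp (c * (X \<omega>)\<^sup>2)) \<partial>M) = ennreal ((1 - 2 * c * v) powr (- 1 / 2))"
proof -
  note [measurable] = centered_gaussian_measurable[OF X]
  have "(\<integral>\<^sup>+\<omega>. ennreal (exp (c * (X \<omega>)\<^sup>2)) \<partial>M) = (\<integral>\<^sup>+x. ennreal (exp (c * x\<^sup>2)) \<partial>distr M borel X)"
    by (subst nn_integral_distr) auto
  also have "\<dots> = (\<integral>\<^sup>+x. ennreal (exp (c * v * x\<^sup>2)) \<partial>std_normal_distribution)"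
    unfolding centered_gaussian_distr[OF X] using centered_gaussian_variance_nonneg[OF X]
    by (subst nn_integral_distr) (auto simp: power_mult_distrib mult.assoc)
  finally show ?thesis
    using c nn_integral_exp_square_std_normal[of "c * v"] by (simp add: mult.assoc)
qed

lemma centered_gaussian_0_AE:
  assumes X: "centered_gaussian M X 0"
  shows "AE \<omega> in M. X \<omega> = 0"
proof -
  note [measurable] = centered_gaussian_measurable[OF X]
  have "AE x in distr M borel X. x = 0"
    unfolding centered_gaussian_distr[OF X] by (subst AE_distr_iff) auto
  then show ?thesis by (subst (asm) AE_distr_iff) auto
qed

text \<open>Jensen's inequality with weights \<open>v i / sum v J\<close> reduces the exponential moment of a correlated
  Gaussian vector to that of a single Gaussian variable, without diagonalising.\<close>

lemma nn_integral_exp_sum_squares_pos_le: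
  fixes X :: "'i \<Rightarrow> 'a \<Rightarrow> real"
  assumes J: "finite J" "J \<noteq> {}" and X: "\<And>i. i \<in> J \<Longrightarrow> centered_gaussian M (X i) (v i)"
    and v: "\<And>i. i \<in> J \<Longrightarrow> 0 < v i" and c: "2 * c * sum v J < 1"
  shows "(\<integral>\<^sup>+\<omega>. ennreal (exp (c * (\<Sum>i\<in>J. (X i \<omega>)\<^sup>2))) \<partial>M)
      \<le> ennreal ((1 - 2 * c * sum v J) powr (- 1 / 2))"
proof -
  define T where "T = sum v J"
  let ?w = "\<lambda>i. v i / T" and ?c = "\<lambda>i. c * T / v i"
  have T: "0 < T" unfolding T_def using J v by (intro sum_pos) auto
  have w: "sum ?w J = 1" using T by (simp add: T_def flip: sum_divide_distrib)
  have [measurable]: "X i \<in> borel_measurable M" if "i \<in> J" for i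
    using X[OF that] by (rule centered_gaussian_measurable)
  have "exp (c * (\<Sum>i\<in>J. (X i \<omega>)\<^sup>2)) \<le> (\<Sum>i\<in>J. ?w i * exp (?c i * (X i \<omega>)\<^sup>2))" for \<omega>
  proof -
    have "c * (\<Sum>i\<in>J. (X i \<omega>)\<^sup>2) = (\<Sum>i\<in>J. ?w i *\<^sub>R (?c i * (X i \<omega>)\<^sup>2))"
      unfolding sum_distrib_left using T by (intro sum.cong refl) (auto dest!: v)
    then show ?thesis
      using convex_on_sum[OF J exp_convex w, of "\<lambda>i. ?c i * (X i \<omega>)\<^sup>2"] v T
      by (simp add: less_imp_le)
  qed
  then have "(\<integral>\<^sup>+\<omega>. ennreal (exp (c * (\<Sum>i\<in>J. (X i \<omega>)\<^sup>2))) \<partial>M)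
      \<le> (\<integral>\<^sup>+\<omega>. ennreal (\<Sum>i\<in>J. ?w i * exp (?c i * (X i \<omega>)\<^sup>2)) \<partial>M)"
    by (intro nn_integral_mono ennreal_leI)
  also have "\<dots> = (\<integral>\<^sup>+\<omega>. (\<Sum>i\<in>J. ennreal (?w i) * ennreal (exp (?c i * (X i \<omega>)\<^sup>2))) \<partial>M)"
    using v T by (simp add: less_imp_le flip: sum_ennreal ennreal_mult)
  also have "\<dots> = (\<Sum>i\<in>J. ennreal (?w i) * (\<integral>\<^sup>+\<omega>. ennreal (exp (?c i * (X i \<omega>)\<^sup>2)) \<partial>M))"
    by (simp add: nn_integral_sum nn_integral_cmult)
  also have "\<dots> = (\<Sum>i\<in>J. ennreal (?w i) * ennreal ((1 - 2 * c * T) powr (- 1 / 2)))"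
  proof (intro sum.cong arg_cong[where f="(*) _"] refl)
    fix i assume i: "i \<in> J"
    have "2 * ?c i * v i = 2 * c * T" using v[OF i] by simp
    then show "(\<integral>\<^sup>+\<omega>. ennreal (exp (?c i * (X i \<omega>)\<^sup>2)) \<partial>M) = ennreal ((1 - 2 * c * T) powr (- 1 / 2))"
      using nn_integral_exp_square_centered_gaussian[OF X[OF i], of "?c i"] c by (simp add: T_def)
  qed
  also have "\<dots> = ennreal (sum ?w J) * ennreal ((1 - 2 * c * T) powr (- 1 / 2))"
    unfolding sum_distrib_right[symmetric] using v T by (subst sum_ennreal) (auto simp: less_imp_le)
  finally show ?thesis by (simp add: w flip: T_def)
qed

lemma nn_integral_exp_sum_squares_le:
  fixes X :: "'i \<Rightarrow> 'a \<Rightarrow> real"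
  assumes J: "finite J" and X: "\<And>i. i \<in> J \<Longrightarrow> centered_gaussian M (X i) (v i)"
    and c: "2 * c * sum v J < 1"
  shows "(\<integral>\<^sup>+\<omega>. ennreal (exp (c * (\<Sum>i\<in>J. (X i \<omega>)\<^sup>2))) \<partial>M)
      \<le> ennreal ((1 - 2 * c * sum v J) powr (- 1 / 2))"
proof -
  define J' where "J' = {i \<in> J. v i \<noteq> 0}"
  have v: "0 < v i" if "i \<in> J'" for i
    using that X[of i] centered_gaussian_variance_nonneg[of "X i" "v i"] by (simp add: J'_def)
  have sum_J': "sum v J' = sum v J"
    using J by (intro sum.mono_neutral_left) (auto simp: J'_def)
  have "AE \<omega> in M. X i \<omega> = 0" if "i \<in> J - J'" for i
    using X[of i] that by (intro centered_gaussian_0_AE) (auto simp: J'_def)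
  then have "AE \<omega> in M. \<forall>i\<in>J - J'. X i \<omega> = 0"
    using J by (intro AE_finite_allI) auto
  then have "AE \<omega> in M. (\<Sum>i\<in>J. (X i \<omega>)\<^sup>2) = (\<Sum>i\<in>J'. (X i \<omega>)\<^sup>2)"
    by eventually_elim (use J in \<open>auto intro!: sum.mono_neutral_right simp: J'_def\<close>)
  then have "(\<integral>\<^sup>+\<omega>. ennreal (exp (c * (\<Sum>i\<in>J. (X i \<omega>)\<^sup>2))) \<partial>M)
      = (\<integral>\<^sup>+\<omega>. ennreal (exp (c * (\<Sum>i\<in>J'. (X i \<omega>)\<^sup>2))) \<partial>M)"
    by (intro nn_integral_cong_AE) auto
  also have "\<dots> \<le> ennreal ((1 - 2 * c * sum v J') powr (- 1 / 2))"
  proof (cases "J' = {}")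
    case True
    then show ?thesis by (simp add: emeasure_space_1)
  next
    case False
    then show ?thesis
      using J X v c sum_J' by (intro nn_integral_exp_sum_squares_pos_le) (auto simp: J'_def)
  qed
  finally show ?thesis by (simp only: sum_J')
qed

end

section \<open>Gaussian matrices\<close>

definition bilin :: "nat \<Rightarrow> real mat \<Rightarrow> (nat \<Rightarrow> real) \<Rightarrow> (nat \<Rightarrow> real) \<Rightarrow> real" where
  "bilin n K v w = (\<Sum>i<n. \<Sum>j<n. v i * w j * K $$ (i, j))"

lemma bilin_add_left: "bilin n K (\<lambda>i. v i + v' i) w = bilin n K v w + bilin n K v' w"
  by (simp add: bilin_def distrib_left distrib_right sum.distrib)

lemma bilin_add_right: "bilin n K w (\<lambda>i. v i + v' i) = bilin n K w v + bilin n K w v'"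
  by (simp add: bilin_def distrib_left distrib_right sum.distrib)

lemma bilin_scale_left: "bilin n K (\<lambda>i. c * v i) w = c * bilin n K v w"
  by (simp add: bilin_def sum_distrib_left mult_ac)

lemma bilin_scale_right: "bilin n K w (\<lambda>i. c * v i) = c * bilin n K w v"
  by (simp add: bilin_def sum_distrib_left mult_ac)

lemma bilin_sum_left: "bilin n K (\<lambda>i. \<Sum>a\<in>A. v a i) w = (\<Sum>a\<in>A. bilin n K (v a) w)"
  by (induction A rule: infinite_finite_induct)
    (simp_all add: bilin_add_left, simp_all add: bilin_def)

lemma bilin_sum_right: "bilin n K w (\<lambda>i. \<Sum>a\<in>A. v a i) = (\<Sum>a\<in>A. bilin n K w (v a))"
  by (induction A rule: infinite_finite_induct)
    (simp_all add: bilin_add_right, simp_all add: bilin_def)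

lemmas bilin_linear = bilin_add_left bilin_add_right bilin_scale_left bilin_scale_right
  bilin_sum_left bilin_sum_right

lemma bilin_commute:
  assumes "sym_psd_mat n K"
  shows "bilin n K v w = bilin n K w v"
proof -
  have K: "K \<in> carrier_mat n n" "transpose_mat K = K" using assms by (auto simp: sym_psd_mat_def)
  have "K $$ (i, j) = K $$ (j, i)" if "i < n" "j < n" for i j
    using arg_cong[OF K(2), of "\<lambda>B. B $$ (j, i)"] K(1) that by simp
  then have "bilin n K v w = (\<Sum>i<n. \<Sum>j<n. w j * v i * K $$ (j, i))"
    unfolding bilin_def by (intro sum.cong refl) auto
  also have "\<dots> = bilin n K w v" unfolding bilin_def by (rule sum.swap)
  finally show ?thesis .
qed

lemma bilin_self_nonneg:
  assumes "sym_psd_mat n K"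
  shows "0 \<le> bilin n K v v"
proof -
  define x where "x = Matrix.vec n v"
  have "0 \<le> scalar_prod x (K *\<^sub>v x)" using assms by (auto simp: sym_psd_mat_def x_def)
  also have "\<dots> = bilin n K v v"
    using assms by (auto simp: sym_psd_mat_def x_def bilin_def scalar_prod_def atLeast0LessThan
        sum_distrib_left mult_ac intro!: sum.cong)
  finally show ?thesis .
qed

lemma bilin_self_pos:
  assumes K: "sym_psd_mat n K" and wz: "bilin n K w z = 1"
  shows "0 < bilin n K z z"
proof (rule ccontr)
  assume "\<not> 0 < bilin n K z z"
  then have zz: "bilin n K z z = 0" using bilin_self_nonneg[OF K, of z] by simp
  define q where "q = bilin n K w w"
  define e where "e = 1 / (q + 1)"
  have q: "0 \<le> q" unfolding q_def by (rule bilin_self_nonneg[OF K])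
  have "0 \<le> bilin n K (\<lambda>i. z i + - e * w i) (\<lambda>i. z i + - e * w i)" by (rule bilin_self_nonneg[OF K])
  also have "\<dots> = e * (e * q - 2)"
    unfolding bilin_linear zz wz bilin_commute[OF K, of z w] q_def[symmetric]
    by (simp add: algebra_simps)
  finally have "0 \<le> e * (e * q - 2)" .
  moreover have "0 < e" "e * q < 1" using q by (auto simp: e_def)
  ultimately show False by (simp add: zero_le_mult_iff)
qed

lemma bilin_dual_basis:
  fixes w z :: "'i \<Rightarrow> nat \<Rightarrow> real"
  assumes K: "sym_psd_mat n K" and I: "finite I"
    and inverse: "\<forall>a\<in>I. \<forall>i\<in>I. (\<Sum>c\<in>I. bilin n K (w a) (w c) * B c i) = of_bool (a = i)"
    and z: "\<And>i. z i = (\<lambda>m. \<Sum>c\<in>I. B c i * w c m)"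
  shows "a \<in> I \<Longrightarrow> i \<in> I \<Longrightarrow> bilin n K (w a) (z i) = of_bool (a = i)"
    and "i \<in> I \<Longrightarrow> bilin n K (z i) (z i) = B i i"
    and "i \<in> I \<Longrightarrow> 0 < B i i"
proof -
  show wz: "bilin n K (w a) (z i) = of_bool (a = i)" if "a \<in> I" "i \<in> I" for a i
    unfolding z bilin_linear using inverse that by (simp add: mult.commute)
  show zz: "bilin n K (z i) (z i) = B i i" if i: "i \<in> I" for i
  proof -
    have "bilin n K (z i) (z i) = (\<Sum>c\<in>I. B c i * bilin n K (w c) (z i))"
      by (subst (1) z) (simp add: bilin_linear)
    then show ?thesis using i I by (simp add: wz)
  qed
  show "0 < B i i" if "i \<in> I" for i
    using bilin_self_pos[OF K, of "w i" "z i"] wz[OF that that] zz[OF that] by simp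
qed

lemma bilin_normalized_dual_basis:
  fixes w z :: "'i \<Rightarrow> nat \<Rightarrow> real"
  assumes K: "sym_psd_mat n K" and I: "finite I"
    and inverse: "\<forall>a\<in>I. \<forall>i\<in>I. (\<Sum>c\<in>I. bilin n K (w a) (w c) * B c i) = of_bool (a = i)"
    and z: "\<And>i. z i = (\<lambda>m. \<Sum>c\<in>I. B c i * w c m)" and i: "i \<in> I"
  defines "b \<equiv> \<lambda>m. inverse (sqrt (B i i)) * z i m"
  shows "bilin n K b b = 1" and "a \<in> I - {i} \<Longrightarrow> bilin n K b (w a) = 0"
proof -
  note dual = bilin_dual_basis[OF K I inverse z]
  show "bilin n K b b = 1"
    unfolding b_def bilin_linear dual(2)[OF i] using dual(3)[OF i] by (simp add: field_simps)
  show "bilin n K b (w a) = 0" if "a \<in> I - {i}"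
    unfolding b_def bilin_linear bilin_commute[OF K, of "z i"] using dual(1)[of a i] that i by auto
qed

locale gaussian_columns = prob_space M for M :: "'w measure" +
  fixes n l :: nat and \<Omega> :: "'w \<Rightarrow> real mat" and K :: "real mat"
  assumes gaussian: "gaussian_random_matrix M n l \<Omega> K"
    and psd: "sym_psd_mat n K"
begin

definition sketch :: "(nat \<Rightarrow> real) \<Rightarrow> 'w \<Rightarrow> nat \<Rightarrow> real" where
  "sketch v \<omega> j = (\<Sum>i<n. v i * \<Omega> \<omega> $$ (i, j))"

lemma sketch_add: "sketch (\<lambda>i. v i + w i) \<omega> j = sketch v \<omega> j + sketch w \<omega> j"
  by (simp add: sketch_def distrib_right sum.distrib)

lemma sketch_scale: "sketch (\<lambda>i. c * v i) \<omega> j = c * sketch v \<omega> j"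
  by (simp add: sketch_def sum_distrib_left mult_ac)

lemma sketch_sum: "sketch (\<lambda>i. \<Sum>a\<in>A. v a i) \<omega> j = (\<Sum>a\<in>A. sketch (v a) \<omega> j)"
  unfolding sketch_def sum_distrib_right by (rule sum.swap)

lemma carrier_\<Omega>: "\<omega> \<in> space M \<Longrightarrow> \<Omega> \<omega> \<in> carrier_mat n l"
  using gaussian by (auto simp: gaussian_random_matrix_def)

lemma multivariate_gaussian_col: "j < l \<Longrightarrow> multivariate_gaussian M n (\<lambda>\<omega>. col (\<Omega> \<omega>) j) (0\<^sub>v n) K"
  using gaussian by (auto simp: gaussian_random_matrix_def)

lemma gaussian_rv_sketch:
  assumes j: "j < l"
  shows "gaussian_rv M (\<lambda>\<omega>. sketch v \<omega> j)"
proof -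
  have "gaussian_rv M (\<lambda>\<omega>. scalar_prod (Matrix.vec n v) (col (\<Omega> \<omega>) j))"
    using multivariate_gaussian_col[OF j] by (auto simp: multivariate_gaussian_def)
  moreover have "scalar_prod (Matrix.vec n v) (col (\<Omega> \<omega>) j) = sketch v \<omega> j" if "\<omega> \<in> space M" for \<omega>
    using carrier_\<Omega>[OF that] j
    by (auto simp: scalar_prod_def sketch_def atLeast0LessThan intro!: sum.cong)
  ultimately show ?thesis by (simp cong: gaussian_rv_cong)
qed

lemma borel_measurable_sketch [measurable]: "j < l \<Longrightarrow> (\<lambda>\<omega>. sketch v \<omega> j) \<in> borel_measurable M"
  using gaussian_rv_sketch[of j v] by (simp add: gaussian_rv_def)

lemma sketch_indicator: "i < n \<Longrightarrow> sketch (indicator {i}) \<omega> j = \<Omega> \<omega> $$ (i, j)"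
  by (simp add: sketch_def indicator_def)

lemma entry_integrable: "i < n \<Longrightarrow> j < l \<Longrightarrow> integrable M (\<lambda>\<omega>. \<Omega> \<omega> $$ (i, j))"
  using gaussian_rv_integrable[OF gaussian_rv_sketch[of j "indicator {i}"]]
  by (simp add: sketch_indicator)

lemma entry_mult_integrable:
  assumes i: "i < n" "i' < n" and j: "j < l"
  shows "integrable M (\<lambda>\<omega>. \<Omega> \<omega> $$ (i, j) * \<Omega> \<omega> $$ (i', j))"
proof -
  let ?e = "\<lambda>i. indicator {i} :: nat \<Rightarrow> real"
  have square: "integrable M (\<lambda>\<omega>. (sketch v \<omega> j)\<^sup>2)" for v
    by (rule gaussian_rv_square_integrable[OF gaussian_rv_sketch[OF j]])
  have "integrable M (\<lambda>\<omega>.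
      ((sketch (\<lambda>m. ?e i m + ?e i' m) \<omega> j)\<^sup>2 - (sketch (?e i) \<omega> j)\<^sup>2 - (sketch (?e i') \<omega> j)\<^sup>2) / 2)"
    by (intro Bochner_Integration.integrable_diff integrable_divide_zero square)
  then show ?thesis
    using i by (simp add: sketch_add sketch_indicator power2_sum)
qed

lemma expectation_entry:
  assumes i: "i < n" and j: "j < l"
  shows "expectation (\<lambda>\<omega>. \<Omega> \<omega> $$ (i, j)) = 0"
proof -
  have "expectation (\<lambda>\<omega>. \<Omega> \<omega> $$ (i, j)) = expectation (\<lambda>\<omega>. vec_index (col (\<Omega> \<omega>) j) i)"
    using i j by (intro Bochner_Integration.integral_cong) (auto dest!: carrier_\<Omega>)
  also have "\<dots> = 0"
    using multivariate_gaussian_col[OF j] i by (simp add: multivariate_gaussian_def)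
  finally show ?thesis .
qed

lemma expectation_entry_mult:
  assumes i: "i < n" "i' < n" and j: "j < l"
  shows "expectation (\<lambda>\<omega>. \<Omega> \<omega> $$ (i, j) * \<Omega> \<omega> $$ (i', j)) = K $$ (i, i')"
proof -
  have "expectation (\<lambda>\<omega>. \<Omega> \<omega> $$ (i, j) * \<Omega> \<omega> $$ (i', j)) = expectation (\<lambda>\<omega>.
      (vec_index (col (\<Omega> \<omega>) j) i - vec_index (0\<^sub>v n) i)
      * (vec_index (col (\<Omega> \<omega>) j) i' - vec_index (0\<^sub>v n) i'))"
    using i j by (intro Bochner_Integration.integral_cong) (auto dest!: carrier_\<Omega>)
  also have "\<dots> = K $$ (i, i')"
    using multivariate_gaussian_col[OF j] i unfolding multivariate_gaussian_def by blast
  finally show ?thesis .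
qed

lemma centered_gaussian_sketch:
  assumes j: "j < l"
  shows "centered_gaussian M (\<lambda>\<omega>. sketch v \<omega> j) (bilin n K v v)"
proof (rule gaussian_rv_centered[OF gaussian_rv_sketch[OF j]])
  show "expectation (\<lambda>\<omega>. sketch v \<omega> j) = 0"
    using j by (simp add: sketch_def entry_integrable expectation_entry)
  have "has_bochner_integral M (\<lambda>\<omega>. \<Sum>i<n. \<Sum>i'<n. v i * v i' * (\<Omega> \<omega> $$ (i, j) * \<Omega> \<omega> $$ (i', j)))
      (bilin n K v v)"
    unfolding bilin_def using j
    by (intro has_bochner_integral_sum has_bochner_integral_mult_right)
      (simp_all add: has_bochner_integral_iff entry_mult_integrable expectation_entry_mult)
  moreover have "(sketch v \<omega> j)\<^sup>2 = (\<Sum>i<n. \<Sum>i'<n. v i * v i' * (\<Omega> \<omega> $$ (i, j) * \<Omega> \<omega> $$ (i', j)))"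
    for \<omega>
    unfolding sketch_def power2_eq_square sum_product by (simp add: mult_ac)
  ultimately show "expectation (\<lambda>\<omega>. (sketch v \<omega> j)\<^sup>2) = bilin n K v v"
    by (simp add: has_bochner_integral_iff)
qed

lemma indep_columns:
  assumes f: "\<And>j. j < l \<Longrightarrow> f j \<in> measurable (\<Pi>\<^sub>M i\<in>{..<n}. borel) N"
    and g: "\<And>j \<omega>. j < l \<Longrightarrow> g j \<omega> = f j (\<lambda>i\<in>{..<n}. \<Omega> \<omega> $$ (i, j))"
  shows "indep_vars (\<lambda>_. N) g {..<l}"
proof -
  have "indep_vars (\<lambda>_. \<Pi>\<^sub>M i\<in>{..<n}. borel) (\<lambda>j \<omega>. \<lambda>i\<in>{..<n}. \<Omega> \<omega> $$ (i, j)) {..<l}"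
    using gaussian by (simp only: gaussian_random_matrix_def)
  then have "indep_vars (\<lambda>_. N) (\<lambda>j \<omega>. f j (\<lambda>i\<in>{..<n}. \<Omega> \<omega> $$ (i, j))) {..<l}"
    by (rule indep_vars_compose2) (use f in auto)
  moreover have "indep_vars (\<lambda>_. N) g {..<l}
      = indep_vars (\<lambda>_. N) (\<lambda>j \<omega>. f j (\<lambda>i\<in>{..<n}. \<Omega> \<omega> $$ (i, j))) {..<l}"
    by (rule indep_vars_cong) (use g in auto)
  ultimately show ?thesis by simp
qed

lemma joint_char_sketch:
  "expectation (\<lambda>\<omega>. iexp (\<Sum>j<l. sketch (v j) \<omega> j))
      = complex_of_real (exp (- (\<Sum>j<l. bilin n K (v j) (v j)) / 2))"
proof -
  have "expectation (\<lambda>\<omega>. iexp (\<Sum>j<l. sketch (v j) \<omega> j))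
      = expectation (\<lambda>\<omega>. \<Prod>j<l. iexp (sketch (v j) \<omega> j))"
    by (simp add: exp_sum sum_distrib_left)
  also have "\<dots> = (\<Prod>j<l. expectation (\<lambda>\<omega>. iexp (sketch (v j) \<omega> j)))"
  proof (rule indep_vars_lebesgue_integral)
    show "indep_vars (\<lambda>_. borel) (\<lambda>j \<omega>. iexp (sketch (v j) \<omega> j)) {..<l}"
    proof (rule indep_columns)
      show "iexp (sketch (v j) \<omega> j) = iexp (\<Sum>i<n. v j i * (\<lambda>i\<in>{..<n}. \<Omega> \<omega> $$ (i, j)) i)" for j \<omega>
        by (simp add: sketch_def)
    qed measurable
    show "integrable M (\<lambda>\<omega>. iexp (sketch (v j) \<omega> j))" if "j \<in> {..<l}" for j
      using that by (intro integrable_const_bound[where B=1]) auto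
  qed simp
  also have "\<dots> = (\<Prod>j<l. complex_of_real (exp (- bilin n K (v j) (v j) / 2)))"
    by (intro prod.cong refl centered_gaussian_char centered_gaussian_sketch) simp
  also have "\<dots> = complex_of_real (exp (- (\<Sum>j<l. bilin n K (v j) (v j)) / 2))"
    by (simp add: exp_sum sum_divide_distrib flip: sum_negf)
  finally show ?thesis .
qed

lemma joint_char_sketch_unit:
  assumes "bilin n K b b = 1"
  shows "expectation (\<lambda>\<omega>. iexp (\<Sum>j<l. s j * sketch b \<omega> j))
      = complex_of_real (exp (- (\<Sum>j<l. (s j)\<^sup>2) / 2))"
  using joint_char_sketch[of "\<lambda>j i. s j * b i"]
  by (simp only: sketch_scale bilin_linear assms) (simp add: power2_eq_square)

lemma joint_char_sketch_factor:
  fixes w :: "'i \<Rightarrow> nat \<Rightarrow> real"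
  assumes A: "finite A" and b: "bilin n K b b = 1" "\<And>a. a \<in> A \<Longrightarrow> bilin n K b (w a) = 0"
  shows "expectation (\<lambda>\<omega>.
        iexp ((\<Sum>j<l. s j * sketch b \<omega> j) + (\<Sum>(a, j)\<in>A \<times> {..<l}. t (a, j) * sketch (w a) \<omega> j)))
    = expectation (\<lambda>\<omega>. iexp (\<Sum>j<l. s j * sketch b \<omega> j))
      * expectation (\<lambda>\<omega>. iexp (\<Sum>(a, j)\<in>A \<times> {..<l}. t (a, j) * sketch (w a) \<omega> j))"
proof -
  define u where "u j i = (\<Sum>a\<in>A. t (a, j) * w a i)" for j i
  have sketch_u: "(\<Sum>(a, j)\<in>A \<times> {..<l}. t (a, j) * sketch (w a) \<omega> j) = (\<Sum>j<l. sketch (u j) \<omega> j)"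
    for \<omega>
    unfolding u_def[abs_def] sketch_sum sketch_scale
    by (simp add: sum.cartesian_product[symmetric] sum.swap[of _ A])
  have "bilin n K b (u j) = 0" for j
    unfolding u_def[abs_def] bilin_linear using b(2) by simp
  then have bilin_u: "bilin n K b (u j) = 0" "bilin n K (u j) b = 0" for j
    by (simp_all add: bilin_commute[OF psd, of "u j" b])
  have "expectation (\<lambda>\<omega>. iexp ((\<Sum>j<l. s j * sketch b \<omega> j) + (\<Sum>j<l. sketch (u j) \<omega> j)))
      = expectation (\<lambda>\<omega>. iexp (\<Sum>j<l. sketch (\<lambda>i. s j * b i + u j i) \<omega> j))"
    unfolding sketch_add sketch_scale sum.distrib ..
  also have "\<dots> = complex_of_real (exp (- (\<Sum>j<l. (s j)\<^sup>2 + bilin n K (u j) (u j)) / 2))"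
    unfolding joint_char_sketch bilin_linear bilin_u b(1) by (simp add: power2_eq_square)
  also have "\<dots> = complex_of_real (exp (- (\<Sum>j<l. (s j)\<^sup>2) / 2))
      * complex_of_real (exp (- (\<Sum>j<l. bilin n K (u j) (u j)) / 2))"
    by (simp add: sum.distrib add_divide_distrib minus_add_distrib flip: exp_add of_real_mult)
  finally show ?thesis
    unfolding sketch_u joint_char_sketch_unit[OF b(1)] joint_char_sketch .
qed

lemma nn_integral_inv_powr_span_dist2_sketch_le:
  fixes w :: "'i \<Rightarrow> nat \<Rightarrow> real"
  assumes A: "finite A" "card A + (p + 1) \<le> l" and p: "4 \<le> p"
    and b: "bilin n K b b = 1" "\<And>a. a \<in> A \<Longrightarrow> bilin n K b (w a) = 0"
  shows "(\<integral>\<^sup>+\<omega>. inv_powr (p / 2) (span_dist2 l A (sketch b \<omega>) (\<lambda>a. sketch (w a) \<omega>)) \<partial>M)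
    \<le> ennreal ((3 / (real p + 1)) powr (p / 2))"
proof -
  let ?X = "\<lambda>\<omega>. \<lambda>j\<in>{..<l}. sketch b \<omega> j" and ?Y = "\<lambda>\<omega>. \<lambda>c\<in>A \<times> {..<l}. sketch (w (fst c)) \<omega> (snd c)"
  have "(\<integral>\<^sup>+\<omega>. inv_powr (p / 2) (span_dist2 l A (?X \<omega>) (\<lambda>a j. ?Y \<omega> (a, j))) \<partial>M)
      \<le> ennreal ((3 / (real p + 1)) powr (p / 2))"
  proof (rule nn_integral_inv_powr_span_dist2_le[OF A p])
    show "?X \<in> M \<rightarrow>\<^sub>M (\<Pi>\<^sub>M j\<in>{..<l}. borel)" "?Y \<in> M \<rightarrow>\<^sub>M (\<Pi>\<^sub>M c\<in>A \<times> {..<l}. borel)"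
      by (auto intro!: measurable_restrict)
    show "distr M (\<Pi>\<^sub>M j\<in>{..<l}. borel) ?X = (\<Pi>\<^sub>M j\<in>{..<l}. std_normal_distribution)"
      by (rule distr_eq_PiM_std_normal_if_char)
        (auto simp: joint_char_sketch_unit[OF b(1)] simp del: of_real_sum)
    show "distr M ((\<Pi>\<^sub>M j\<in>{..<l}. borel) \<Otimes>\<^sub>M (\<Pi>\<^sub>M c\<in>A \<times> {..<l}. borel)) (\<lambda>\<omega>. (?X \<omega>, ?Y \<omega>))
        = distr M (\<Pi>\<^sub>M j\<in>{..<l}. borel) ?X \<Otimes>\<^sub>M distr M (\<Pi>\<^sub>M c\<in>A \<times> {..<l}. borel) ?Y"
      using A(1) joint_char_sketch_factor[OF A(1) b]
      by (intro distr_Pair_eq_pair_measure_if_char_factor)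
        (auto simp: case_prod_beta' simp del: of_real_sum)
  qed
  moreover have "span_dist2 l A (?X \<omega>) (\<lambda>a j. ?Y \<omega> (a, j))
      = span_dist2 l A (sketch b \<omega>) (\<lambda>a. sketch (w a) \<omega>)" for \<omega>
    by (rule span_dist2_cong) auto
  ultimately show ?thesis by simp
qed

lemma sum_squares_sketch_tail:
  fixes w :: "'i \<Rightarrow> nat \<Rightarrow> real" and u T :: real
  assumes J: "finite J" and u: "1 \<le> u"
  defines "T \<equiv> \<Sum>i\<in>J. bilin n K (w i) (w i)"
  shows "prob {\<omega> \<in> space M. u\<^sup>2 * (l * T) < (\<Sum>j<l. \<Sum>i\<in>J. (sketch (w i) \<omega> j)\<^sup>2)}
    \<le> (u * exp (- (u\<^sup>2 - 1) / 2)) ^ l"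
proof (cases "T = 0")
  case True
  then have "bilin n K (w i) (w i) = 0" if "i \<in> J" for i
    using J that bilin_self_nonneg[OF psd] by (simp add: T_def sum_nonneg_eq_0_iff)
  then have "AE \<omega> in M. sketch (w i) \<omega> j = 0" if "i \<in> J" "j < l" for i j
    using centered_gaussian_sketch[OF that(2), of "w i"] that(1)
    by (auto intro: centered_gaussian_0_AE)
  then have "AE \<omega> in M. \<forall>j\<in>{..<l}. \<forall>i\<in>J. sketch (w i) \<omega> j = 0"
    using J by (intro AE_finite_allI) auto
  then have "AE \<omega> in M. \<not> u\<^sup>2 * (l * T) < (\<Sum>j<l. \<Sum>i\<in>J. (sketch (w i) \<omega> j)\<^sup>2)"
    by eventually_elim (simp add: True)
  then have "prob {\<omega> \<in> space M. u\<^sup>2 * (l * T) < (\<Sum>j<l. \<Sum>i\<in>J. (sketch (w i) \<omega> j)\<^sup>2)} = 0"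
    by (subst prob_eq_0) auto
  then show ?thesis using u by simp
next
  case False
  moreover have "0 \<le> T" unfolding T_def by (intro sum_nonneg bilin_self_nonneg[OF psd])
  ultimately have T: "0 < T" by simp
  have "prob {\<omega> \<in> space M. u\<^sup>2 * (card {..<l} * T) < (\<Sum>j<l. \<Sum>i\<in>J. (sketch (w i) \<omega> j)\<^sup>2)}
      \<le> (u * exp (- (u\<^sup>2 - 1) / 2)) ^ card {..<l}"
  proof (rule chi_square_type_tail[OF _ _ T u])
    show "indep_vars (\<lambda>_. borel) (\<lambda>j \<omega>. \<Sum>i\<in>J. (sketch (w i) \<omega> j)\<^sup>2) {..<l}"
    proof (rule indep_columns)
      show "(\<Sum>i\<in>J. (sketch (w i) \<omega> j)\<^sup>2) = (\<Sum>i\<in>J. (\<Sum>m<n. w i m * (\<lambda>m\<in>{..<n}. \<Omega> \<omega> $$ (m, j)) m)\<^sup>2)"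
        for j \<omega>
        by (simp add: sketch_def)
    qed measurable
    show "(\<integral>\<^sup>+\<omega>. ennreal (exp (c * (\<Sum>i\<in>J. (sketch (w i) \<omega> j)\<^sup>2))) \<partial>M)
        \<le> ennreal ((1 - 2 * c * T) powr (- 1 / 2))"
      if "j \<in> {..<l}" "2 * c * T < 1" for j c
      using that unfolding T_def
      by (intro nn_integral_exp_sum_squares_le J centered_gaussian_sketch) auto
  qed simp
  then show ?thesis by simp
qed

text \<open>For \<open>B = S\<^sup>-\<^sup>1\<close>, where \<open>S\<close> is the Gram matrix of the \<open>w a\<close>, the vectors \<open>z i\<close> form the dual
  basis, so that \<open>sketch (z i)\<close> is independent of \<open>sketch (w a)\<close> for \<open>a \<noteq> i\<close>.\<close>

lemma exists_dual_family_sketch: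
  fixes w z :: "'i \<Rightarrow> nat \<Rightarrow> real"
  assumes I: "finite I" and B: "\<And>i. i \<in> I \<Longrightarrow> 0 < B i i"
    and z: "\<And>i. z i = (\<lambda>m. \<Sum>c\<in>I. B c i * w c m)"
    and dist: "\<And>i. i \<in> I \<Longrightarrow>
      0 < span_dist2 l (I - {i}) (sketch (\<lambda>m. inverse (sqrt (B i i)) * z i m) \<omega>) (\<lambda>a. sketch (w a) \<omega>)"
      (is "\<And>i. i \<in> I \<Longrightarrow> 0 < ?D i")
  shows "\<exists>g. (\<forall>i\<in>I. \<forall>a\<in>I. dotp l (g i) (sketch (w a) \<omega>) = of_bool (i = a)) \<and>
    (\<Sum>i\<in>I. dotp l (g i) (g i)) \<le> (\<Sum>i\<in>I. B i i / ?D i)"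
proof -
  let ?r = "\<lambda>a. sketch (w a) \<omega>"
  have le: "?D i / B i i \<le> span_dist2 l (I - {i}) (?r i) ?r" if i: "i \<in> I" for i
  proof -
    have "?r i j = inverse (sqrt (B i i)) * sketch (\<lambda>m. inverse (sqrt (B i i)) * z i m) \<omega> j
        + (\<Sum>c\<in>I - {i}. - B c i / B i i * ?r c j)" for j
    proof -
      have "sketch (z i) \<omega> j = (\<Sum>c\<in>I. B c i * ?r c j)"
        by (simp add: z sketch_sum sketch_scale)
      then have "?r i j = 1 / B i i * sketch (z i) \<omega> j - (\<Sum>c\<in>I - {i}. B c i * ?r c j) / B i i"
        using B[OF i] by (simp add: sum.remove[OF I i] field_simps)
      then show ?thesis
        unfolding sketch_scale using B[OF i]
        by (simp add: sum_divide_distrib sum_negf inverse_eq_divide flip: mult.assoc)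
    qed
    then have "(inverse (sqrt (B i i)))\<^sup>2 * ?D i \<le> span_dist2 l (I - {i}) (?r i) ?r"
      using I by (intro span_dist2_scale_le[where d="\<lambda>c. - B c i / B i i"]) auto
    moreover have "(inverse (sqrt (B i i)))\<^sup>2 = 1 / B i i"
      using B[OF i] by (simp add: inverse_eq_divide power_divide)
    ultimately show ?thesis by simp
  qed
  have "0 < span_dist2 l (I - {i}) (?r i) ?r" if "i \<in> I" for i
    using le[OF that] B[OF that] dist[OF that] by (meson divide_pos_pos less_le_trans)
  from exists_dual_family[OF I this] obtain g
    where g: "\<forall>i\<in>I. \<forall>a\<in>I. dotp l (g i) (?r a) = of_bool (i = a)"
      "\<forall>i\<in>I. dotp l (g i) (g i) \<le> 1 / span_dist2 l (I - {i}) (?r i) ?r"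
    by blast
  have "(\<Sum>i\<in>I. dotp l (g i) (g i)) \<le> (\<Sum>i\<in>I. B i i / ?D i)"
  proof (rule sum_mono)
    fix i assume i: "i \<in> I"
    have "dotp l (g i) (g i) \<le> 1 / span_dist2 l (I - {i}) (?r i) ?r" using g(2) i by blast
    also have "\<dots> \<le> 1 / (?D i / B i i)"
      using le[OF i] B[OF i] dist[OF i] by (intro frac_le) auto
    finally show "dotp l (g i) (g i) \<le> B i i / ?D i" by simp
  qed
  then show ?thesis using g(1) by blast
qed

lemma dual_family_sketch_tail:
  fixes w :: "'i \<Rightarrow> nat \<Rightarrow> real" and B :: "'i \<Rightarrow> 'i \<Rightarrow> real" and t :: real
  assumes I: "finite I" "I \<noteq> {}" and l: "l = card I + p" and p: "4 \<le> p" and t: "1 \<le> t"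
    and inverse: "\<forall>a\<in>I. \<forall>i\<in>I. (\<Sum>c\<in>I. bilin n K (w a) (w c) * B c i) = of_bool (a = i)"
  shows "\<exists>F\<in>sets M. prob F \<le> 1 / t ^ p \<and>
    (\<forall>\<omega>\<in>space M - F. \<exists>g. (\<forall>i\<in>I. \<forall>a\<in>I. dotp l (g i) (sketch (w a) \<omega>) = of_bool (i = a)) \<and>
      (\<Sum>i\<in>I. dotp l (g i) (g i)) \<le> t\<^sup>2 * (3 / (real p + 1)) * (\<Sum>i\<in>I. B i i))"
proof -
  define z where "z i = (\<lambda>m. \<Sum>c\<in>I. B c i * w c m)" for i
  note B = bilin_dual_basis(3)[OF psd I(1) inverse z_def]
  define b where "b i = (\<lambda>m. inverse (sqrt (B i i)) * z i m)" for i
  define D where "D i \<omega> = span_dist2 l (I - {i}) (sketch (b i) \<omega>) (\<lambda>a. sketch (w a) \<omega>)" for i \<omega>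
  have [measurable]: "D i \<in> borel_measurable M" if "i \<in> I" for i
    unfolding D_def[abs_def] using I by (intro borel_measurable_span_dist2) auto
  define \<tau> where "\<tau> = t\<^sup>2 * (3 / (real p + 1))"
  define F where
    "F = {\<omega> \<in> space M. \<not> ((\<forall>i\<in>I. 0 < D i \<omega>) \<and> (\<Sum>i\<in>I. B i i / D i \<omega>) \<le> \<tau> * (\<Sum>i\<in>I. B i i))}"
  have \<tau>: "0 < \<tau>" using t by (simp add: \<tau>_def)
  have "F \<in> sets M" unfolding F_def using I by measurable
  moreover have "prob F \<le> 1 / t ^ p"
  proof -
    have "card (I - {i}) + (p + 1) \<le> l" if "i \<in> I" for i
      using that I l by (simp add: card_Diff_singleton card_gt_0_iff Suc_leI)
    then have "(\<integral>\<^sup>+\<omega>. inv_powr (p / 2) (D i \<omega>) \<partial>M) \<le> ennreal ((3 / (real p + 1)) powr (p / 2))"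
      if "i \<in> I" for i
      unfolding D_def using that I p
      by (intro nn_integral_inv_powr_span_dist2_sketch_le)
        (auto simp: b_def intro: bilin_normalized_dual_basis[OF psd I(1) inverse z_def])
    then have "prob F \<le> (3 / (real p + 1)) powr (p / 2) * \<tau> powr (- (p / 2))"
      unfolding F_def using I B p \<tau> by (intro weighted_inverse_sum_tail) auto
    also have "\<dots> = 1 / t ^ p"
      unfolding \<tau>_def using t by (intro powr_half_cancel) auto
    finally show ?thesis .
  qed
  moreover have "\<exists>g. (\<forall>i\<in>I. \<forall>a\<in>I. dotp l (g i) (sketch (w a) \<omega>) = of_bool (i = a)) \<and>
      (\<Sum>i\<in>I. dotp l (g i) (g i)) \<le> \<tau> * (\<Sum>i\<in>I. B i i)" if \<omega>: "\<omega> \<in> space M - F" for \<omega>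
  proof -
    have D_pos: "\<And>i. i \<in> I \<Longrightarrow> 0 < D i \<omega>" and D_sum: "(\<Sum>i\<in>I. B i i / D i \<omega>) \<le> \<tau> * (\<Sum>i\<in>I. B i i)"
      using \<omega> by (auto simp: F_def)
    have "\<exists>g. (\<forall>i\<in>I. \<forall>a\<in>I. dotp l (g i) (sketch (w a) \<omega>) = of_bool (i = a)) \<and>
        (\<Sum>i\<in>I. dotp l (g i) (g i)) \<le> (\<Sum>i\<in>I. B i i / D i \<omega>)"
      using D_pos unfolding D_def b_def by (intro exists_dual_family_sketch I(1) B z_def)
    with D_sum show ?thesis by (meson order_trans)
  qed
  ultimately show ?thesis unfolding \<tau>_def by blast
qed

end

section \<open>The deterministic error bound\<close>

lemma index_mult_mat_sum:
  fixes A B :: "real mat"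
  assumes "A \<in> carrier_mat a b" and "B \<in> carrier_mat b c" and "i < a" and "j < c"
  shows "(A * B) $$ (i, j) = (\<Sum>t<b. A $$ (i, t) * B $$ (t, j))"
  using assms by (auto simp: scalar_prod_def atLeast0LessThan intro!: sum.cong)

lemma trace_mat_mult_commute:
  assumes A: "A \<in> carrier_mat a b" and B: "B \<in> carrier_mat b a"
  shows "trace_mat (A * B) = trace_mat (B * A)"
proof -
  have "trace_mat (A * B) = (\<Sum>i<a. \<Sum>t<b. A $$ (i, t) * B $$ (t, i))"
    using A by (simp add: trace_mat_def index_mult_mat_sum[OF A B] del: index_mult_mat(1))
  also have "\<dots> = (\<Sum>t<b. \<Sum>i<a. B $$ (t, i) * A $$ (i, t))"
    by (subst sum.swap) (simp add: mult.commute)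
  also have "\<dots> = trace_mat (B * A)"
    using B by (simp add: trace_mat_def index_mult_mat_sum[OF B A] del: index_mult_mat(1))
  finally show ?thesis .
qed

lemma frobenius_norm_nonneg: "0 \<le> frobenius_norm B"
  by (simp add: frobenius_norm_def sum_nonneg)

lemma frobenius_norm_sq:
  assumes "B \<in> carrier_mat a b"
  shows "(frobenius_norm B)\<^sup>2 = (\<Sum>i<a. \<Sum>j<b. (B $$ (i, j))\<^sup>2)"
  using assms by (simp add: frobenius_norm_def sum_nonneg)

lemma frobenius_norm_eq_L2_set:
  assumes "B \<in> carrier_mat a b"
  shows "frobenius_norm B = L2_set (\<lambda>c. B $$ c) ({..<a} \<times> {..<b})"
  using assms by (simp add: frobenius_norm_def L2_set_def sum.cartesian_product case_prod_beta')

lemma frobenius_norm_sq_trace: "(frobenius_norm B)\<^sup>2 = trace_mat (transpose_mat B * B)"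
proof -
  have "trace_mat (transpose_mat B * B) = (\<Sum>j<dim_col B. \<Sum>i<dim_row B. (B $$ (i, j))\<^sup>2)"
    by (auto simp: trace_mat_def scalar_prod_def power2_eq_square atLeast0LessThan intro!: sum.cong)
  also have "\<dots> = (frobenius_norm B)\<^sup>2"
    by (subst sum.swap) (simp add: frobenius_norm_sq[OF carrier_matI[OF refl refl]])
  finally show ?thesis ..
qed

lemma frobenius_norm_eq_0_iff:
  assumes B: "B \<in> carrier_mat a b"
  shows "frobenius_norm B = 0 \<longleftrightarrow> B = 0\<^sub>m a b"
  using B by (auto simp: frobenius_norm_eq_L2_set[OF B] L2_set_eq_0_iff)

lemma frobenius_norm_diff_le:
  assumes A: "A \<in> carrier_mat a b" and B: "B \<in> carrier_mat a b"
  shows "frobenius_norm (A - B) \<le> frobenius_norm A + frobenius_norm B"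
proof -
  have "frobenius_norm (A - B) = L2_set (\<lambda>c. A $$ c + - B $$ c) ({..<a} \<times> {..<b})"
    unfolding frobenius_norm_eq_L2_set[OF minus_carrier_mat[OF B]]
    using A B by (intro L2_set_cong) auto
  also have "\<dots> \<le> L2_set (\<lambda>c. A $$ c) ({..<a} \<times> {..<b}) + L2_set (\<lambda>c. - B $$ c) ({..<a} \<times> {..<b})"
    by (rule L2_set_triangle_ineq)
  also have "\<dots> = frobenius_norm A + frobenius_norm B"
    unfolding frobenius_norm_eq_L2_set[OF A] frobenius_norm_eq_L2_set[OF B]
    by (simp add: L2_set_def)
  finally show ?thesis .
qed

lemma frobenius_norm_mult_le:
  assumes A: "A \<in> carrier_mat a b" and B: "B \<in> carrier_mat b c"
  shows "frobenius_norm (A * B) \<le> frobenius_norm A * frobenius_norm B"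
proof (rule power2_le_imp_le)
  have "(frobenius_norm (A * B))\<^sup>2 = (\<Sum>i<a. \<Sum>j<c. (\<Sum>t<b. A $$ (i, t) * B $$ (t, j))\<^sup>2)"
    unfolding frobenius_norm_sq[OF mult_carrier_mat[OF A B]]
    by (intro sum.cong refl) (simp only: lessThan_iff index_mult_mat_sum[OF A B])
  also have "\<dots> \<le> (\<Sum>i<a. \<Sum>j<c. (\<Sum>t<b. (A $$ (i, t))\<^sup>2) * (\<Sum>t<b. (B $$ (t, j))\<^sup>2))"
    by (intro sum_mono Cauchy_Schwarz_ineq_sum)
  also have "\<dots> = (\<Sum>i<a. \<Sum>t<b. (A $$ (i, t))\<^sup>2) * (\<Sum>j<c. \<Sum>t<b. (B $$ (t, j))\<^sup>2)"
    by (rule sum_product[symmetric])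
  also have "(\<Sum>j<c. \<Sum>t<b. (B $$ (t, j))\<^sup>2) = (\<Sum>t<b. \<Sum>j<c. (B $$ (t, j))\<^sup>2)"
    by (rule sum.swap)
  finally show "(frobenius_norm (A * B))\<^sup>2 \<le> (frobenius_norm A * frobenius_norm B)\<^sup>2"
    unfolding power_mult_distrib frobenius_norm_sq[OF A] frobenius_norm_sq[OF B] .
qed (simp add: frobenius_norm_nonneg)

lemma frobenius_norm_transpose: "frobenius_norm (transpose_mat B) = frobenius_norm B"
proof -
  have "(\<Sum>i<dim_col B. \<Sum>j<dim_row B. (transpose_mat B $$ (i, j))\<^sup>2)
      = (\<Sum>i<dim_col B. \<Sum>j<dim_row B. (B $$ (j, i))\<^sup>2)"
    by (intro sum.cong refl) auto
  also have "\<dots> = (\<Sum>j<dim_row B. \<Sum>i<dim_col B. (B $$ (j, i))\<^sup>2)" by (rule sum.swap)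
  finally show ?thesis by (simp add: frobenius_norm_def)
qed

lemma orthonormal_cols_transpose_mult:
  assumes U: "U \<in> carrier_mat m r" "orthonormal_cols U" and E: "E \<in> carrier_mat r c"
  shows "transpose_mat U * (U * E) = E"
proof -
  have "transpose_mat U * (U * E) = transpose_mat U * U * E"
    using U(1) E by (intro assoc_mult_mat[symmetric]) auto
  also have "transpose_mat U * U = 1\<^sub>m r" using U by (simp add: orthonormal_cols_def)
  also have "1\<^sub>m r * E = E" by (rule left_mult_one_mat[OF E])
  finally show ?thesis .
qed

lemma frobenius_norm_orthonormal_mult:
  assumes U: "U \<in> carrier_mat m r" "orthonormal_cols U" and E: "E \<in> carrier_mat r c"
  shows "frobenius_norm (U * E) = frobenius_norm E"
proof -
  have "transpose_mat (U * E) * (U * E) = transpose_mat E * (transpose_mat U * (U * E))"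
    unfolding transpose_mult[OF U(1) E] using U(1) E by (intro assoc_mult_mat) auto
  then have "(frobenius_norm (U * E))\<^sup>2 = (frobenius_norm E)\<^sup>2"
    by (simp only: frobenius_norm_sq_trace orthonormal_cols_transpose_mult[OF assms])
  then show ?thesis by (simp add: frobenius_norm_nonneg)
qed

lemma frobenius_norm_mult_transpose_orthonormal:
  assumes V: "V \<in> carrier_mat n r" "orthonormal_cols V" and E: "E \<in> carrier_mat c r"
  shows "frobenius_norm (E * transpose_mat V) = frobenius_norm E"
proof -
  have "transpose_mat (E * transpose_mat V) = V * transpose_mat E"
    using V E by (subst transpose_mult) auto
  then show ?thesis
    using frobenius_norm_orthonormal_mult[OF V, of "transpose_mat E" c] E
      frobenius_norm_transpose[of "E * transpose_mat V"] frobenius_norm_transpose[of E] by simp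
qed

lemma frobenius_norm_diff_sq:
  assumes A: "A \<in> carrier_mat a b" and B: "B \<in> carrier_mat a b"
  shows "(frobenius_norm (A - B))\<^sup>2
      = (frobenius_norm A)\<^sup>2 + (frobenius_norm B)\<^sup>2 - 2 * trace_mat (transpose_mat B * A)"
proof -
  have "trace_mat (transpose_mat B * A) = (\<Sum>j<b. \<Sum>i<a. B $$ (i, j) * A $$ (i, j))"
    using A B by (auto simp: trace_mat_def scalar_prod_def atLeast0LessThan intro!: sum.cong)
  also have "\<dots> = (\<Sum>i<a. \<Sum>j<b. A $$ (i, j) * B $$ (i, j))"
    by (subst sum.swap) (simp add: mult.commute)
  finally show ?thesis
    using A B
    by (simp add: frobenius_norm_sq[OF A] frobenius_norm_sq[OF B]
        frobenius_norm_sq[OF minus_carrier_mat[OF B]]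
        power2_diff sum.distrib sum_subtractf sum_distrib_left mult.assoc)
qed

lemma frobenius_norm_residual_le:
  assumes Q: "Q \<in> carrier_mat m r" "orthonormal_cols Q" and B: "B \<in> carrier_mat m c"
  shows "frobenius_norm (B - Q * transpose_mat Q * B) \<le> frobenius_norm B"
proof -
  define C where "C = transpose_mat Q * B"
  have C: "C \<in> carrier_mat r c" using Q B by (simp add: C_def)
  have "transpose_mat (Q * C) * B = transpose_mat C * transpose_mat Q * B"
    by (simp only: transpose_mult[OF Q(1) C])
  also have "\<dots> = transpose_mat C * C"
    using assoc_mult_mat[of "transpose_mat C" c r "transpose_mat Q" m B c] Q B C
    by (simp add: C_def)
  finally have "(frobenius_norm (B - Q * C))\<^sup>2 = (frobenius_norm B)\<^sup>2 - (frobenius_norm C)\<^sup>2"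
    unfolding frobenius_norm_diff_sq[OF B mult_carrier_mat[OF Q(1) C]]
      frobenius_norm_orthonormal_mult[OF Q C]
    by (simp add: frobenius_norm_sq_trace)
  moreover have "Q * transpose_mat Q * B = Q * C"
    unfolding C_def using Q B by (intro assoc_mult_mat) auto
  ultimately have "(frobenius_norm (B - Q * transpose_mat Q * B))\<^sup>2 \<le> (frobenius_norm B)\<^sup>2" by simp
  then show ?thesis by (rule power2_le_imp_le) (rule frobenius_norm_nonneg)
qed

lemma economized_qr_residual_le:
  assumes qr: "economized_qr B Q R" and B: "B \<in> carrier_mat m l"
    and A: "A \<in> carrier_mat m n" and Z: "Z \<in> carrier_mat l n"
  shows "frobenius_norm (A - Q * transpose_mat Q * A) \<le> frobenius_norm (A - B * Z)"
proof -
  have Q: "Q \<in> carrier_mat m (min m l)" "orthonormal_cols Q" and R: "R \<in> carrier_mat (min m l) l"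
    and QR: "Q * R = B"
    using qr B by (auto simp: economized_qr_def)
  have P: "Q * transpose_mat Q \<in> carrier_mat m m" and BZ: "B * Z \<in> carrier_mat m n"
    using Q B Z by auto
  have "Q * transpose_mat Q * B = Q * (transpose_mat Q * (Q * R))"
    unfolding QR[symmetric] using Q R by (intro assoc_mult_mat) auto
  also have "\<dots> = B"
    unfolding orthonormal_cols_transpose_mult[OF Q R] by (rule QR)
  finally have "Q * transpose_mat Q * (B * Z) = B * Z"
    using assoc_mult_mat[OF P B Z] by simp
  then have "Q * transpose_mat Q * (A - B * Z) = Q * transpose_mat Q * A - B * Z"
    by (simp only: mult_minus_distrib_mat[OF P A BZ])
  moreover have "(A - C) - (E - C) = A - E" if "C \<in> carrier_mat m n" "E \<in> carrier_mat m n" for C E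
    using that A by (intro eq_matI) auto
  ultimately have "(A - B * Z) - Q * transpose_mat Q * (A - B * Z) = A - Q * transpose_mat Q * A"
    using BZ mult_carrier_mat[OF P A] by (simp only:)
  then show ?thesis
    using frobenius_norm_residual_le[OF Q minus_carrier_mat[OF BZ], of A] by simp
qed

lemma orthonormal_cols_select:
  assumes V: "V \<in> carrier_mat n r" "orthonormal_cols V"
    and f: "inj_on f {..<d}" "f ` {..<d} \<subseteq> {..<r}"
  shows "orthonormal_cols (Matrix.mat n d (\<lambda>(i, j). V $$ (i, f j)))"
  unfolding orthonormal_cols_def
proof (rule eq_matI)
  let ?W = "Matrix.mat n d (\<lambda>(i, j). V $$ (i, f j))"
  fix a b assume "a < dim_row (1\<^sub>m (dim_col ?W))" "b < dim_col (1\<^sub>m (dim_col ?W))"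
  then have ab: "a < d" "b < d" "f a < r" "f b < r" using f(2) by auto
  have "(transpose_mat ?W * ?W) $$ (a, b) = (transpose_mat V * V) $$ (f a, f b)"
    using V(1) ab by (auto simp: scalar_prod_def intro!: sum.cong)
  also have "\<dots> = of_bool (f a = f b)" using V ab by (simp add: orthonormal_cols_def)
  finally show "(transpose_mat ?W * ?W) $$ (a, b) = 1\<^sub>m (dim_col ?W) $$ (a, b)"
    using ab inj_onD[OF f(1)] by auto
qed auto

lemma V1_carrier: "V1_mat n k V \<in> carrier_mat n k"
  by (simp add: V1_mat_def)

lemma V2_carrier: "V2_mat n k V \<in> carrier_mat n (n - k)"
  by (simp add: V2_mat_def)

lemma Sigma2_carrier: "Sigma2_mat n k \<sigma> \<in> carrier_mat (n - k) (n - k)"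
  by (simp add: Sigma2_mat_def)

lemma orthonormal_cols_V1:
  assumes "V \<in> carrier_mat n n" "orthonormal_cols V" "k \<le> n"
  shows "orthonormal_cols (V1_mat n k V)"
  using orthonormal_cols_select[OF assms(1,2), of "\<lambda>j. j" k] assms(3) by (auto simp: V1_mat_def)

lemma orthonormal_cols_V2:
  assumes "V \<in> carrier_mat n n" "orthonormal_cols V"
  shows "orthonormal_cols (V2_mat n k V)"
  unfolding V2_mat_def by (rule orthonormal_cols_select[OF assms]) (auto simp: image_subset_iff)

lemma sum_lessThan_split:
  fixes f :: "nat \<Rightarrow> 'a :: comm_monoid_add"
  assumes "k \<le> n"
  shows "(\<Sum>i<n. f i) = (\<Sum>i<k. f i) + (\<Sum>i<n - k. f (k + i))"
  using assms sum.atLeastLessThan_concat[of 0 k n f] sum.atLeastLessThan_shift_0[of f k n]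
  by (simp add: atLeast0LessThan)

lemma frobenius_norm_diag_mult_eq_Sigma2:
  assumes V: "V \<in> carrier_mat n n" and Y: "Y \<in> carrier_mat n c" and k: "k \<le> n"
    and V1: "transpose_mat (V1_mat n k V) * Y = 0\<^sub>m k c"
  shows "frobenius_norm (mat_diag n (\<lambda>i. \<sigma> (i + 1)) * (transpose_mat V * Y))
    = frobenius_norm (Sigma2_mat n k \<sigma> * (transpose_mat (V2_mat n k V) * Y))"
    (is "frobenius_norm ?L = frobenius_norm ?R")
proof -
  define N where "N = transpose_mat V * Y"
  have N: "N \<in> carrier_mat n c" using V Y by (simp add: N_def)
  have N2: "transpose_mat (V2_mat n k V) * Y \<in> carrier_mat (n - k) c"
    using Y by (intro mult_carrier_mat) (simp_all add: V2_carrier)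
  have upper: "N $$ (i, j) = 0" if "i < k" "j < c" for i j
  proof -
    have "N $$ (i, j) = (transpose_mat (V1_mat n k V) * Y) $$ (i, j)"
      using that V Y k by (auto simp: N_def V1_mat_def scalar_prod_def intro!: sum.cong)
    then show ?thesis using that by (simp add: V1)
  qed
  have lower: "N $$ (k + i, j) = (transpose_mat (V2_mat n k V) * Y) $$ (i, j)"
    if "i < n - k" "j < c" for i j
    using that V Y by (auto simp: N_def V2_mat_def scalar_prod_def intro!: sum.cong)
  have L: "?L = Matrix.mat n c (\<lambda>(i, j). \<sigma> (i + 1) * N $$ (i, j))"
    unfolding N_def[symmetric] by (rule mat_diag_mult_left[OF N])
  have R: "?R = Matrix.mat (n - k) c (\<lambda>(i, j). \<sigma> (k + i + 1)
      * (transpose_mat (V2_mat n k V) * Y) $$ (i, j))"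
    unfolding Sigma2_mat_def by (rule mat_diag_mult_left[OF N2])
  have "(\<Sum>i<n. \<Sum>j<c. (\<sigma> (i + 1) * N $$ (i, j))\<^sup>2)
      = (\<Sum>i<n - k. \<Sum>j<c. (\<sigma> (k + i + 1) * (transpose_mat (V2_mat n k V) * Y) $$ (i, j))\<^sup>2)"
    unfolding sum_lessThan_split[OF k] by (simp add: upper lower del: index_mult_mat(1))
  then show ?thesis unfolding L R by (simp add: frobenius_norm_def del: index_mult_mat(1))
qed

lemma frobenius_norm_svd_mult:
  assumes k: "k \<le> n" and svd: "is_svd m n A U \<sigma> V" and Y: "Y \<in> carrier_mat n c"
    and V1: "transpose_mat (V1_mat n k V) * Y = 0\<^sub>m k c"
  shows "frobenius_norm (A * Y)
      = frobenius_norm (Sigma2_mat n k \<sigma> * transpose_mat (V2_mat n k V) * Y)"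
proof -
  define D where "D = mat_diag n (\<lambda>i. \<sigma> (i + 1))"
  have U: "U \<in> carrier_mat m n" "orthonormal_cols U" and V: "V \<in> carrier_mat n n"
    and A: "A = U * D * transpose_mat V"
    using svd by (auto simp: is_svd_def D_def)
  have D: "D \<in> carrier_mat n n" by (simp add: D_def)
  have "A * Y = U * D * (transpose_mat V * Y)"
    unfolding A using U D V Y by (intro assoc_mult_mat) auto
  also have "\<dots> = U * (D * (transpose_mat V * Y))"
    using U D V Y by (intro assoc_mult_mat) auto
  finally have "frobenius_norm (A * Y) = frobenius_norm (D * (transpose_mat V * Y))"
    using frobenius_norm_orthonormal_mult[OF U, of "D * (transpose_mat V * Y)" c] D V Y by simp
  also have "\<dots> = frobenius_norm (Sigma2_mat n k \<sigma> * (transpose_mat (V2_mat n k V) * Y))"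
    unfolding D_def by (rule frobenius_norm_diag_mult_eq_Sigma2[OF V Y k V1])
  also have "Sigma2_mat n k \<sigma> * (transpose_mat (V2_mat n k V) * Y)
      = Sigma2_mat n k \<sigma> * transpose_mat (V2_mat n k V) * Y"
    by (rule assoc_mult_mat[OF Sigma2_carrier _ Y, symmetric]) (simp add: V2_carrier)
  finally show ?thesis .
qed

lemma mult_one_minus_mat:
  fixes B X Z :: "real mat"
  assumes B: "B \<in> carrier_mat b n" and X: "X \<in> carrier_mat n l" and Z: "Z \<in> carrier_mat l n"
  shows "B * (1\<^sub>m n - X * Z) = B - B * X * Z"
  using mult_minus_distrib_mat[OF B one_carrier_mat mult_carrier_mat[OF X Z]]
    assoc_mult_mat[OF B X Z] B
  by simp

lemma sketch_error_bound:
  assumes k: "k \<le> n" and svd: "is_svd m n A U \<sigma> V" and X: "X \<in> carrier_mat n l"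
    and qr: "economized_qr (A * X) Q R"
    and G: "G \<in> carrier_mat l k" and right_inverse: "transpose_mat (V1_mat n k V) * X * G = 1\<^sub>m k"
  shows "frobenius_norm (A - Q * transpose_mat Q * A)
    \<le> frobenius_norm (Sigma2_mat n k \<sigma>)
      + frobenius_norm (Sigma2_mat n k \<sigma> * transpose_mat (V2_mat n k V) * X) * frobenius_norm G"
proof -
  define W where "W = V1_mat n k V"
  define L where "L = Sigma2_mat n k \<sigma> * transpose_mat (V2_mat n k V)"
  define Z where "Z = G * transpose_mat W"
  define Y where "Y = 1\<^sub>m n - X * Z"
  have V: "V \<in> carrier_mat n n" "orthonormal_cols V" and A: "A \<in> carrier_mat m n"
    using svd by (auto simp: is_svd_def)
  have W: "W \<in> carrier_mat n k" "orthonormal_cols W"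
    using V k by (simp_all add: W_def V1_carrier orthonormal_cols_V1)
  have L: "L \<in> carrier_mat (n - k) n"
    using Sigma2_carrier[of n k \<sigma>] V2_carrier[of n k V] by (auto simp: L_def)
  have Z: "Z \<in> carrier_mat l n" using G W by (simp add: Z_def)
  have Y: "Y \<in> carrier_mat n n" unfolding Y_def using X Z by (intro minus_carrier_mat) simp
  have mult_Y: "B * Y = B - B * X * G * transpose_mat W" if B: "B \<in> carrier_mat b n" for b and B
  proof -
    have "B * X * Z = B * X * G * transpose_mat W"
      unfolding Z_def using B X G W by (intro assoc_mult_mat[symmetric]) auto
    then show ?thesis by (simp only: Y_def mult_one_minus_mat[OF B X Z])
  qed
  have "transpose_mat W * Y = 0\<^sub>m k n"
    using mult_Y[of "transpose_mat W" k] W right_inverse by (simp add: W_def)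
  then have "frobenius_norm (A * Y) = frobenius_norm (L * Y)"
    unfolding W_def L_def by (rule frobenius_norm_svd_mult[OF k svd Y])
  also have "\<dots> = frobenius_norm (L - L * X * G * transpose_mat W)"
    by (simp only: mult_Y[OF L])
  also have "\<dots> \<le> frobenius_norm L + frobenius_norm (L * X * G * transpose_mat W)"
    using L X G W by (intro frobenius_norm_diff_le) auto
  also have "frobenius_norm L = frobenius_norm (Sigma2_mat n k \<sigma>)"
    unfolding L_def
    by (rule frobenius_norm_mult_transpose_orthonormal[OF V2_carrier orthonormal_cols_V2[OF V]
          Sigma2_carrier])
  also have "frobenius_norm (L * X * G * transpose_mat W) = frobenius_norm (L * X * G)"
    using L X G by (intro frobenius_norm_mult_transpose_orthonormal[OF W]) auto
  also have "\<dots> \<le> frobenius_norm (L * X) * frobenius_norm G"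
    using L X by (intro frobenius_norm_mult_le[OF _ G]) auto
  finally have "frobenius_norm (A * Y)
      \<le> frobenius_norm (Sigma2_mat n k \<sigma>) + frobenius_norm (L * X) * frobenius_norm G" by simp
  moreover have "A * Y = A - A * X * Z" unfolding Y_def by (rule mult_one_minus_mat[OF A X Z])
  ultimately show ?thesis
    using economized_qr_residual_le[OF qr _ A Z] A X by (simp add: L_def)
qed

section \<open>The probabilistic error bound\<close>

lemma mat_inverse_invertible:
  fixes S :: "real mat"
  assumes S: "S \<in> carrier_mat k k" and inv: "invertible_mat S"
  shows "the (mat_inverse S) \<in> carrier_mat k k" and "S * the (mat_inverse S) = 1\<^sub>m k"
proof -
  obtain B where B: "S * B = 1\<^sub>m (dim_row S)" "B * S = 1\<^sub>m (dim_row B)"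
    using inv by (auto simp: invertible_mat_def inverts_mat_def)
  have "dim_col B = k" using arg_cong[OF B(1), of dim_col] S by simp
  moreover have "dim_row B = k" using arg_cong[OF B(2), of dim_col] S by simp
  ultimately have "B \<in> carrier_mat k k" by auto
  then have "S \<in> Units (ring_mat TYPE(real) k ())"
    using S B by (auto simp: Units_def ring_mat_def intro!: bexI[of _ B])
  then obtain C where "mat_inverse S = Some C"
    using mat_inverse(1)[OF S, of "()"] by (cases "mat_inverse S") auto
  then show "the (mat_inverse S) \<in> carrier_mat k k" "S * the (mat_inverse S) = 1\<^sub>m k"
    using mat_inverse(2)[OF S] by auto
qed

lemma index_gram_mat:
  assumes L: "L \<in> carrier_mat n d" and K: "K \<in> carrier_mat n n" and ab: "a < d" "b < d"
  shows "(transpose_mat L * K * L) $$ (a, b) = bilin n K (\<lambda>i. L $$ (i, a)) (\<lambda>i. L $$ (i, b))"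
proof -
  have Lt: "transpose_mat L \<in> carrier_mat d n" using L by simp
  have "(transpose_mat L * K * L) $$ (a, b)
      = (\<Sum>j<n. (\<Sum>i<n. L $$ (i, a) * K $$ (i, j)) * L $$ (j, b))"
    unfolding index_mult_mat_sum[OF mult_carrier_mat[OF Lt K] L ab]
    using L ab by (intro sum.cong refl arg_cong2[where f="(*)"])
      (simp add: index_mult_mat_sum[OF Lt K] del: index_mult_mat(1))
  also have "\<dots> = bilin n K (\<lambda>i. L $$ (i, a)) (\<lambda>i. L $$ (i, b))"
    unfolding bilin_def sum_distrib_right by (subst sum.swap) (simp add: mult_ac)
  finally show ?thesis .
qed

lemma trace_gram_mat:
  assumes L: "L \<in> carrier_mat n d" and K: "K \<in> carrier_mat n n"
  shows "trace_mat (transpose_mat L * K * L)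
      = (\<Sum>a<d. bilin n K (\<lambda>i. L $$ (i, a)) (\<lambda>i. L $$ (i, a)))"
  using L by (simp add: trace_mat_def index_gram_mat[OF L K] del: index_mult_mat(1))

lemma right_inverse_of_dual_family:
  fixes B :: "real mat"
  assumes B: "B \<in> carrier_mat k l"
    and dual: "\<And>i a. i < k \<Longrightarrow> a < k \<Longrightarrow> dotp l (g i) (\<lambda>j. B $$ (a, j)) = of_bool (i = a)"
  shows "\<exists>G\<in>carrier_mat l k. B * G = 1\<^sub>m k \<and> (frobenius_norm G)\<^sup>2 = (\<Sum>i<k. dotp l (g i) (g i))"
proof (intro bexI conjI)
  let ?G = "Matrix.mat l k (\<lambda>(j, i). g i j)"
  show G: "?G \<in> carrier_mat l k" by simp
  have "(B * ?G) $$ (a, i) = of_bool (i = a)" if "a < k" "i < k" for a i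
    unfolding index_mult_mat_sum[OF B G that] dual[OF that(2,1), symmetric] dotp_def
    using that by (simp add: mult.commute)
  then show "B * ?G = 1\<^sub>m k"
    using B by (intro eq_matI) (auto simp del: index_mult_mat(1))
  show "(frobenius_norm ?G)\<^sup>2 = (\<Sum>i<k. dotp l (g i) (g i))"
    unfolding frobenius_norm_sq[OF G] by (subst sum.swap) (simp add: dotp_def power2_eq_square)
qed

context gaussian_columns
begin

lemma index_transpose_mult_\<Omega>:
  assumes L: "L \<in> carrier_mat n d" and \<omega>: "\<omega> \<in> space M" and "a < d" and "j < l"
  shows "(transpose_mat L * \<Omega> \<omega>) $$ (a, j) = sketch (\<lambda>i. L $$ (i, a)) \<omega> j"
  using index_mult_mat_sum[of "transpose_mat L" d n "\<Omega> \<omega>" l a j] assms carrier_\<Omega>[OF \<omega>]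
  by (simp add: sketch_def)

lemma frobenius_norm_sketch_tail:
  assumes L: "L \<in> carrier_mat n d" and u: "1 \<le> u"
  shows "\<exists>F\<in>sets M. prob F \<le> (u * exp (- (u\<^sup>2 - 1) / 2)) ^ l \<and>
    (\<forall>\<omega>\<in>space M - F. (frobenius_norm (transpose_mat L * \<Omega> \<omega>))\<^sup>2
      \<le> u\<^sup>2 * (l * trace_mat (transpose_mat L * K * L)))"
proof (intro bexI conjI ballI)
  let ?w = "\<lambda>a i. L $$ (i, a)"
  let ?T = "\<Sum>a<d. bilin n K (?w a) (?w a)"
  let ?F = "{\<omega> \<in> space M. u\<^sup>2 * (l * ?T) < (\<Sum>j<l. \<Sum>a<d. (sketch (?w a) \<omega> j)\<^sup>2)}"
  show "?F \<in> sets M" by measurable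
  show "prob ?F \<le> (u * exp (- (u\<^sup>2 - 1) / 2)) ^ l"
    by (rule sum_squares_sketch_tail[OF _ u]) simp
  fix \<omega> assume \<omega>: "\<omega> \<in> space M - ?F"
  have "transpose_mat L * \<Omega> \<omega> \<in> carrier_mat d l" using L \<omega> carrier_\<Omega>[of \<omega>] by auto
  then have "(frobenius_norm (transpose_mat L * \<Omega> \<omega>))\<^sup>2 = (\<Sum>a<d. \<Sum>j<l. (sketch (?w a) \<omega> j)\<^sup>2)"
    using \<omega> by (simp add: frobenius_norm_sq index_transpose_mult_\<Omega>[OF L] del: index_mult_mat(1))
  also have "\<dots> = (\<Sum>j<l. \<Sum>a<d. (sketch (?w a) \<omega> j)\<^sup>2)" by (rule sum.swap)
  also have "\<dots> \<le> u\<^sup>2 * (l * ?T)" using \<omega> by auto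
  also have "?T = trace_mat (transpose_mat L * K * L)"
    using psd by (intro trace_gram_mat[symmetric] L) (simp add: sym_psd_mat_def)
  finally show "(frobenius_norm (transpose_mat L * \<Omega> \<omega>))\<^sup>2
      \<le> u\<^sup>2 * (l * trace_mat (transpose_mat L * K * L))" .
qed

lemma right_inverse_sketch_tail:
  assumes L: "L \<in> carrier_mat n k" and inv: "invertible_mat (transpose_mat L * K * L)"
    and k: "1 \<le> k" and l: "l = k + p" and p: "4 \<le> p" and t: "1 \<le> t"
  shows "\<exists>F\<in>sets M. prob F \<le> 1 / t ^ p \<and> (\<forall>\<omega>\<in>space M - F. \<exists>G\<in>carrier_mat l k.
    transpose_mat L * \<Omega> \<omega> * G = 1\<^sub>m k \<and>
    (frobenius_norm G)\<^sup>2
      \<le> t\<^sup>2 * (3 / (real p + 1)) * trace_mat (the (mat_inverse (transpose_mat L * K * L))))"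
proof -
  let ?w = "\<lambda>a i. L $$ (i, a)"
  define S where "S = transpose_mat L * K * L"
  define C where "C = the (mat_inverse S)"
  have K: "K \<in> carrier_mat n n" using psd by (simp add: sym_psd_mat_def)
  have S: "S \<in> carrier_mat k k" using L K by (auto simp: S_def)
  have C: "C \<in> carrier_mat k k" "S * C = 1\<^sub>m k"
    using mat_inverse_invertible[OF S] inv by (auto simp: C_def S_def)
  have "(\<Sum>c<k. bilin n K (?w a) (?w c) * C $$ (c, b)) = of_bool (a = b)" if "a < k" "b < k" for a b
  proof -
    have "(\<Sum>c<k. bilin n K (?w a) (?w c) * C $$ (c, b)) = (S * C) $$ (a, b)"
      unfolding index_mult_mat_sum[OF S C(1) that] unfolding S_def
      using that by (simp add: index_gram_mat[OF L K] del: index_mult_mat(1))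
    then show ?thesis using that by (simp add: C(2))
  qed
  then obtain F where F: "F \<in> sets M" "prob F \<le> 1 / t ^ p"
    and dual: "\<And>\<omega>. \<omega> \<in> space M - F \<Longrightarrow>
      \<exists>g. (\<forall>i<k. \<forall>a<k. dotp l (g i) (sketch (?w a) \<omega>) = of_bool (i = a)) \<and>
      (\<Sum>i<k. dotp l (g i) (g i)) \<le> t\<^sup>2 * (3 / (real p + 1)) * (\<Sum>i<k. C $$ (i, i))"
    using dual_family_sketch_tail[of "{..<k}" p t ?w "\<lambda>c i. C $$ (c, i)"] k l p t
    by (auto simp: Ball_def lessThan_empty_iff)
  have "\<exists>G\<in>carrier_mat l k. transpose_mat L * \<Omega> \<omega> * G = 1\<^sub>m k \<and>
      (frobenius_norm G)\<^sup>2 \<le> t\<^sup>2 * (3 / (real p + 1)) * trace_mat C" if \<omega>: "\<omega> \<in> space M - F" for \<omega>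
  proof -
    obtain g where g: "\<And>i a. i < k \<Longrightarrow> a < k \<Longrightarrow> dotp l (g i) (sketch (?w a) \<omega>) = of_bool (i = a)"
      and norm: "(\<Sum>i<k. dotp l (g i) (g i)) \<le> t\<^sup>2 * (3 / (real p + 1)) * (\<Sum>i<k. C $$ (i, i))"
      using dual[OF \<omega>] by blast
    have L\<Omega>: "transpose_mat L * \<Omega> \<omega> \<in> carrier_mat k l" using L \<omega> carrier_\<Omega>[of \<omega>] by auto
    have "\<exists>G\<in>carrier_mat l k. transpose_mat L * \<Omega> \<omega> * G = 1\<^sub>m k \<and>
        (frobenius_norm G)\<^sup>2 = (\<Sum>i<k. dotp l (g i) (g i))"
    proof (rule right_inverse_of_dual_family[OF L\<Omega>])
      fix i a assume "i < k" "a < k"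
      moreover from this have "dotp l (g i) (\<lambda>j. (transpose_mat L * \<Omega> \<omega>) $$ (a, j))
          = dotp l (g i) (sketch (?w a) \<omega>)"
        using \<omega> by (simp add: dotp_def index_transpose_mult_\<Omega>[OF L] del: index_mult_mat(1))
      ultimately show "dotp l (g i) (\<lambda>j. (transpose_mat L * \<Omega> \<omega>) $$ (a, j)) = of_bool (i = a)"
        using g by simp
    qed
    then show ?thesis using norm C(1) by (auto simp: trace_mat_def)
  qed
  then show ?thesis using F unfolding C_def S_def by blast
qed

end

lemma frobenius_norm_Sigma2: "frobenius_norm (Sigma2_mat n k \<sigma>) = sqrt (\<Sum>j=k+1..n. (\<sigma> j)\<^sup>2)"
proof -
  have "(frobenius_norm (Sigma2_mat n k \<sigma>))\<^sup>2
      = (\<Sum>i<n - k. \<Sum>j<n - k. if i = j then (\<sigma> (k + i + 1))\<^sup>2 else 0)"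
    unfolding frobenius_norm_sq[OF Sigma2_carrier]
    by (intro sum.cong refl) (auto simp: Sigma2_mat_def mat_diag_def)
  also have "\<dots> = (\<Sum>i<n - k. (\<sigma> (k + 1 + i))\<^sup>2)" by simp
  also have "\<dots> = (\<Sum>j=k+1..n. (\<sigma> j)\<^sup>2)"
    by (rule sum.reindex_bij_witness[of _ "\<lambda>j. j - (k + 1)" "\<lambda>i. k + 1 + i"]) auto
  finally show ?thesis by (metis frobenius_norm_nonneg real_sqrt_unique)
qed

lemma trace_Sigma2_V2:
  fixes V :: "real mat" and \<sigma> :: "nat \<Rightarrow> real" and k :: nat
  assumes K: "K \<in> carrier_mat n n"
  defines "L \<equiv> Sigma2_mat n k \<sigma> * transpose_mat (V2_mat n k V)"
  shows "trace_mat (Sigma2_mat n k \<sigma> * Sigma2_mat n k \<sigma> * transpose_mat (V2_mat n k V) * K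
      * V2_mat n k V)
    = trace_mat (L * K * transpose_mat L)"
proof -
  let ?S = "Sigma2_mat n k \<sigma>" and ?V = "V2_mat n k V"
  have S: "?S \<in> carrier_mat (n - k) (n - k)" and V: "?V \<in> carrier_mat n (n - k)"
    and Vt: "transpose_mat ?V \<in> carrier_mat (n - k) n"
    by (simp_all add: Sigma2_carrier V2_carrier)
  have L: "L \<in> carrier_mat (n - k) n" unfolding L_def by (rule mult_carrier_mat[OF S Vt])
  have LK: "L * K \<in> carrier_mat (n - k) n" by (rule mult_carrier_mat[OF L K])
  have "?S * ?S * transpose_mat ?V * K * ?V = ?S * (L * K * ?V)"
    by (simp only: assoc_mult_mat[OF S S Vt] L_def[symmetric] assoc_mult_mat[OF S L K]
          assoc_mult_mat[OF S LK V])
  also have "trace_mat \<dots> = trace_mat (L * K * ?V * ?S)"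
    by (rule trace_mat_mult_commute[OF S mult_carrier_mat[OF LK V]])
  also have "L * K * ?V * ?S = L * K * (?V * ?S)"
    by (rule assoc_mult_mat[OF LK V S])
  also have "?V * ?S = transpose_mat L"
  proof -
    have "transpose_mat ?S = ?S" by (rule eq_matI) (auto simp: Sigma2_mat_def mat_diag_def)
    then show ?thesis by (simp add: L_def transpose_mult[OF S Vt])
  qed
  finally show ?thesis .
qed

lemma error_factor_mult_eq:
  fixes u t N T \<theta> c \<Phi> :: real and k p :: nat
  assumes "0 \<le> u" and "0 \<le> t" and "0 < c" and "0 < \<Phi>" and "1 \<le> k"
  shows
    "(1 + u * t * sqrt (N * (3 * real k / (real p + 1)) * (T / (c * \<Phi>\<^sup>2) / (real k / (c * \<theta>))))) * \<Phi>
    = \<Phi> + sqrt (u\<^sup>2 * (N * T)) * sqrt (t\<^sup>2 * (3 / (real p + 1)) * \<theta>)"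
proof -
  have "T / (c * \<Phi>\<^sup>2) / (real k / (c * \<theta>)) = T * \<theta> / (real k * \<Phi>\<^sup>2)"
    using assms by simp
  then have "sqrt (N * (3 * real k / (real p + 1)) * (T / (c * \<Phi>\<^sup>2) / (real k / (c * \<theta>)))) * \<Phi>
      = sqrt (N * (3 * real k / (real p + 1)) * (T * \<theta> / (real k * \<Phi>\<^sup>2))) * sqrt (\<Phi>\<^sup>2)"
    using assms by simp
  also have "\<dots> = sqrt (N * T * (3 / (real p + 1)) * \<theta>)"
    unfolding real_sqrt_mult[symmetric] using assms by simp
  finally have "sqrt (N * (3 * real k / (real p + 1)) * (T / (c * \<Phi>\<^sup>2) / (real k / (c * \<theta>)))) * \<Phi>
      = sqrt (N * T * (3 / (real p + 1)) * \<theta>)" .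
  moreover have "sqrt (u\<^sup>2 * (N * T)) * sqrt (t\<^sup>2 * (3 / (real p + 1)) * \<theta>)
      = u * t * sqrt (N * T * (3 / (real p + 1)) * \<theta>)"
  proof -
    have "sqrt (u\<^sup>2 * (N * T)) * sqrt (t\<^sup>2 * (3 / (real p + 1)) * \<theta>)
        = sqrt ((u * t)\<^sup>2 * (N * T * (3 / (real p + 1)) * \<theta>))"
      unfolding real_sqrt_mult[symmetric] by (simp add: power_mult_distrib mult_ac)
    also have "\<dots> = u * t * sqrt (N * T * (3 / (real p + 1)) * \<theta>)"
      using assms by (simp only: real_sqrt_mult[of "(u * t)\<^sup>2"]) simp
    finally show ?thesis .
  qed
  ultimately show ?thesis by (simp add: distrib_right mult.assoc)
qed

lemma sketch_error_bound_beta_gamma: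
  fixes u t lam1 :: real
  assumes svd: "is_svd m n A U \<sigma> V" and K: "K \<in> carrier_mat n n" and k: "1 \<le> k" "k \<le> n"
    and X: "X \<in> carrier_mat n l" and qr: "economized_qr (A * X) Q R"
    and lam1: "0 < lam1" and Sigma2: "Sigma2_mat n k \<sigma> \<noteq> 0\<^sub>m (n - k) (n - k)" and ut: "0 \<le> u" "0 \<le> t"
    and G: "G \<in> carrier_mat l k" "transpose_mat (V1_mat n k V) * X * G = 1\<^sub>m k"
  defines "L \<equiv> Sigma2_mat n k \<sigma> * transpose_mat (V2_mat n k V)"
    and "S \<equiv> transpose_mat (V1_mat n k V) * K * V1_mat n k V"
  assumes norm_L: "(frobenius_norm (L * X))\<^sup>2 \<le> u\<^sup>2 * (l * trace_mat (L * K * transpose_mat L))"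
    and norm_G: "(frobenius_norm G)\<^sup>2 \<le> t\<^sup>2 * (3 / (real p + 1)) * trace_mat (the (mat_inverse S))"
  shows "frobenius_norm (A - Q * transpose_mat Q * A)
    \<le> (1 + u * t * sqrt (real l * (3 * real k / (real p + 1))
          * (beta_k n k \<sigma> V K lam1 / gamma_k n k V K lam1)))
      * sqrt (\<Sum>j=k+1..n. (\<sigma> j)\<^sup>2)"
proof -
  let ?\<Phi> = "frobenius_norm (Sigma2_mat n k \<sigma>)"
  have \<Phi>: "0 < ?\<Phi>"
    using Sigma2 frobenius_norm_eq_0_iff[OF Sigma2_carrier] frobenius_norm_nonneg
    by (simp add: less_le)
  have "frobenius_norm (A - Q * transpose_mat Q * A)
      \<le> ?\<Phi> + frobenius_norm (L * X) * frobenius_norm G"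
    unfolding L_def by (rule sketch_error_bound[OF k(2) svd X qr G])
  also have "\<dots> \<le> ?\<Phi> + sqrt (u\<^sup>2 * (l * trace_mat (L * K * transpose_mat L)))
      * sqrt (t\<^sup>2 * (3 / (real p + 1)) * trace_mat (the (mat_inverse S)))"
    using norm_L norm_G by (intro add_left_mono mult_mono real_le_rsqrt real_sqrt_ge_zero)
      (auto simp: frobenius_norm_nonneg intro: order_trans[OF zero_le_power2])
  also have "\<dots> = (1 + u * t * sqrt (real l * (3 * real k / (real p + 1))
      * (beta_k n k \<sigma> V K lam1 / gamma_k n k V K lam1))) * ?\<Phi>"
    unfolding beta_k_def gamma_k_def trace_Sigma2_V2[OF K] L_def[symmetric] S_def[symmetric]
    by (rule error_factor_mult_eq[OF ut lam1 \<Phi> k(1), symmetric])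
  finally show ?thesis by (simp only: frobenius_norm_Sigma2)
qed

lemma Sigma2_nonzero_imp_less:
  assumes "Sigma2_mat n k \<sigma> \<noteq> 0\<^sub>m (n - k) (n - k)"
  shows "k < n"
  using assms by (rule contrapos_np) (auto simp: Sigma2_mat_def mat_diag_def)

lemma (in gaussian_columns) sketch_error_tail:
  fixes A U V :: "real mat" and Q R :: "'w \<Rightarrow> real mat" and \<sigma> :: "nat \<Rightarrow> real" and u t lam1 :: real
  assumes svd: "is_svd m n A U \<sigma> V" and k: "1 \<le> k" "k \<le> n" and p: "4 \<le> p" and l: "l = k + p"
    and invertible: "invertible_mat (transpose_mat (V1_mat n k V) * K * V1_mat n k V)"
    and lam1: "0 < lam1" and Sigma2: "Sigma2_mat n k \<sigma> \<noteq> 0\<^sub>m (n - k) (n - k)"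
    and qr: "\<And>\<omega>. \<omega> \<in> space M \<Longrightarrow> economized_qr (A * \<Omega> \<omega>) (Q \<omega>) (R \<omega>)"
    and u: "1 \<le> u" and t: "1 \<le> t"
  shows "\<exists>F\<in>sets M.
    {\<omega> \<in> space M.
       \<not> frobenius_norm (A - Q \<omega> * transpose_mat (Q \<omega>) * A)
           \<le> (1 + u * t * sqrt (real l * (3 * real k / (real p + 1))
                 * (beta_k n k \<sigma> V K lam1 / gamma_k n k V K lam1)))
             * sqrt (\<Sum>j=k+1..n. (\<sigma> j)\<^sup>2)} \<subseteq> F \<and>
    prob F \<le> 1 / t ^ p + (u * exp (- (u\<^sup>2 - 1) / 2)) ^ l"
    (is "\<exists>F\<in>sets M. {\<omega> \<in> space M. \<not> ?good \<omega>} \<subseteq> F \<and> _")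
proof -
  let ?L = "Sigma2_mat n k \<sigma> * transpose_mat (V2_mat n k V)" and ?V1 = "V1_mat n k V"
  have K: "K \<in> carrier_mat n n" using psd by (simp add: sym_psd_mat_def)
  have "transpose_mat ?L \<in> carrier_mat n (n - k)"
    using mult_carrier_mat[OF Sigma2_carrier, of "transpose_mat (V2_mat n k V)"] V2_carrier by simp
  from frobenius_norm_sketch_tail[OF this u] obtain F
    where F: "F \<in> events" "prob F \<le> (u * exp (- (u\<^sup>2 - 1) / 2)) ^ l"
    and norm_L: "\<And>\<omega>. \<omega> \<in> space M - F \<Longrightarrow> (frobenius_norm (?L * \<Omega> \<omega>))\<^sup>2
      \<le> u\<^sup>2 * (l * trace_mat (?L * K * transpose_mat ?L))"
    by auto
  from right_inverse_sketch_tail[OF V1_carrier invertible k(1) l p t] obtain H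
    where H: "H \<in> events" "prob H \<le> 1 / t ^ p"
    and G: "\<And>\<omega>. \<omega> \<in> space M - H \<Longrightarrow> \<exists>G\<in>carrier_mat l k. transpose_mat ?V1 * \<Omega> \<omega> * G = 1\<^sub>m k \<and>
      (frobenius_norm G)\<^sup>2
        \<le> t\<^sup>2 * (3 / (real p + 1)) * trace_mat (the (mat_inverse (transpose_mat ?V1 * K * ?V1)))"
    by blast
  have "?good \<omega>" if \<omega>: "\<omega> \<in> space M" "\<omega> \<notin> H" "\<omega> \<notin> F" for \<omega>
  proof -
    obtain G where "G \<in> carrier_mat l k" "transpose_mat ?V1 * \<Omega> \<omega> * G = 1\<^sub>m k"
      "(frobenius_norm G)\<^sup>2
          \<le> t\<^sup>2 * (3 / (real p + 1)) * trace_mat (the (mat_inverse (transpose_mat ?V1 * K * ?V1)))"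
      using G \<omega> by blast
    then show ?thesis
      using \<omega> norm_L u t
      by (intro sketch_error_bound_beta_gamma[OF svd K k carrier_\<Omega> qr lam1 Sigma2]) auto
  qed
  then have "{\<omega> \<in> space M. \<not> ?good \<omega>} \<subseteq> H \<union> F" by blast
  moreover have "prob (H \<union> F) \<le> 1 / t ^ p + (u * exp (- (u\<^sup>2 - 1) / 2)) ^ l"
    using measure_Un_le[OF H(1) F(1)] H(2) F(2) by linarith
  ultimately show ?thesis using H(1) F(1) by (intro bexI[of _ "H \<union> F"]) auto
qed

theorem theorem3p1:
  fixes m n k p :: nat
    and A U V K :: "real mat"
    and \<sigma> lam :: "nat \<Rightarrow> real"
    and M :: "'w measure"
    and \<Omega> Q R :: "'w \<Rightarrow> real mat"
  assumes "1 \<le> n" and "n \<le> m" and "1 \<le> k" and "4 \<le> p"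
    and "A \<in> carrier_mat m n"
    and "is_svd m n A U \<sigma> V"
    and "sym_psd_mat n K"
    and "eigenvalues_decreasing n K lam"
    and "0 < lam k"
    and "invertible_mat (transpose_mat (V1_mat n k V) * K * V1_mat n k V)"
    and "Sigma2_mat n k \<sigma> \<noteq> 0\<^sub>m (n - k) (n - k)"
    and "prob_space M"
    and "gaussian_random_matrix M n (k + p) \<Omega> K"
    and "\<And>\<omega>. \<omega> \<in> space M \<Longrightarrow> economized_qr (A * \<Omega> \<omega>) (Q \<omega>) (R \<omega>)"
  shows "\<forall>u\<ge>1. \<forall>t\<ge>1. \<exists>F\<in>sets M.
    {\<omega> \<in> space M.
       \<not> frobenius_norm (A - Q \<omega> * transpose_mat (Q \<omega>) * A)
           \<le> (1 + u * t * sqrt (real (k + p) * (3 * real k / (real p + 1))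
                 * (beta_k n k \<sigma> V K (lam 1) / gamma_k n k V K (lam 1))))
             * sqrt (\<Sum>j=k+1..n. (\<sigma> j)\<^sup>2)} \<subseteq> F \<and>
    measure M F \<le> 1 / t ^ p + (u * exp (- (u\<^sup>2 - 1) / 2)) ^ (k + p)"
proof (intro allI impI)
  fix u t :: real assume "1 \<le> u" and "1 \<le> t"
  interpret gaussian_columns M n "k + p" \<Omega> K
    using assms by (simp add: gaussian_columns_def gaussian_columns_axioms_def)
  have "k < n" by (rule Sigma2_nonzero_imp_less) fact
  then have "lam k \<le> lam 1" using assms(3,8) by (simp add: eigenvalues_decreasing_def)
  then have "0 < lam 1" using assms(9) by linarith
  show "\<exists>F\<in>sets M.
    {\<omega> \<in> space M.
       \<not> frobenius_norm (A - Q \<omega> * transpose_mat (Q \<omega>) * A)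
           \<le> (1 + u * t * sqrt (real (k + p) * (3 * real k / (real p + 1))
                 * (beta_k n k \<sigma> V K (lam 1) / gamma_k n k V K (lam 1))))
             * sqrt (\<Sum>j=k+1..n. (\<sigma> j)\<^sup>2)} \<subseteq> F \<and>
    measure M F \<le> 1 / t ^ p + (u * exp (- (u\<^sup>2 - 1) / 2)) ^ (k + p)"
    by (rule sketch_error_tail) (use assms \<open>k < n\<close> \<open>0 < lam 1\<close> \<open>1 \<le> u\<close> \<open>1 \<le> t\<close> in auto)
qed

end
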